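(* Let $M$ be as in the context (a closed connected orientable $C^\infty$ manifold of dimension $n\ge 2$ with volume form $\omega$ and a fixed finite regular conservative atlas). Then, there is a constant $\chi>0$ (depending only on the atlas of $M$) such that: given - any $\epsilon>0$; - any $v\in\mathfrak{X}_\mu^{s,\beta}(M)$, $s\in\mathbb{Z}^+\cup\{\infty\}$, $0\le\beta\le1$; - any finite set $\Sigma\subset M$; - any neighbourhood $U$ of $\Sigma$; - any traceless linear maps $A_x\in L(n,\mathbb{R})$, $x\in\Sigma$, satisfying $\|A_x-Dv(x)\|<\chi\epsilon$, where $Dv(x)$ is taken in some local chart $(V_x,\phi_x)$ of the atlas around $x$, there exists $Z\in\mathfrak{X}_\mu^{s,\beta}(M)$ satisfying: (1) for each $x\in\Sigma$, on the local chart $(V_x,\phi_x)$, $Z(y)=v(x)+A_x(y-x)$ for $y$ near $x$; (2) $Z=v$ in $U^{c}=M\setminus U$; (3) $\|Z-v\|_{C^1}<\epsilon$.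
   Context: Standing setting: $M$ is a second countable, Hausdorff, connected, orientable, closed (compact without boundary) $C^\infty$ manifold of dimension $n\ge 2$, equipped with a $C^\infty$ volume form $\omega$ and a fixed finite atlas $(V_i,\phi_i)_{i\le m}$ that is conservative (each $\phi_i$ pushes $\omega$ forward to the canonical volume form of $\mathbb{R}^n$, and $\phi_i(V_i)=\lambda\mathbb{B}^n$ for some constant $\lambda>0$, where $\mathbb{B}^n$ is the open unit ball) and regular (there is a larger conservative atlas $(W_i,\Phi_i)_{i\le m}$ with $\overline{V_i}\subset W_i$ and $\Phi_i|_{V_i}=\phi_i$). $\mu$ is the Lebesgue measure induced by $\omega$. For $s\in\mathbb{Z}^+$ and $0<\beta\le1$, $\mathfrak{X}^{s,\beta}(M)$ is the space of $C^s$ vector fields on $M$ such that, on local charts, each partial derivative of order $s$ is $\beta$-Hölder continuous. Conventions: $C^{s,0}:=C^s$, $C^{\infty,\beta}:=C^\infty$. $\mathfrak{X}^{s,\beta}_\mu(M)$ is the subspace of vector fields that are divergence-free with respect to $\omega$. $L(n,\mathbb{R})$ is the space of linear maps $\mathbb{R}^n\to\mathbb{R}^n$ and $\|\cdot\|$ the operator norm for the Euclidean norm. A point $x\in M$ is identified with its image $\phi_x(x)\in\mathbb{R}^n$ in the chart, and vector fields with their expressions (maps $\phi_x(V_x)\to\mathbb{R}^n$) in that chart. The $C^1$ norm is $\|X\|_{C^1}=\max_j\max\big(\sup_{\phi_j(V_j)}|X_j|,\ \sup_{\phi_j(V_j)}\|DX_j\|\big)$, where $X_j:\phi_j(V_j)\to\mathbb{R}^n$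 is the expression of $X$ in the chart $(V_j,\phi_j)$. *)

theory Defs
  imports "HOL-Analysis.Analysis"
begin

section \<open>Maps of class \<open>C\<^sup>s\<close> on open sets\<close>

definition partial_deriv ::
    "'n \<Rightarrow> (real^'n \<Rightarrow> 'b::real_normed_vector) \<Rightarrow> real^'n \<Rightarrow> 'b" where
  "partial_deriv i f = (\<lambda>p. frechet_derivative f (at p) (axis i 1))"

definition iter_partial ::
    "'n list \<Rightarrow> (real^'n \<Rightarrow> 'b::real_normed_vector) \<Rightarrow> real^'n \<Rightarrow> 'b" where
  "iter_partial is f = foldr partial_deriv is f"

text \<open>For open \<open>S\<close>; the order \<open>s = \<infinity>\<close> gives \<open>C\<^sup>\<infinity>\<close>. The partial derivatives are taken
  from Frechet derivatives, so their existence is expressed by differentiability.\<close>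

definition C_on ::
    "enat \<Rightarrow> (real^'n) set \<Rightarrow> (real^'n \<Rightarrow> 'b::real_normed_vector) \<Rightarrow> bool" where
  "C_on s S f \<longleftrightarrow>
     (\<forall>is. (enat (length is) < s \<longrightarrow> (\<forall>p\<in>S. iter_partial is f differentiable (at p))) \<and>
           (enat (length is) \<le> s \<longrightarrow> continuous_on S (iter_partial is f)))"

definition hoelder_on ::
    "real \<Rightarrow> (real^'n) set \<Rightarrow> (real^'n \<Rightarrow> 'b::real_normed_vector) \<Rightarrow> bool" where
  "hoelder_on \<beta> S f \<longleftrightarrow> (\<exists>C. \<forall>p\<in>S. \<forall>q\<in>S. norm (f p - f q) \<le> C * norm (p - q) powr \<beta>)"


section \<open>Smooth manifolds\<close>

text \<open>A chart \<open>(V, \<phi>)\<close> is a domain together with a total function of which only the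
  restriction to \<open>V\<close> matters.\<close>

type_synonym ('a, 'n) chart = "'a set \<times> ('a \<Rightarrow> (real, 'n) vec)"

definition is_chart :: "'a topology \<Rightarrow> ('a, 'n::finite) chart \<Rightarrow> bool" where
  "is_chart T \<kappa> \<longleftrightarrow>
     openin T (fst \<kappa>) \<and> open (snd \<kappa> ` fst \<kappa>) \<and>
     homeomorphic_map (subtopology T (fst \<kappa>)) (top_of_set (snd \<kappa> ` fst \<kappa>)) (snd \<kappa>)"

definition chart_inv :: "('a, 'n::finite) chart \<Rightarrow> real^'n \<Rightarrow> 'a" where
  "chart_inv \<kappa> = inv_into (fst \<kappa>) (snd \<kappa>)"

definition transition ::
    "('a, 'n::finite) chart \<Rightarrow> ('a, 'n) chart \<Rightarrow> real^'n \<Rightarrow> real^'n" where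
  "transition \<kappa> \<kappa>' = snd \<kappa>' \<circ> chart_inv \<kappa>"

definition dtransition ::
    "('a, 'n::finite) chart \<Rightarrow> ('a, 'n) chart \<Rightarrow> 'a \<Rightarrow> real^'n \<Rightarrow> real^'n" where
  "dtransition \<kappa> \<kappa>' x = frechet_derivative (transition \<kappa> \<kappa>') (at (snd \<kappa> x))"

definition compatible :: "('a, 'n::finite) chart \<Rightarrow> ('a, 'n) chart \<Rightarrow> bool" where
  "compatible \<kappa> \<kappa>' \<longleftrightarrow>
     C_on \<infinity> (snd \<kappa> ` (fst \<kappa> \<inter> fst \<kappa>')) (transition \<kappa> \<kappa>') \<and>
     C_on \<infinity> (snd \<kappa>' ` (fst \<kappa> \<inter> fst \<kappa>')) (transition \<kappa>' \<kappa>)"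

text \<open>A smooth structure is a maximal smooth atlas.\<close>

definition smooth_structure :: "'a topology \<Rightarrow> ('a, 'n::finite) chart set \<Rightarrow> bool" where
  "smooth_structure T \<A> \<longleftrightarrow>
     (\<forall>\<kappa>\<in>\<A>. is_chart T \<kappa>) \<and> (\<Union>\<kappa>\<in>\<A>. fst \<kappa>) = topspace T \<and>
     (\<forall>\<kappa>\<in>\<A>. \<forall>\<kappa>'\<in>\<A>. compatible \<kappa> \<kappa>') \<and>
     (\<forall>\<kappa>. is_chart T \<kappa> \<and> (\<forall>\<kappa>'\<in>\<A>. compatible \<kappa> \<kappa>') \<longrightarrow> \<kappa> \<in> \<A>)"

definition orientable :: "'a topology \<Rightarrow> ('a, 'n::finite) chart set \<Rightarrow> bool" where
  "orientable T \<A> \<longleftrightarrow>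
     (\<exists>\<B>\<subseteq>\<A>. (\<Union>\<kappa>\<in>\<B>. fst \<kappa>) = topspace T \<and>
        (\<forall>\<kappa>\<in>\<B>. \<forall>\<kappa>'\<in>\<B>. \<forall>x\<in>fst \<kappa> \<inter> fst \<kappa>'. det (matrix (dtransition \<kappa> \<kappa>' x)) > 0))"

text \<open>The dimension is \<open>CARD('n)\<close>. A connected manifold is taken to be nonempty, which
  \<open>connected_space\<close> does not include.\<close>

definition closed_manifold :: "'a topology \<Rightarrow> ('a, 'n::finite) chart set \<Rightarrow> bool" where
  "closed_manifold T \<A> \<longleftrightarrow>
     smooth_structure T \<A> \<and> second_countable T \<and> Hausdorff_space T \<and>
     topspace T \<noteq> {} \<and> connected_space T \<and> compact_space T"


section \<open>Tangent vectors and volume forms\<close>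

text \<open>A tangent vector at \<open>x\<close> assigns to each chart around \<open>x\<close> its components in that chart,
  subject to the transformation law given by the differentials of the transition maps.
  It is \<open>0\<close> on all other arguments, so that equality of tangent vectors is equality
  of functions.\<close>

type_synonym ('a, 'n) tangent = "('a, 'n) chart \<Rightarrow> (real, 'n) vec"

definition charts_at :: "('a, 'n::finite) chart set \<Rightarrow> 'a \<Rightarrow> ('a, 'n) chart set" where
  "charts_at \<A> x = {\<kappa> \<in> \<A>. x \<in> fst \<kappa>}"

definition tangent_space ::
    "('a, 'n::finite) chart set \<Rightarrow> 'a \<Rightarrow> ('a, 'n) tangent set" where
  "tangent_space \<A> x =
     {u. (\<forall>\<kappa>\<in>charts_at \<A> x. \<forall>\<kappa>'\<in>charts_at \<A> x. u \<kappa>' = dtransition \<kappa> \<kappa>' x (u \<kappa>)) \<and>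
         (\<forall>\<kappa>. \<kappa> \<notin> charts_at \<A> x \<longrightarrow> u \<kappa> = 0)}"

definition coord_vector ::
    "('a, 'n::finite) chart set \<Rightarrow> ('a, 'n) chart \<Rightarrow> 'a \<Rightarrow> 'n \<Rightarrow> ('a, 'n) tangent" where
  "coord_vector \<A> \<kappa> x i =
     (\<lambda>\<kappa>'. if \<kappa>' \<in> charts_at \<A> x then dtransition \<kappa> \<kappa>' x (axis i 1) else 0)"

text \<open>An alternating form of top degree at \<open>x\<close> takes a family of tangent vectors indexed
  by \<open>'n\<close>. Its single coefficient in a chart is its value on the coordinate vectors.\<close>

type_synonym ('a, 'n) top_form = "'a \<Rightarrow> ('n \<Rightarrow> ('a, 'n) tangent) \<Rightarrow> real"

definition alternating_form_at ::
    "('a, 'n::finite) chart set \<Rightarrow> 'a \<Rightarrow> (('n \<Rightarrow> ('a, 'n) tangent) \<Rightarrow> real) \<Rightarrow> bool" where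
  "alternating_form_at \<A> x \<eta> \<longleftrightarrow>
     (\<forall>u i v w a b. range u \<subseteq> tangent_space \<A> x \<and>
        v \<in> tangent_space \<A> x \<and> w \<in> tangent_space \<A> x \<longrightarrow>
        \<eta> (u(i := (\<lambda>\<kappa>. a *\<^sub>R v \<kappa> + b *\<^sub>R w \<kappa>))) = a * \<eta> (u(i := v)) + b * \<eta> (u(i := w))) \<and>
     (\<forall>u i j. range u \<subseteq> tangent_space \<A> x \<and> i \<noteq> j \<and> u i = u j \<longrightarrow> \<eta> u = 0)"

definition form_coeff ::
    "('a, 'n::finite) chart set \<Rightarrow> ('a, 'n) top_form \<Rightarrow> ('a, 'n) chart \<Rightarrow> real^'n \<Rightarrow> real" where
  "form_coeff \<A> \<omega> \<kappa> p = \<omega> (chart_inv \<kappa> p) (coord_vector \<A> \<kappa> (chart_inv \<kappa> p))"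

definition volume_form ::
    "'a topology \<Rightarrow> ('a, 'n::finite) chart set \<Rightarrow> ('a, 'n) top_form \<Rightarrow> bool" where
  "volume_form T \<A> \<omega> \<longleftrightarrow>
     (\<forall>x\<in>topspace T. alternating_form_at \<A> x (\<omega> x) \<and>
        (\<exists>u. range u \<subseteq> tangent_space \<A> x \<and> \<omega> x u \<noteq> 0)) \<and>
     (\<forall>\<kappa>\<in>\<A>. C_on \<infinity> (snd \<kappa> ` fst \<kappa>) (form_coeff \<A> \<omega> \<kappa>))"


section \<open>Conservative and regular atlases\<close>

text \<open>The differential of \<open>\<phi>\<close> at \<open>x\<close> sends a tangent vector \<open>u\<close> to its components \<open>u (V, \<phi>)\<close>,
  and the canonical volume form of \<open>\<real>\<^sup>n\<close> is the determinant: the following says that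
  \<open>\<omega>\<close> on \<open>V\<close> corresponds to the canonical volume form under \<open>\<phi>\<close>.\<close>

definition conservative_chart ::
    "('a, 'n::finite) chart set \<Rightarrow> ('a, 'n) top_form \<Rightarrow> ('a, 'n) chart \<Rightarrow> bool" where
  "conservative_chart \<A> \<omega> \<kappa> \<longleftrightarrow>
     (\<forall>x\<in>fst \<kappa>. \<forall>u. range u \<subseteq> tangent_space \<A> x \<longrightarrow> \<omega> x u = det (\<chi> i. u i \<kappa>))"

definition conservative_atlas ::
    "'a topology \<Rightarrow> ('a, 'n::finite) chart set \<Rightarrow> ('a, 'n) top_form \<Rightarrow>
     nat \<Rightarrow> (nat \<Rightarrow> ('a, 'n) chart) \<Rightarrow> bool" where
  "conservative_atlas T \<A> \<omega> m c \<longleftrightarrow>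
     (\<forall>i\<in>{1..m}. c i \<in> \<A> \<and> conservative_chart \<A> \<omega> (c i)) \<and>
     (\<Union>i\<in>{1..m}. fst (c i)) = topspace T \<and>
     (\<exists>r>0. \<forall>i\<in>{1..m}. snd (c i) ` fst (c i) = ball 0 r)"

definition regular_conservative_atlas ::
    "'a topology \<Rightarrow> ('a, 'n::finite) chart set \<Rightarrow> ('a, 'n) top_form \<Rightarrow>
     nat \<Rightarrow> (nat \<Rightarrow> ('a, 'n) chart) \<Rightarrow> bool" where
  "regular_conservative_atlas T \<A> \<omega> m c \<longleftrightarrow>
     conservative_atlas T \<A> \<omega> m c \<and>
     (\<exists>d. conservative_atlas T \<A> \<omega> m d \<and>
        (\<forall>i\<in>{1..m}. T closure_of fst (c i) \<subseteq> fst (d i) \<and>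
                     (\<forall>x\<in>fst (c i). snd (d i) x = snd (c i) x)))"


section \<open>Vector fields\<close>

type_synonym ('a, 'n) field = "'a \<Rightarrow> ('a, 'n) tangent"

definition expression ::
    "('a, 'n::finite) field \<Rightarrow> ('a, 'n) chart \<Rightarrow> real^'n \<Rightarrow> real^'n" where
  "expression X \<kappa> p = X (chart_inv \<kappa> p) \<kappa>"

text \<open>Being of class \<open>C\<^sup>s\<close> is asked in all charts of the smooth structure; the Hoelder
  condition refers to the charts of the fixed finite atlas \<open>c\<close>. For \<open>s = \<infinity>\<close> there are no
  derivatives of order \<open>s\<close>, and for \<open>\<beta> = 0\<close> there is no Hoelder condition, in accordance with
  \<open>C\<^sup>\<infinity>\<^sup>,\<^sup>\<beta> = C\<^sup>\<infinity>\<close> and \<open>C\<^sup>s\<^sup>,\<^sup>0 = C\<^sup>s\<close>.\<close>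

definition vector_fields ::
    "'a topology \<Rightarrow> ('a, 'n::finite) chart set \<Rightarrow> nat \<Rightarrow> (nat \<Rightarrow> ('a, 'n) chart) \<Rightarrow>
     enat \<Rightarrow> real \<Rightarrow> ('a, 'n) field set" where
  "vector_fields T \<A> m c s \<beta> =
     {X. (\<forall>x\<in>topspace T. X x \<in> tangent_space \<A> x) \<and>
         (\<forall>\<kappa>\<in>\<A>. C_on s (snd \<kappa> ` fst \<kappa>) (expression X \<kappa>)) \<and>
         (\<beta> > 0 \<longrightarrow> (\<forall>j\<in>{1..m}. \<forall>is. enat (length is) = s \<longrightarrow>
            hoelder_on \<beta> (snd (c j) ` fst (c j)) (iter_partial is (expression X (c j)))))}"

text \<open>The divergence of \<open>X\<close> with respect to \<open>\<omega>\<close> is given by \<open>d(\<iota>\<^sub>X \<omega>) = div X \<cdot> \<omega>\<close>. In a chart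
  where \<open>\<omega> = f dx\<^sub>1 \<and> \<dots> \<and> dx\<^sub>n\<close> this reads \<open>div X = (\<Sum>i. \<partial>\<^sub>i (f X\<^sub>i)) / f\<close>.\<close>

definition divergence ::
    "('a, 'n::finite) chart set \<Rightarrow> ('a, 'n) top_form \<Rightarrow> ('a, 'n) field \<Rightarrow>
     ('a, 'n) chart \<Rightarrow> real^'n \<Rightarrow> real" where
  "divergence \<A> \<omega> X \<kappa> p =
     (\<Sum>i\<in>UNIV. partial_deriv i (\<lambda>q. form_coeff \<A> \<omega> \<kappa> q * expression X \<kappa> q $ i) p) /
     form_coeff \<A> \<omega> \<kappa> p"

definition div_free_fields ::
    "'a topology \<Rightarrow> ('a, 'n::finite) chart set \<Rightarrow> ('a, 'n) top_form \<Rightarrow>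
     nat \<Rightarrow> (nat \<Rightarrow> ('a, 'n) chart) \<Rightarrow> enat \<Rightarrow> real \<Rightarrow> ('a, 'n) field set" where
  "div_free_fields T \<A> \<omega> m c s \<beta> =
     {X \<in> vector_fields T \<A> m c s \<beta>.
        \<forall>\<kappa>\<in>\<A>. \<forall>p\<in>snd \<kappa> ` fst \<kappa>. divergence \<A> \<omega> X \<kappa> p = 0}"

definition field_diff :: "('a, 'n::finite) field \<Rightarrow> ('a, 'n) field \<Rightarrow> ('a, 'n) field" where
  "field_diff X Y = (\<lambda>x \<kappa>. X x \<kappa> - Y x \<kappa>)"

definition C1_norm :: "nat \<Rightarrow> (nat \<Rightarrow> ('a, 'n::finite) chart) \<Rightarrow> ('a, 'n) field \<Rightarrow> real" where
  "C1_norm m c X =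
     Max ((\<lambda>j. max
       (SUP p\<in>snd (c j) ` fst (c j). norm (expression X (c j) p))
       (SUP p\<in>snd (c j) ` fst (c j). onorm (frechet_derivative (expression X (c j)) (at p)))) ` {1..m})"

end

theory Submission
  imports Defs
begin

text \<open>
  Let \<open>x \<in> \<Sigma>\<close>, and let \<open>p\<close> be its image in a conservative chart. In this chart the field
  \<open>Y(y) = v(p) + A (y - p) - v(y)\<close> is divergence-free because \<open>A\<close> is traceless, it vanishes at
  \<open>p\<close>, and near \<open>p\<close> its derivative is smaller than \<open>\<chi> \<epsilon>\<close>. Adding \<open>Y\<close> to \<open>v\<close> near \<open>x\<close> would do what is
  wanted, so \<open>Y\<close> has to be cut off without creating divergence. The Poincare homotopy provides a
  potential: with \<open>G(y) = \<integral>\<^sub>0\<^sup>1 t\<^sup>n\<^sup>-\<^sup>2 Y(p + t (y - p)) dt\<close>, the antisymmetric tensor field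
  \<open>G\<^sub>i (y - p)\<^sub>j - G\<^sub>j (y - p)\<^sub>i\<close> has row divergences \<open>Y\<^sub>i\<close>. Multiplying it by a cutoff function \<open>\<rho>\<close>
  and taking row divergences again gives
    \<open>W = \<rho> Y + ((y - p) \<bullet> \<nabla>\<rho>) G - (G \<bullet> \<nabla>\<rho>) (y - p)\<close>,
  which is divergence-free, equals \<open>Y\<close> where \<open>\<rho> = 1\<close> and has compact support
  (\<open>div_localized_field\<close>). The formula contains \<open>Y\<close> and \<open>G\<close> but none of their derivatives,
  and averaging along rays preserves every class \<open>C\<^sup>s\<^sup>,\<^sup>\<beta>\<close> (\<open>C_hoelder_on_radial_mean\<close>). Hence
  \<open>v + W\<close> is as regular as \<open>v\<close> for all \<open>s\<close> and \<open>\<beta>\<close> at once, and no elliptic estimate enters.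

  If \<open>\<eta>\<close> bounds the derivative of \<open>Y\<close> on the ball of radius \<open>r\<close>, then \<open>\<bar>Y\<bar>\<close> and \<open>\<bar>G\<bar>\<close> are \<open>O(r \<eta>)\<close> there,
  while the first and second derivatives of a cutoff at scale \<open>r\<close> are \<open>O(1/r)\<close> and \<open>O(1/r\<^sup>2)\<close>.
  So \<open>\<bar>W\<bar> = O(r \<eta>)\<close> and \<open>\<bar>DW\<bar> = O(\<eta>)\<close> with constants depending on \<open>n\<close> only
  (\<open>linearizing_perturbation\<close>).

  Seen in another chart, \<open>W\<close> is pushed forward by a transition map \<open>\<tau>\<close>. Its derivative then consists of
  a term with \<open>D\<tau>\<close>, \<open>DW\<close> and the derivative of the inverse of \<open>\<tau>\<close>, and of a term with \<open>D\<^sup>2\<tau>\<close> and \<open>W\<close>.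
  The closures of the chart domains are compact subsets of the larger domains of a regular atlas, so
  the first derivatives of all transition maps are bounded by one constant
  (\<open>transition_partials_bounded\<close>); this constant determines \<open>\<chi>\<close>. The second term is
  \<open>O(r \<eta>)\<close> with a factor that depends on \<open>x\<close>, and it is made small by the choice of \<open>r\<close>
  (\<open>perturbation_at_point\<close>). For finitely many points the supports are taken disjoint, so
  that the bounds do not add up (\<open>glue_perturbations\<close>).

  Two conditions have to be moved between charts. In a chart that is not conservative the
  coefficient of \<open>\<omega>\<close> is the Jacobian determinant of the passage to a conservative chart, and
  \<open>divergence_pullback\<close> shows that vanishing divergence is preserved. The Hoelder condition on
  the balls of the given atlas is equivalent to a local Hoelder condition in all charts of
  the smooth structure, because these balls have compact closures in the larger charts
  (\<open>regular_field_iff\<close>); the calculus below is therefore developed for local Hoelder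
  conditions, which survive composition with smooth maps.
\<close>

section \<open>Partial derivatives\<close>

text \<open>Where \<open>f\<close> has no derivative, both sides are the same arbitrary choice.\<close>

lemma frechet_derivative_eventually_eq:
  assumes "\<forall>\<^sub>F q in nhds p. f q = g q"
  shows "frechet_derivative f (at p) = frechet_derivative g (at p)"
proof -
  have fp: "f p = g p" using assms eventually_nhds_x_imp_x by blast
  have ev: "\<forall>\<^sub>F q in at p. f q = g q" using assms
    by (auto simp: eventually_at_filter elim: eventually_mono)
  then have ev': "\<forall>\<^sub>F q in at p. g q = f q" by (auto elim: eventually_mono)
  have "(f has_derivative D) (at p) \<longleftrightarrow> (g has_derivative D) (at p)" for D
    using has_derivative_transform_eventually[OF _ ev fp] has_derivative_transform_eventually[OF _ ev' fp[symmetric]]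
    by auto
  then show ?thesis by (simp add: frechet_derivative_def)
qed

lemma eventually_nhds_eq_on_open:
  assumes "open S" "p \<in> S" "\<And>q. q \<in> S \<Longrightarrow> f q = g q"
  shows "\<forall>\<^sub>F q in nhds p. f q = g q"
  using assms by (auto simp: eventually_nhds)

lemma partial_deriv_cong_open:
  assumes "open S" "p \<in> S" "\<And>q. q \<in> S \<Longrightarrow> f q = g q"
  shows "partial_deriv i f p = partial_deriv i g p"
  using frechet_derivative_eventually_eq[OF eventually_nhds_eq_on_open[of S p f g]] assms
  by (simp add: partial_deriv_def)

lemma differentiable_cong_open:
  assumes "open S" "p \<in> S" "\<And>q. q \<in> S \<Longrightarrow> f q = g q" "f differentiable (at p)"
  shows "g differentiable (at p)"
  using assms has_derivative_transform_within_open[of f _ p UNIV S g] unfolding differentiable_def by blast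

lemma partial_deriv_eq:
  assumes "(f has_derivative D) (at p)"
  shows "partial_deriv i f p = D (axis i 1)"
  using frechet_derivative_at[OF assms] by (simp add: partial_deriv_def)

lemma vec_eq_sum_axis: "h = (\<Sum>i\<in>UNIV. h $ i *\<^sub>R axis i (1::real))"
  by (simp add: vec_eq_iff axis_def if_distrib cong: if_cong)

lemma linear_eq_sum_axis:
  assumes "linear D"
  shows "D h = (\<Sum>i\<in>UNIV. h $ i *\<^sub>R D (axis i (1::real)))"
proof -
  have "D h = D (\<Sum>i\<in>UNIV. h $ i *\<^sub>R axis i 1)"
    by (rule arg_cong[OF vec_eq_sum_axis])
  also have "\<dots> = (\<Sum>i\<in>UNIV. h $ i *\<^sub>R D (axis i 1))"
    using assms by (simp add: linear_sum linear_cmul)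
  finally show ?thesis .
qed

lemma has_derivative_partials:
  assumes "f differentiable (at p)"
  shows "(f has_derivative (\<lambda>h. \<Sum>i\<in>UNIV. h $ i *\<^sub>R partial_deriv i f p)) (at p)"
proof -
  have D: "(f has_derivative (frechet_derivative f (at p))) (at p)"
    using assms frechet_derivative_works by blast
  then have "linear (frechet_derivative f (at p))" using has_derivative_linear by blast
  then have "frechet_derivative f (at p) = (\<lambda>h. \<Sum>i\<in>UNIV. h $ i *\<^sub>R partial_deriv i f p)"
    by (intro ext) (simp add: partial_deriv_def linear_eq_sum_axis[symmetric])
  then show ?thesis using D by simp
qed

lemma frechet_derivative_partials:
  assumes "f differentiable (at p)"
  shows "frechet_derivative f (at p) = (\<lambda>h. \<Sum>i\<in>UNIV. h $ i *\<^sub>R partial_deriv i f p)"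
  using frechet_derivative_at[OF has_derivative_partials[OF assms]] by simp

lemma norm_sum_partials_le:
  fixes d :: "'n::finite \<Rightarrow> 'b::real_normed_vector"
  assumes "\<And>i. norm (d i) \<le> B"
  shows "norm (\<Sum>i\<in>UNIV. (h::real^'n) $ i *\<^sub>R d i) \<le> real CARD('n) * B * norm h"
proof -
  have "norm (\<Sum>i\<in>UNIV. h $ i *\<^sub>R d i) \<le> (\<Sum>i\<in>(UNIV::'n set). norm h * B)"
    by (rule sum_norm_le)
      (use assms component_le_norm_cart[of h] in \<open>auto intro!: mult_mono order_trans[OF norm_ge_zero]\<close>)
  then show ?thesis by (simp add: mult_ac)
qed

lemma onorm_frechet_le:
  fixes f :: "real^'n::finite \<Rightarrow> 'b::real_normed_vector"
  assumes "f differentiable (at p)" "\<And>i. norm (partial_deriv i f p) \<le> B"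
  shows "onorm (frechet_derivative f (at p)) \<le> real CARD('n) * B"
proof (rule onorm_bound)
  have "0 \<le> norm (partial_deriv undefined f p)" by simp
  then have "0 \<le> B" using assms(2) order_trans by blast
  then show "0 \<le> real CARD('n) * B" by simp
  show "norm (frechet_derivative f (at p) h) \<le> real CARD('n) * B * norm h" for h
    unfolding frechet_derivative_partials[OF assms(1)] by (rule norm_sum_partials_le) (rule assms(2))
qed

abbreviation coord_div :: "(real^'n::finite \<Rightarrow> real^'n) \<Rightarrow> real^'n \<Rightarrow> real" where
  "coord_div f p \<equiv> (\<Sum>i\<in>UNIV. partial_deriv i f p $ i)"


section \<open>Local Hoelder classes\<close>

text \<open>The class \<open>C\<^sup>n\<^sup>,\<^sup>b\<close> on an open set, with \<open>b = 0\<close> for \<open>C\<^sup>n\<close>. The Hoelder condition on the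
  derivatives of order \<open>n\<close> is local, which makes the class invariant under changes of coordinates.
  The recursion on \<open>n\<close> through partial derivatives is the form in which the rules of
  differentiation yield closure properties by induction.\<close>

fun C_hoelder_on :: "real \<Rightarrow> nat \<Rightarrow> (real^'n::finite) set \<Rightarrow> (real^'n \<Rightarrow> 'b::real_normed_vector) \<Rightarrow> bool" where
  "C_hoelder_on b 0 S f \<longleftrightarrow>
     continuous_on S f \<and> (b > 0 \<longrightarrow> (\<forall>p\<in>S. \<exists>e>0. hoelder_on b (S \<inter> ball p e) f))"
| "C_hoelder_on b (Suc n) S f \<longleftrightarrow>
     (\<forall>p\<in>S. f differentiable (at p)) \<and> (\<forall>i. C_hoelder_on b n S (partial_deriv i f))"

lemma hoelder_on_subset: "hoelder_on b S f \<Longrightarrow> T \<subseteq> S \<Longrightarrow> hoelder_on b T f"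
  unfolding hoelder_on_def by blast

lemma hoelder_on_cong: "(\<And>x. x \<in> S \<Longrightarrow> f x = g x) \<Longrightarrow> hoelder_on b S f \<Longrightarrow> hoelder_on b S g"
  unfolding hoelder_on_def by auto

lemma hoelder_onI:
  assumes "\<And>p q. p \<in> S \<Longrightarrow> q \<in> S \<Longrightarrow> norm (f p - f q) \<le> C * norm (p - q) powr b"
  shows "hoelder_on b S f"
  using assms unfolding hoelder_on_def by (intro exI[of _ C] ballI)

lemma hoelder_onE:
  assumes "hoelder_on b S f"
  obtains C where "C \<ge> 0" "\<And>p q. p \<in> S \<Longrightarrow> q \<in> S \<Longrightarrow> norm (f p - f q) \<le> C * norm (p - q) powr b"
proof -
  obtain C where C: "\<And>p q. p \<in> S \<Longrightarrow> q \<in> S \<Longrightarrow> norm (f p - f q) \<le> C * norm (p - q) powr b"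
    using assms unfolding hoelder_on_def by blast
  have "norm (f p - f q) \<le> \<bar>C\<bar> * norm (p - q) powr b" if "p \<in> S" "q \<in> S" for p q
    using C[OF that] mult_right_mono[of C "\<bar>C\<bar>" "norm (p - q) powr b"] by (smt (verit) powr_ge_zero)
  then show ?thesis using that[of "\<bar>C\<bar>"] by auto
qed

lemma C_hoelder_on_subset: "C_hoelder_on b n S f \<Longrightarrow> T \<subseteq> S \<Longrightarrow> C_hoelder_on b n T f"
proof (induction n arbitrary: f)
  case 0
  then have "continuous_on T f" by (auto intro: continuous_on_subset)
  moreover have "\<exists>e>0. hoelder_on b (T \<inter> ball p e) f" if bp: "b > 0" and p: "p \<in> T" for p
  proof -
    obtain e where "e > 0" "hoelder_on b (S \<inter> ball p e) f" using 0 bp p by auto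
    then show ?thesis using hoelder_on_subset[of b "S \<inter> ball p e" f "T \<inter> ball p e"] 0 by blast
  qed
  ultimately show ?case by simp
next
  case (Suc n)
  then show ?case by auto
qed

lemma C_hoelder_on_cong:
  assumes "open S" "C_hoelder_on b n S f" "\<And>x. x \<in> S \<Longrightarrow> f x = g x"
  shows "C_hoelder_on b n S g"
  using assms(2,3)
proof (induction n arbitrary: f g)
  case 0
  then have "continuous_on S g" by (metis C_hoelder_on.simps(1) continuous_on_cong)
  moreover have "\<exists>e>0. hoelder_on b (S \<inter> ball p e) g" if bp: "b > 0" and p: "p \<in> S" for p
  proof -
    obtain e where "e > 0" "hoelder_on b (S \<inter> ball p e) f" using 0 bp p by auto
    then show ?thesis using hoelder_on_cong[of "S \<inter> ball p e" f g b] 0 by blast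
  qed
  ultimately show ?case by simp
next
  case (Suc n)
  have "\<forall>p\<in>S. g differentiable (at p)"
    using differentiable_cong_open[OF assms(1)] Suc.prems by (metis C_hoelder_on.simps(2))
  moreover have "C_hoelder_on b n S (partial_deriv i g)" for i
  proof (rule Suc.IH)
    show "C_hoelder_on b n S (partial_deriv i f)" using Suc.prems by simp
    show "partial_deriv i f x = partial_deriv i g x" if "x \<in> S" for x
      using partial_deriv_cong_open[OF assms(1) that] Suc.prems by blast
  qed
  ultimately show ?case by simp
qed

lemma C_hoelder_on_local:
  assumes "\<And>p. p \<in> S \<Longrightarrow> \<exists>U. open U \<and> p \<in> U \<and> C_hoelder_on b n U f"
  shows "C_hoelder_on b n S f"
  using assms
proof (induction n arbitrary: f)
  case 0
  have "isCont f p" if "p \<in> S" for p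
    using 0[OF that] by (auto simp: continuous_on_eq_continuous_at)
  then have "continuous_on S f" by (simp add: continuous_at_imp_continuous_on)
  moreover have "\<exists>e>0. hoelder_on b (S \<inter> ball p e) f" if bp: "b > 0" and p: "p \<in> S" for p
  proof -
    obtain U where U: "open U" "p \<in> U" "C_hoelder_on b 0 U f" using 0[OF p] by blast
    then obtain e where e: "e > 0" "hoelder_on b (U \<inter> ball p e) f" using bp by auto
    obtain d where d: "d > 0" "ball p d \<subseteq> U" using U openE by blast
    have "hoelder_on b (S \<inter> ball p (min d e)) f"
      by (rule hoelder_on_subset[OF e(2)]) (use d in auto)
    then show ?thesis using d e by (intro exI[of _ "min d e"]) auto
  qed
  ultimately show ?case by simp
next
  case (Suc n)
  have "\<forall>p\<in>S. f differentiable (at p)" using Suc.prems by fastforce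
  moreover have "C_hoelder_on b n S (partial_deriv i f)" for i
    by (rule Suc.IH) (use Suc.prems in fastforce)
  ultimately show ?case by simp
qed

text \<open>The radius is kept at most \<open>1/2\<close> so that distances within the ball are at most \<open>1\<close>; on such
  distances a Lipschitz bound implies Hoelder bounds of all exponents up to \<open>1\<close>.\<close>

lemma C1_locally_lipschitz:
  fixes f :: "real^'n::finite \<Rightarrow> 'b::real_normed_vector"
  assumes "open S" and diff: "\<And>p. p \<in> S \<Longrightarrow> f differentiable (at p)"
    and cont: "\<And>i. continuous_on S (partial_deriv i f)" and p: "p \<in> S"
  obtains e M where "e > 0" "M \<ge> 0" "e \<le> 1/2" "ball p e \<subseteq> S"
    "\<And>x y. x \<in> ball p e \<Longrightarrow> y \<in> ball p e \<Longrightarrow> norm (f x - f y) \<le> M * norm (x - y)"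
proof -
  obtain e0 where e0: "e0 > 0" "cball p e0 \<subseteq> S" using assms(1) p open_contains_cball by blast
  define e where "e = min e0 (1/2)"
  have e: "e > 0" "e \<le> 1/2" "cball p e \<subseteq> S" using e0 by (auto simp: e_def)
  have "\<exists>B. \<forall>x\<in>cball p e. norm (partial_deriv i f x) \<le> B" for i
  proof -
    have "compact (partial_deriv i f ` cball p e)"
      by (rule compact_continuous_image) (use cont e in \<open>auto intro: continuous_on_subset\<close>)
    then show ?thesis using compact_imp_bounded bounded_iff by (metis image_eqI)
  qed
  then obtain B where B: "\<And>i x. x \<in> cball p e \<Longrightarrow> norm (partial_deriv i f x) \<le> B i" by metis
  define M where "M = Max (range B)"
  have BM: "norm (partial_deriv i f x) \<le> M" if "x \<in> cball p e" for i x
    using B[OF that, of i] Max_ge[of "range B" "B i"] unfolding M_def by (meson finite finite_imageI order_trans rangeI)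
  have M0: "0 \<le> M" by (rule order_trans[OF norm_ge_zero BM[of p undefined]]) (use e in simp)
  have "norm (f x - f y) \<le> (real CARD('n) * M) * norm (x - y)" if "x \<in> ball p e" "y \<in> ball p e" for x y
  proof (rule differentiable_bound[of "ball p e" f "\<lambda>x. frechet_derivative f (at x)"])
    show "(f has_derivative frechet_derivative f (at x)) (at x within ball p e)" if "x \<in> ball p e" for x
    proof -
      have "x \<in> S" using that e by auto
      then show ?thesis using diff frechet_derivative_works has_derivative_at_withinI by blast
    qed
    show "onorm (frechet_derivative f (at x)) \<le> real CARD('n) * M" if "x \<in> ball p e" for x
    proof (rule onorm_frechet_le)
      have "x \<in> cball p e" using that by auto
      then show "f differentiable (at x)" "\<And>i. norm (partial_deriv i f x) \<le> M"
        using e(3) diff BM by blast+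
    qed
  qed (use that in auto)
  then show ?thesis using e M0 by (intro that[of e "real CARD('n) * M"]) (auto dest: subsetD)
qed

lemma C_hoelder_on_continuous:
  fixes f :: "real^'n::finite \<Rightarrow> 'b::real_normed_vector"
  assumes "C_hoelder_on b n S f"
  shows "continuous_on S f"
  using assms
  by (cases n) (auto intro!: continuous_at_imp_continuous_on differentiable_imp_continuous_within)

lemma C_hoelder_on_Suc_imp:
  fixes f :: "real^'n::finite \<Rightarrow> 'b::real_normed_vector"
  assumes S: "open S" and b: "b' \<le> 1"
  shows "C_hoelder_on b (Suc n) S f \<Longrightarrow> C_hoelder_on b' n S f"
proof (induction n arbitrary: f)
  case 0
  have diff: "f differentiable (at p)" if "p \<in> S" for p using 0 that by simp
  have c: "continuous_on S f" using 0 C_hoelder_on_continuous by blast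
  have "\<exists>e>0. hoelder_on b' (S \<inter> ball p e) f" if bp: "b' > 0" and p: "p \<in> S" for p
  proof -
    have cp: "continuous_on S (partial_deriv i f)" for i using 0 by simp
    obtain e M where e: "e > 0" "M \<ge> 0" "e \<le> 1/2"
      "\<And>x y. x \<in> ball p e \<Longrightarrow> y \<in> ball p e \<Longrightarrow> norm (f x - f y) \<le> M * norm (x - y)"
      by (rule C1_locally_lipschitz[OF S diff cp p]) auto
    have "norm (f x - f y) \<le> M * norm (x - y) powr b'" if xy: "x \<in> ball p e" "y \<in> ball p e" for x y
    proof -
      have "norm (x - y) \<le> 1" using xy e(3) norm_triangle_ineq4[of "x - p" "y - p"]
        by (simp add: dist_norm norm_minus_commute)
      then have "norm (x - y) \<le> norm (x - y) powr b'"
        using powr_mono'[of b' 1 "norm (x - y)"] b by (cases "x = y") auto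
      then show ?thesis using e(4)[OF xy] mult_left_mono[OF _ e(2)] order_trans by blast
    qed
    then have "hoelder_on b' (S \<inter> ball p e) f" by (intro hoelder_onI[of _ _ M]) blast
    then show ?thesis using e by blast
  qed
  then show ?case using c by simp
next
  case (Suc n)
  then show ?case by (metis C_hoelder_on.simps(2))
qed

lemma C_hoelder_on_Suc_has_derivative:
  assumes "C_hoelder_on b (Suc n) S f" "p \<in> S"
  shows "(f has_derivative frechet_derivative f (at p)) (at p)"
  using assms frechet_derivative_works by auto

lemma C_hoelder_on_const: "C_hoelder_on b n S (\<lambda>_. c)"
proof (induction n arbitrary: c)
  case 0
  have "hoelder_on b T (\<lambda>_. c)" for T unfolding hoelder_on_def by (rule exI[of _ 0]) auto
  then show ?case by (auto intro: exI[of _ 1])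
next
  case (Suc n)
  have "partial_deriv i (\<lambda>_. c) = (\<lambda>_. 0)" for i :: 'a
    by (rule ext) (simp add: partial_deriv_eq[OF has_derivative_const])
  then show ?case using Suc by simp
qed

lemma C_hoelder_on_bounded_linear:
  assumes "bounded_linear L" "C_hoelder_on b n S f"
  shows "open S \<Longrightarrow> C_hoelder_on b n S (\<lambda>x. L (f x))"
  using assms(2)
proof (induction n arbitrary: f)
  case 0
  interpret bounded_linear L by fact
  have "hoelder_on b T (\<lambda>x. L (f x))" if T: "hoelder_on b T f" for T
  proof -
    obtain C where C: "C \<ge> 0" "\<And>p q. p \<in> T \<Longrightarrow> q \<in> T \<Longrightarrow> norm (f p - f q) \<le> C * norm (p - q) powr b"
      using hoelder_onE[OF T] by blast
    obtain K where K: "0 \<le> K" "\<And>x. norm (L x) \<le> norm x * K" using nonneg_bounded by blast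
    have "norm (L (f p) - L (f q)) \<le> (C * K) * norm (p - q) powr b" if "p \<in> T" "q \<in> T" for p q
      using K(2)[of "f p - f q"] mult_right_mono[OF C(2)[OF that] K(1)] by (simp add: diff mult_ac)
    then show ?thesis by (rule hoelder_onI)
  qed
  moreover have "continuous_on S (\<lambda>x. L (f x))" using 0 continuous_on by auto
  ultimately show ?case using 0 by (auto; blast)
next
  case (Suc n)
  have D: "((\<lambda>x. L (f x)) has_derivative (\<lambda>h. L (frechet_derivative f (at p) h))) (at p)" if "p \<in> S" for p
    by (intro bounded_linear.has_derivative[OF assms(1)] C_hoelder_on_Suc_has_derivative[OF Suc.prems(2) that])
  have "C_hoelder_on b n S (partial_deriv i (\<lambda>x. L (f x)))" for i
  proof (rule C_hoelder_on_cong)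
    show "C_hoelder_on b n S (\<lambda>x. L (partial_deriv i f x))" using Suc by simp
    show "L (partial_deriv i f p) = partial_deriv i (\<lambda>x. L (f x)) p" if "p \<in> S" for p
      using partial_deriv_eq[OF D[OF that]] by (simp add: partial_deriv_def)
  qed (use Suc in auto)
  then show ?case using D by (auto simp: differentiable_def)
qed

lemma C_hoelder_on_add:
  assumes "open S" "C_hoelder_on b n S f" "C_hoelder_on b n S g"
  shows "C_hoelder_on b n S (\<lambda>x. f x + g x)"
  using assms(2,3)
proof (induction n arbitrary: f g)
  case 0
  have "\<exists>e>0. hoelder_on b (S \<inter> ball p e) (\<lambda>x. f x + g x)" if bp: "b > 0" and p: "p \<in> S" for p
  proof -
    obtain e1 e2 where e: "e1 > 0" "e2 > 0" and h: "hoelder_on b (S \<inter> ball p e1) f" "hoelder_on b (S \<inter> ball p e2) g"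
      using 0 bp p unfolding C_hoelder_on.simps by blast
    obtain C where C: "C \<ge> 0" "\<And>u q. u \<in> S \<inter> ball p e1 \<Longrightarrow> q \<in> S \<inter> ball p e1 \<Longrightarrow> norm (f u - f q) \<le> C * norm (u - q) powr b"
      using hoelder_onE[OF h(1)] by blast
    obtain C' where C': "C' \<ge> 0" "\<And>u q. u \<in> S \<inter> ball p e2 \<Longrightarrow> q \<in> S \<inter> ball p e2 \<Longrightarrow> norm (g u - g q) \<le> C' * norm (u - q) powr b"
      using hoelder_onE[OF h(2)] by blast
    have "norm (f u + g u - (f q + g q)) \<le> (C + C') * norm (u - q) powr b"
      if "u \<in> S \<inter> ball p (min e1 e2)" "q \<in> S \<inter> ball p (min e1 e2)" for u q
    proof -
      have "norm (f u + g u - (f q + g q)) \<le> norm (f u - f q) + norm (g u - g q)"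
        by (metis add_diff_add norm_triangle_ineq)
      also have "\<dots> \<le> C * norm (u - q) powr b + C' * norm (u - q) powr b"
        using C(2)[of u q] C'(2)[of u q] that by fastforce
      finally show ?thesis by (simp add: distrib_right)
    qed
    then have "hoelder_on b (S \<inter> ball p (min e1 e2)) (\<lambda>x. f x + g x)" by (rule hoelder_onI)
    then show ?thesis using e by (intro exI[of _ "min e1 e2"]) auto
  qed
  then show ?case using 0 by (auto intro: continuous_intros)
next
  case (Suc n)
  have D: "((\<lambda>x. f x + g x) has_derivative (\<lambda>h. frechet_derivative f (at p) h + frechet_derivative g (at p) h)) (at p)"
    if "p \<in> S" for p
    by (intro has_derivative_add C_hoelder_on_Suc_has_derivative[OF Suc.prems(1) that]
        C_hoelder_on_Suc_has_derivative[OF Suc.prems(2) that])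
  have "C_hoelder_on b n S (partial_deriv i (\<lambda>x. f x + g x))" for i
  proof (rule C_hoelder_on_cong[OF assms(1)])
    show "C_hoelder_on b n S (\<lambda>x. partial_deriv i f x + partial_deriv i g x)" using Suc by simp
    show "partial_deriv i f p + partial_deriv i g p = partial_deriv i (\<lambda>x. f x + g x) p" if "p \<in> S" for p
      using partial_deriv_eq[OF D[OF that]] by (simp add: partial_deriv_def)
  qed
  then show ?case using D by (auto simp: differentiable_def)
qed

lemma C_hoelder_on_sum:
  assumes "open S" "\<And>i. i \<in> I \<Longrightarrow> C_hoelder_on b n S (f i)"
  shows "C_hoelder_on b n S (\<lambda>x. \<Sum>i\<in>I. f i x)"
  using assms(2)
  by (induction I rule: infinite_finite_induct) (auto intro: C_hoelder_on_const C_hoelder_on_add[OF assms(1)])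

text \<open>In the induction step the product rule needs \<open>f\<close> and \<open>g\<close> themselves in the class of order \<open>n\<close>;
  this is where \<open>b \<le> 1\<close> is used, since continuously differentiable maps are locally Hoelder for such
  exponents only.\<close>

lemma C_hoelder_on_bilinear:
  assumes h: "bounded_bilinear h" and S: "open S" and b: "b \<le> 1"
  shows "C_hoelder_on b n S f \<Longrightarrow> C_hoelder_on b n S g \<Longrightarrow> C_hoelder_on b n S (\<lambda>x. h (f x) (g x))"
proof (induction n arbitrary: f g)
  case 0
  interpret bounded_bilinear h by (rule h)
  have cf: "continuous_on S f" and cg: "continuous_on S g" using 0 by auto
  have "\<exists>e>0. hoelder_on b (S \<inter> ball p e) (\<lambda>x. h (f x) (g x))" if bp: "b > 0" and p: "p \<in> S" for p
  proof -
    obtain e1 e2 where e: "e1 > 0" "e2 > 0" and hh: "hoelder_on b (S \<inter> ball p e1) f" "hoelder_on b (S \<inter> ball p e2) g"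
      using 0 bp p unfolding C_hoelder_on.simps by blast
    obtain C where C: "C \<ge> 0" "\<And>u q. u \<in> S \<inter> ball p e1 \<Longrightarrow> q \<in> S \<inter> ball p e1 \<Longrightarrow> norm (f u - f q) \<le> C * norm (u - q) powr b"
      using hoelder_onE[OF hh(1)] by blast
    obtain C' where C': "C' \<ge> 0" "\<And>u q. u \<in> S \<inter> ball p e2 \<Longrightarrow> q \<in> S \<inter> ball p e2 \<Longrightarrow> norm (g u - g q) \<le> C' * norm (u - q) powr b"
      using hoelder_onE[OF hh(2)] by blast
    have "isCont f p" "isCont g p" using cf cg p S continuous_on_eq_continuous_at by blast+
    then obtain d1 d2 where d: "d1 > 0" "d2 > 0"
      "\<And>x. dist x p < d1 \<Longrightarrow> dist (f x) (f p) < 1" "\<And>x. dist x p < d2 \<Longrightarrow> dist (g x) (g p) < 1"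
      unfolding continuous_at_eps_delta by (metis zero_less_one)
    obtain K where K: "0 \<le> K" "\<And>a b. norm (h a b) \<le> norm a * norm b * K" using nonneg_bounded by blast
    define F G where "F = norm (f p) + 1" and "G = norm (g p) + 1"
    define r where "r = min (min e1 e2) (min d1 d2)"
    have fF: "norm (f x) \<le> F" and gG: "norm (g x) \<le> G" if "x \<in> ball p r" for x
      using d(3,4)[of x] that norm_triangle_sub[of "f x" "f p"] norm_triangle_sub[of "g x" "g p"]
      by (auto simp: F_def G_def r_def dist_norm norm_minus_commute)
    have "norm (h (f u) (g u) - h (f q) (g q)) \<le> ((C * G + F * C') * K) * norm (u - q) powr b"
      if uq: "u \<in> S \<inter> ball p r" "q \<in> S \<inter> ball p r" for u q
    proof -
      let ?N = "norm (u - q) powr b"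
      have eq: "h (f u) (g u) - h (f q) (g q) = h (f u - f q) (g u) + h (f q) (g u - g q)"
        by (simp add: diff_left diff_right)
      have "norm (h (f u) (g u) - h (f q) (g q)) \<le> norm (f u - f q) * norm (g u) * K + norm (f q) * norm (g u - g q) * K"
        unfolding eq using norm_triangle_ineq[of "h (f u - f q) (g u)" "h (f q) (g u - g q)"]
          K(2)[of "f u - f q" "g u"] K(2)[of "f q" "g u - g q"] by linarith
      also have "\<dots> \<le> (C * ?N) * G * K + F * (C' * ?N) * K"
      proof (intro add_mono mult_mono)
        show "norm (f u - f q) \<le> C * ?N" "norm (g u - g q) \<le> C' * ?N"
          using C(2)[of u q] C'(2)[of u q] uq by (auto simp: r_def)
        show "norm (g u) \<le> G" "norm (f q) \<le> F" using fF gG uq by auto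
      qed (use K C C' in \<open>auto simp: F_def G_def\<close>)
      finally show ?thesis by (simp add: algebra_simps)
    qed
    then have "hoelder_on b (S \<inter> ball p r) (\<lambda>x. h (f x) (g x))" by (rule hoelder_onI)
    then show ?thesis using e d by (intro exI[of _ r]) (auto simp: r_def)
  qed
  then show ?case using cf cg by (auto intro: continuous_on)
next
  case (Suc n)
  have fn: "C_hoelder_on b n S f" "C_hoelder_on b n S g"
    using C_hoelder_on_Suc_imp[OF S b] Suc.prems by auto
  have D: "((\<lambda>x. h (f x) (g x)) has_derivative (\<lambda>k. h (f p) (frechet_derivative g (at p) k) + h (frechet_derivative f (at p) k) (g p))) (at p)"
    if "p \<in> S" for p
    by (intro bounded_bilinear.FDERIV[OF h] C_hoelder_on_Suc_has_derivative[OF Suc.prems(1) that]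
        C_hoelder_on_Suc_has_derivative[OF Suc.prems(2) that])
  have "C_hoelder_on b n S (partial_deriv i (\<lambda>x. h (f x) (g x)))" for i
  proof (rule C_hoelder_on_cong[OF S])
    show "C_hoelder_on b n S (\<lambda>x. h (f x) (partial_deriv i g x) + h (partial_deriv i f x) (g x))"
      using Suc fn by (intro C_hoelder_on_add[OF S] Suc.IH) auto
    show "h (f p) (partial_deriv i g p) + h (partial_deriv i f p) (g p) = partial_deriv i (\<lambda>x. h (f x) (g x)) p" if "p \<in> S" for p
      using partial_deriv_eq[OF D[OF that]] by (simp add: partial_deriv_def)
  qed
  then show ?case using D by (auto simp: differentiable_def)
qed

lemmas C_hoelder_on_scaleR = C_hoelder_on_bilinear[OF bounded_bilinear_scaleR]
lemmas C_hoelder_on_mult = C_hoelder_on_bilinear[OF bounded_bilinear_mult]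

lemma C_hoelder_on_nth:
  "open S \<Longrightarrow> C_hoelder_on b n S f \<Longrightarrow> C_hoelder_on b n S (\<lambda>x. f x $ i)"
  using C_hoelder_on_bounded_linear[OF bounded_linear_vec_nth] by blast

definition C_infinity_on :: "(real^'n::finite) set \<Rightarrow> (real^'n \<Rightarrow> 'b::real_normed_vector) \<Rightarrow> bool" where
  "C_infinity_on S f \<longleftrightarrow> (\<forall>n. C_hoelder_on 0 n S f)"

lemma C_infinity_onD: "open S \<Longrightarrow> b \<le> 1 \<Longrightarrow> C_infinity_on S f \<Longrightarrow> C_hoelder_on b n S f"
  unfolding C_infinity_on_def using C_hoelder_on_Suc_imp by blast

lemma C_infinity_on_partial: "C_infinity_on S f \<Longrightarrow> C_infinity_on S (partial_deriv i f)"
  unfolding C_infinity_on_def by (metis C_hoelder_on.simps(2))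

lemma C_infinity_on_differentiable: "C_infinity_on S f \<Longrightarrow> p \<in> S \<Longrightarrow> f differentiable (at p)"
  unfolding C_infinity_on_def by (metis C_hoelder_on.simps(2))

lemma C_infinity_on_continuous: "C_infinity_on S f \<Longrightarrow> continuous_on S f"
  unfolding C_infinity_on_def by (metis C_hoelder_on.simps(1))

lemma partial_deriv_compose:
  fixes g :: "real^'m::finite \<Rightarrow> real^'n::finite"
  assumes "f differentiable (at (g p))" "g differentiable (at p)"
  shows "partial_deriv i (\<lambda>x. f (g x)) p = (\<Sum>j\<in>UNIV. partial_deriv i g p $ j *\<^sub>R partial_deriv j f (g p))"
    and "(\<lambda>x. f (g x)) differentiable (at p)"
proof -
  have D: "((\<lambda>x. f (g x)) has_derivative (\<lambda>h. \<Sum>j\<in>UNIV. frechet_derivative g (at p) h $ j *\<^sub>R partial_deriv j f (g p))) (at p)"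
    using has_derivative_compose[of g "frechet_derivative g (at p)" p UNIV f]
      has_derivative_partials[OF assms(1)] assms(2) frechet_derivative_works by blast
  show "partial_deriv i (\<lambda>x. f (g x)) p = (\<Sum>j\<in>UNIV. partial_deriv i g p $ j *\<^sub>R partial_deriv j f (g p))"
    using partial_deriv_eq[OF D] by (simp add: partial_deriv_def)
  show "(\<lambda>x. f (g x)) differentiable (at p)" using D by (auto simp: differentiable_def)
qed

text \<open>The inner map is locally Lipschitz, so composing with it keeps the Hoelder exponent. This is
  what makes the classes meaningful on a manifold.\<close>

lemma C_hoelder_on_compose_smooth:
  fixes g :: "real^'m::finite \<Rightarrow> real^'n::finite"
  assumes S: "open S" and R: "open R" and b: "0 \<le> b" "b \<le> 1" and g: "C_infinity_on S g" and gR: "g ` S \<subseteq> R"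
  shows "C_hoelder_on b n R f \<Longrightarrow> C_hoelder_on b n S (\<lambda>x. f (g x))"
proof (induction n arbitrary: f)
  case 0
  have cg: "continuous_on S g" using g by (rule C_infinity_on_continuous)
  have c: "continuous_on S (\<lambda>x. f (g x))" using 0 cg gR by (auto intro: continuous_on_compose2)
  have "\<exists>e>0. hoelder_on b (S \<inter> ball p e) (\<lambda>x. f (g x))" if bp: "b > 0" and p: "p \<in> S" for p
  proof -
    obtain e M where e: "e > 0" "M \<ge> 0" "e \<le> 1/2"
      "\<And>x y. x \<in> ball p e \<Longrightarrow> y \<in> ball p e \<Longrightarrow> norm (g x - g y) \<le> M * norm (x - y)"
      by (rule C1_locally_lipschitz[OF S C_infinity_on_differentiable[OF g]
            C_infinity_on_continuous[OF C_infinity_on_partial[OF g]] p]) auto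
    have "g p \<in> R" using gR p by blast
    then obtain r where r: "r > 0" "hoelder_on b (R \<inter> ball (g p) r) f"
      using 0 bp by auto
    obtain C where C: "C \<ge> 0" "\<And>u q. u \<in> R \<inter> ball (g p) r \<Longrightarrow> q \<in> R \<inter> ball (g p) r \<Longrightarrow> norm (f u - f q) \<le> C * norm (u - q) powr b"
      using hoelder_onE[OF r(2)] by blast
    have "isCont g p" using cg p S continuous_on_eq_continuous_at by blast
    then obtain d where d: "d > 0" "\<And>x. dist x p < d \<Longrightarrow> dist (g x) (g p) < r"
      unfolding continuous_at_eps_delta using r(1) by metis
    have "norm (f (g u) - f (g q)) \<le> (C * M powr b) * norm (u - q) powr b"
      if uq: "u \<in> S \<inter> ball p (min d e)" "q \<in> S \<inter> ball p (min d e)" for u q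
    proof -
      have "norm (f (g u) - f (g q)) \<le> C * norm (g u - g q) powr b"
        by (rule C(2)) (use uq d(2)[of u] d(2)[of q] gR in \<open>auto simp: dist_commute\<close>)
      also have "norm (g u - g q) powr b \<le> (M * norm (u - q)) powr b"
        by (rule powr_mono2) (use b e(4)[of u q] uq in auto)
      also have "\<dots> = M powr b * norm (u - q) powr b"
        using e(2) by (simp add: powr_mult)
      finally show ?thesis using C(1) by (simp add: mult_left_mono mult.assoc)
    qed
    then have "hoelder_on b (S \<inter> ball p (min d e)) (\<lambda>x. f (g x))" by (rule hoelder_onI)
    then show ?thesis using e(1) d(1) by (intro exI[of _ "min d e"]) auto
  qed
  then show ?case using c by simp
next
  case (Suc n)
  have df: "f differentiable (at (g p))" and dg: "g differentiable (at p)" if "p \<in> S" for p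
    using Suc.prems that gR C_infinity_on_differentiable[OF g that] by auto
  have "C_hoelder_on b n S (partial_deriv i (\<lambda>x. f (g x)))" for i
  proof (rule C_hoelder_on_cong[OF S])
    show "C_hoelder_on b n S (\<lambda>p. \<Sum>j\<in>UNIV. partial_deriv i g p $ j *\<^sub>R partial_deriv j f (g p))"
    proof (intro C_hoelder_on_sum[OF S] C_hoelder_on_scaleR[OF S b(2)] C_hoelder_on_nth[OF S])
      show "C_hoelder_on b n S (partial_deriv i g)"
        using C_infinity_onD[OF S b(2) C_infinity_on_partial[OF g]] .
      show "C_hoelder_on b n S (\<lambda>x. partial_deriv j f (g x))" for j
        by (rule Suc.IH) (use Suc.prems in simp)
    qed
    show "(\<Sum>j\<in>UNIV. partial_deriv i g p $ j *\<^sub>R partial_deriv j f (g p)) = partial_deriv i (\<lambda>x. f (g x)) p" if "p \<in> S" for p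
      using partial_deriv_compose(1)[OF df dg] that by metis
  qed
  then show ?case using partial_deriv_compose(2)[OF df dg] by auto
qed

text \<open>Links the iterated partial derivatives of \<^const>\<open>C_on\<close>, in which the last index of the list is
  differentiated first, with the recursion of \<^const>\<open>C_hoelder_on\<close>.\<close>

lemma C_on_enat_iff:
  fixes f :: "real^'n::finite \<Rightarrow> 'b::real_normed_vector"
  assumes "open S"
  shows "C_on (enat n) S f \<longleftrightarrow> C_hoelder_on 0 n S f"
    and "b > 0 \<Longrightarrow> C_hoelder_on b n S f \<longleftrightarrow> C_on (enat n) S f \<and>
      (\<forall>is. length is = n \<longrightarrow> (\<forall>p\<in>S. \<exists>e>0. hoelder_on b (S \<inter> ball p e) (iter_partial is f)))"
proof -
  have iter: "iter_partial (is @ [i]) f = iter_partial is (partial_deriv i f)" for "is" i and f :: "real^'n \<Rightarrow> 'b"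
    by (simp add: iter_partial_def)
  have nil: "iter_partial [] f = f" for f :: "real^'n \<Rightarrow> 'b" by (simp add: iter_partial_def)
  have all: "(\<forall>is. P is) \<longleftrightarrow> P [] \<and> (\<forall>is i. P (is @ [i]))" for P :: "'n list \<Rightarrow> bool"
  proof safe
    fix "is" assume "P []" "\<forall>is i. P (is @ [i])"
    then show "P is" by (cases "is" rule: rev_cases) auto
  qed auto
  have step: "C_on (enat (Suc n)) S f \<longleftrightarrow> (\<forall>p\<in>S. f differentiable (at p)) \<and> (\<forall>i. C_on (enat n) S (partial_deriv i f))" for n and f :: "real^'n \<Rightarrow> 'b"
  proof -
    have c: "(\<forall>p\<in>S. f differentiable (at p)) \<Longrightarrow> continuous_on S f"
      by (auto intro!: continuous_at_imp_continuous_on differentiable_imp_continuous_within)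
    show ?thesis unfolding C_on_def
      by (subst all, simp only: iter nil) (auto simp: c)
  qed
  have zero: "C_on (enat 0) S f \<longleftrightarrow> continuous_on S f" for f :: "real^'n \<Rightarrow> 'b"
    unfolding C_on_def by (auto simp: nil enat_0_iff zero_enat_def[symmetric])
  show eq: "C_on (enat n) S f \<longleftrightarrow> C_hoelder_on 0 n S f"
    by (induction n arbitrary: f) (simp_all add: zero step)
  assume b: "b > 0"
  show "C_hoelder_on b n S f \<longleftrightarrow> C_on (enat n) S f \<and>
      (\<forall>is. length is = n \<longrightarrow> (\<forall>p\<in>S. \<exists>e>0. hoelder_on b (S \<inter> ball p e) (iter_partial is f)))"
  proof (induction n arbitrary: f)
    case 0
    show ?case using b by (auto simp: zero nil)
  next
    case (Suc n)
    have snoc: "(\<forall>is. length is = Suc n \<longrightarrow> (\<forall>p\<in>S. \<exists>e>0. hoelder_on b (S \<inter> ball p e) (iter_partial is f))) \<longleftrightarrow>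
      (\<forall>i is. length is = n \<longrightarrow> (\<forall>p\<in>S. \<exists>e>0. hoelder_on b (S \<inter> ball p e) (iter_partial is (partial_deriv i f))))"
      by (subst all, simp only: iter) auto
    show ?case unfolding step C_hoelder_on.simps Suc snoc by blast
  qed
qed

lemma C_on_infinity_iff:
  fixes f :: "real^'n::finite \<Rightarrow> 'b::real_normed_vector"
  assumes "open S"
  shows "C_on \<infinity> S f \<longleftrightarrow> C_infinity_on S f"
proof -
  have "C_on \<infinity> S f \<longleftrightarrow> (\<forall>n. C_on (enat n) S f)"
  proof
    assume L: "C_on \<infinity> S f"
    show "\<forall>n. C_on (enat n) S f" using L unfolding C_on_def by simp
  next
    assume R: "\<forall>n. C_on (enat n) S f"
    have "(\<forall>p\<in>S. iter_partial is f differentiable at p) \<and> continuous_on S (iter_partial is f)" for "is"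
      using R[rule_format, of "Suc (length is)"] unfolding C_on_def by simp
    then show "C_on \<infinity> S f" unfolding C_on_def by simp
  qed
  then show ?thesis by (simp add: C_infinity_on_def C_on_enat_iff(1)[OF assms])
qed


text \<open>Two nearby points lie in one ball of a finite subcover. For two points at distance at least
  \<open>d\<close> the factor \<open>d powr b\<close> bounds the right-hand side from below, and \<open>f\<close> is bounded on \<open>K\<close>.\<close>

lemma C_hoelder_on_compact:
  fixes f :: "real^'n::finite \<Rightarrow> 'b::real_normed_vector"
  assumes f: "C_hoelder_on b 0 S f" and b: "b > 0" and K: "compact K" "K \<subseteq> S" and S: "open S"
  shows "hoelder_on b K f"
proof -
  have "\<exists>e C. e > 0 \<and> C \<ge> 0 \<and> (\<forall>x\<in>ball p e. \<forall>y\<in>ball p e. norm (f x - f y) \<le> C * norm (x - y) powr b)" if p: "p \<in> K" for p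
  proof -
    have pS: "p \<in> S" using p K by blast
    obtain e where e: "e > 0" "hoelder_on b (S \<inter> ball p e) f" using f b pS by auto
    obtain d where d: "d > 0" "ball p d \<subseteq> S" using pS S openE by blast
    have "hoelder_on b (ball p (min d e)) f" by (rule hoelder_on_subset[OF e(2)]) (use d in auto)
    then obtain C where "C \<ge> 0" "\<And>x y. x \<in> ball p (min d e) \<Longrightarrow> y \<in> ball p (min d e) \<Longrightarrow> norm (f x - f y) \<le> C * norm (x - y) powr b"
      using hoelder_onE by blast
    then show ?thesis using e d by (intro exI[of _ "min d e"] exI[of _ C]) simp
  qed
  then obtain e C where e: "\<And>p. p \<in> K \<Longrightarrow> e p > 0" and C: "\<And>p. p \<in> K \<Longrightarrow> C p \<ge> 0"
    and fC: "\<And>p x y. p \<in> K \<Longrightarrow> x \<in> ball p (e p) \<Longrightarrow> y \<in> ball p (e p) \<Longrightarrow> norm (f x - f y) \<le> C p * norm (x - y) powr b"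
    by metis
  obtain F where F: "F \<subseteq> K" "finite F" "K \<subseteq> (\<Union>p\<in>F. ball p (e p / 2))"
    using compactE_image[OF K(1), of K "\<lambda>p. ball p (e p / 2)"] e by force
  define d where "d = Min (insert 1 ((\<lambda>p. e p / 2) ` F))"
  have d0: "d > 0" using F e by (auto simp: d_def)
  have de: "d \<le> e p / 2" if "p \<in> F" for p unfolding d_def by (rule Min_le) (use that F in auto)
  define C1 where "C1 = (\<Sum>p\<in>F. C p)"
  have CC: "C p \<le> C1" if "p \<in> F" for p
    unfolding C1_def by (rule member_le_sum) (use that F C in auto)
  have "continuous_on K f" using f K continuous_on_subset by auto
  then have "bounded (f ` K)" using compact_continuous_image K compact_imp_bounded by blast
  then obtain M where M: "\<And>x. x \<in> K \<Longrightarrow> norm (f x) \<le> M" unfolding bounded_iff by blast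
  show ?thesis
  proof (rule hoelder_onI)
    fix x y assume xy: "x \<in> K" "y \<in> K"
    have M0: "0 \<le> M" using M[OF xy(1)] norm_ge_zero order_trans by blast
    have C10: "0 \<le> C1" unfolding C1_def by (rule sum_nonneg) (use C F in auto)
    show "norm (f x - f y) \<le> (C1 + 2 * M / d powr b) * norm (x - y) powr b"
    proof (cases "norm (x - y) < d")
      case True
      obtain p where p: "p \<in> F" "x \<in> ball p (e p / 2)" using F(3) xy by blast
      then have pK: "p \<in> K" using F by blast
      have "dist p y \<le> dist p x + dist x y" by (rule dist_triangle)
      then have "y \<in> ball p (e p)" "x \<in> ball p (e p)" using p(2) True de[OF p(1)] e[OF pK] by (auto simp: dist_norm)
      then have "norm (f x - f y) \<le> C p * norm (x - y) powr b" using fC[OF pK] by blast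
      also have "\<dots> \<le> (C1 + 2 * M / d powr b) * norm (x - y) powr b"
        using CC[OF p(1)] M0 by (intro mult_right_mono) (auto intro: add_increasing2)
      finally show ?thesis .
    next
      case False
      have "norm (f x - f y) \<le> 2 * M" using M[OF xy(1)] M[OF xy(2)] norm_triangle_ineq4[of "f x" "f y"] by simp
      also have "\<dots> = (2 * M / d powr b) * d powr b" using d0 by simp
      also have "\<dots> \<le> (2 * M / d powr b) * norm (x - y) powr b"
        using False d0 b M0 by (intro mult_left_mono powr_mono2) auto
      also have "\<dots> \<le> (C1 + 2 * M / d powr b) * norm (x - y) powr b"
        using C10 by (intro mult_right_mono) auto
      finally show ?thesis .
    qed
  qed
qed

section \<open>Second derivatives and determinants\<close>

text \<open>The mean value theorem in direction \<open>i\<close> reduces the second difference to a first difference of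
  \<open>\<partial>\<^sub>i f\<close>, to which differentiability at \<open>p\<close> applies. The second difference is symmetric in
  \<open>i\<close> and \<open>j\<close>, which gives the symmetry of the second derivatives.\<close>

lemma mixed_difference_estimate:
  fixes f :: "real^'n::finite \<Rightarrow> real"
  assumes S: "open S" "p \<in> S" and f: "\<And>q. q \<in> S \<Longrightarrow> f differentiable (at q)"
    and fi: "partial_deriv i f differentiable (at p)" and eps: "\<epsilon> > 0"
  obtains \<delta> where "\<delta> > 0" "\<And>t. 0 < t \<Longrightarrow> t < \<delta> \<Longrightarrow>
    \<bar>f (p + t *\<^sub>R axis i 1 + t *\<^sub>R axis j 1) - f (p + t *\<^sub>R axis i 1) - f (p + t *\<^sub>R axis j 1) + f p
      - t\<^sup>2 * partial_deriv j (partial_deriv i f) p\<bar> \<le> \<epsilon> * t\<^sup>2"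
proof -
  define g where "g = partial_deriv i f"
  define D where "D = (\<lambda>h::real^'n. \<Sum>k\<in>UNIV. h $ k *\<^sub>R partial_deriv k g p)"
  have gD: "(g has_derivative D) (at p)" unfolding g_def D_def by (rule has_derivative_partials[OF fi])
  obtain d1 where d1: "d1 > 0" "\<And>y. norm (y - p) < d1 \<Longrightarrow> norm (g y - g p - D (y - p)) \<le> \<epsilon>/4 * norm (y - p)"
    using gD eps unfolding has_derivative_at_alt by (meson divide_pos_pos zero_less_numeral)
  obtain d2 where d2: "d2 > 0" "ball p d2 \<subseteq> S" using S openE by blast
  let ?ei = "axis i 1 :: real^'n" and ?ej = "axis j 1 :: real^'n"
  have nn: "norm (s *\<^sub>R ?ei + r *\<^sub>R ?ej) \<le> 2 * t" if "0 \<le> s" "s \<le> t" "0 \<le> r" "r \<le> t" for s r t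
    using norm_triangle_ineq[of "s *\<^sub>R ?ei" "r *\<^sub>R ?ej"] that by (simp add: norm_axis_1)
  show ?thesis
  proof (rule that[of "min d1 d2 / 2"])
    show "0 < min d1 d2 / 2" using d1 d2 by simp
    fix t :: real assume t: "0 < t" "t < min d1 d2 / 2"
    let ?u = "\<lambda>s. f (p + s *\<^sub>R ?ei + t *\<^sub>R ?ej) - f (p + s *\<^sub>R ?ei)"
    have inS: "p + s *\<^sub>R ?ei + r *\<^sub>R ?ej \<in> S" if "0 \<le> s" "s \<le> t" "0 \<le> r" "r \<le> t" for s r
    proof -
      have "dist (p + s *\<^sub>R ?ei + r *\<^sub>R ?ej) p < d2" using nn[OF that] t by (simp add: dist_norm add.assoc norm_minus_commute[of p])
      then show ?thesis using d2(2) by (auto simp: dist_commute)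
    qed
    have dv: "((\<lambda>s. f (p + s *\<^sub>R ?ei + r *\<^sub>R ?ej)) has_real_derivative g (p + s *\<^sub>R ?ei + r *\<^sub>R ?ej)) (at s)"
      if "0 \<le> s" "s \<le> t" "0 \<le> r" "r \<le> t" for s r
    proof -
      have "(f has_derivative frechet_derivative f (at (p + s *\<^sub>R ?ei + r *\<^sub>R ?ej))) (at (p + s *\<^sub>R ?ei + r *\<^sub>R ?ej))"
        using f[OF inS[OF that]] frechet_derivative_works by blast
      then have "((\<lambda>s. f (p + s *\<^sub>R ?ei + r *\<^sub>R ?ej)) has_derivative
         (\<lambda>h. frechet_derivative f (at (p + s *\<^sub>R ?ei + r *\<^sub>R ?ej)) (h *\<^sub>R ?ei))) (at s)"
        by (rule has_derivative_compose[rotated]) (auto intro!: derivative_eq_intros)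
      moreover have "linear (frechet_derivative f (at (p + s *\<^sub>R ?ei + r *\<^sub>R ?ej)))"
        using f[OF inS[OF that]] linear_frechet_derivative by blast
      ultimately show ?thesis
        unfolding has_field_derivative_def g_def partial_deriv_def
        by (simp add: linear_cmul mult_commute_abs)
    qed
    have du: "DERIV ?u s :> g (p + s *\<^sub>R ?ei + t *\<^sub>R ?ej) - g (p + s *\<^sub>R ?ei)" if "0 \<le> s" "s \<le> t" for s
      using DERIV_diff[OF dv[of s t] dv[of s 0]] that t by simp
    obtain s where s: "0 < s" "s < t" "?u t - ?u 0 = (t - 0) * (g (p + s *\<^sub>R ?ei + t *\<^sub>R ?ej) - g (p + s *\<^sub>R ?ei))"
      using MVT2[OF t(1), of ?u "\<lambda>s. g (p + s *\<^sub>R ?ei + t *\<^sub>R ?ej) - g (p + s *\<^sub>R ?ei)"] du by blast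
    let ?A = "g (p + s *\<^sub>R ?ei + t *\<^sub>R ?ej) - g p - D (s *\<^sub>R ?ei + t *\<^sub>R ?ej)"
    let ?B = "g (p + s *\<^sub>R ?ei) - g p - D (s *\<^sub>R ?ei)"
    have A: "\<bar>?A\<bar> \<le> \<epsilon>/2 * t"
    proof -
      have n: "norm (s *\<^sub>R ?ei + t *\<^sub>R ?ej) \<le> 2 * t" using nn[of s t t] s t by simp
      have "\<bar>?A\<bar> \<le> \<epsilon>/4 * norm (s *\<^sub>R ?ei + t *\<^sub>R ?ej)"
        using d1(2)[of "p + s *\<^sub>R ?ei + t *\<^sub>R ?ej"] n t by (simp add: add.assoc)
      also have "\<dots> \<le> \<epsilon>/4 * (2 * t)" using n eps by (intro mult_left_mono) auto
      finally show ?thesis by simp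
    qed
    have B: "\<bar>?B\<bar> \<le> \<epsilon>/2 * t"
    proof -
      have n: "norm (s *\<^sub>R ?ei) \<le> 2 * t" using nn[of s t 0] s t by simp
      have "\<bar>?B\<bar> \<le> \<epsilon>/4 * norm (s *\<^sub>R ?ei)"
        using d1(2)[of "p + s *\<^sub>R ?ei"] n t by simp
      also have "\<dots> \<le> \<epsilon>/4 * (2 * t)" using n eps by (intro mult_left_mono) auto
      finally show ?thesis by simp
    qed
    have lin: "linear D" using gD has_derivative_linear by blast
    have Dj: "D (s *\<^sub>R ?ei + t *\<^sub>R ?ej) - D (s *\<^sub>R ?ei) = t * partial_deriv j g p"
      using partial_deriv_eq[OF gD, of j] lin by (simp add: linear_add linear_cmul)
    have "f (p + t *\<^sub>R ?ei + t *\<^sub>R ?ej) - f (p + t *\<^sub>R ?ei) - f (p + t *\<^sub>R ?ej) + f p - t\<^sup>2 * partial_deriv j g p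
       = ?u t - ?u 0 - t\<^sup>2 * partial_deriv j g p" by simp
    also have "\<dots> = t * (g (p + s *\<^sub>R ?ei + t *\<^sub>R ?ej) - g (p + s *\<^sub>R ?ei)) - t * (t * partial_deriv j g p)"
      using s(3) by (simp add: power2_eq_square)
    also have "\<dots> = t * (?A - ?B)"
      unfolding Dj[symmetric] by (simp add: algebra_simps)
    finally have "\<bar>f (p + t *\<^sub>R ?ei + t *\<^sub>R ?ej) - f (p + t *\<^sub>R ?ei) - f (p + t *\<^sub>R ?ej) + f p - t\<^sup>2 * partial_deriv j g p\<bar>
       = t * \<bar>?A - ?B\<bar>" using t(1) by (simp add: abs_mult)
    also have "\<dots> \<le> t * (\<epsilon> * t)"
    proof (rule mult_left_mono)
      show "\<bar>?A - ?B\<bar> \<le> \<epsilon> * t" using A B by linarith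
    qed (use t in simp)
    finally show "\<bar>f (p + t *\<^sub>R ?ei + t *\<^sub>R ?ej) - f (p + t *\<^sub>R ?ei) - f (p + t *\<^sub>R ?ej) + f p
        - t\<^sup>2 * partial_deriv j (partial_deriv i f) p\<bar> \<le> \<epsilon> * t\<^sup>2"
      by (simp add: g_def power2_eq_square mult_ac)
  qed
qed

lemma mixed_partials_commute:
  fixes f :: "real^'n::finite \<Rightarrow> real"
  assumes S: "open S" "p \<in> S" and f: "\<And>q. q \<in> S \<Longrightarrow> f differentiable (at q)"
    and fi: "\<And>i. partial_deriv i f differentiable (at p)"
  shows "partial_deriv i (partial_deriv j f) p = partial_deriv j (partial_deriv i f) p"
proof (rule ccontr)
  assume neq: "partial_deriv i (partial_deriv j f) p \<noteq> partial_deriv j (partial_deriv i f) p"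
  define e where "e = \<bar>partial_deriv i (partial_deriv j f) p - partial_deriv j (partial_deriv i f) p\<bar> / 4"
  have e: "e > 0" using neq by (simp add: e_def)
  obtain d1 where d1: "d1 > 0" "\<And>t. 0 < t \<Longrightarrow> t < d1 \<Longrightarrow>
    \<bar>f (p + t *\<^sub>R axis i 1 + t *\<^sub>R axis j 1) - f (p + t *\<^sub>R axis i 1) - f (p + t *\<^sub>R axis j 1) + f p
      - t\<^sup>2 * partial_deriv j (partial_deriv i f) p\<bar> \<le> e * t\<^sup>2"
    using mixed_difference_estimate[OF S f fi e, of i j] by blast
  obtain d2 where d2: "d2 > 0" "\<And>t. 0 < t \<Longrightarrow> t < d2 \<Longrightarrow>
    \<bar>f (p + t *\<^sub>R axis j 1 + t *\<^sub>R axis i 1) - f (p + t *\<^sub>R axis j 1) - f (p + t *\<^sub>R axis i 1) + f p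
      - t\<^sup>2 * partial_deriv i (partial_deriv j f) p\<bar> \<le> e * t\<^sup>2"
    using mixed_difference_estimate[OF S f fi e, of j i] by blast
  define t where "t = min d1 d2 / 2"
  have t: "0 < t" "t < d1" "t < d2" using d1 d2 by (auto simp: t_def)
  have sw: "p + t *\<^sub>R axis j 1 + t *\<^sub>R axis i 1 = p + t *\<^sub>R axis i 1 + t *\<^sub>R axis j 1" by simp
  have "\<bar>t\<^sup>2 * partial_deriv i (partial_deriv j f) p - t\<^sup>2 * partial_deriv j (partial_deriv i f) p\<bar> \<le> 2 * (e * t\<^sup>2)"
    using d1(2)[OF t(1,2)] d2(2)[OF t(1,3), unfolded sw] by linarith
  then have "t\<^sup>2 * (4 * e) \<le> t\<^sup>2 * (2 * e)"
    by (simp add: e_def right_diff_distrib[symmetric] abs_mult)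
  then show False using e t by simp
qed

lemma has_derivative_det_rows:
  fixes r :: "'n::finite \<Rightarrow> 'a::real_normed_vector \<Rightarrow> real^'n"
  assumes "\<And>k. (r k has_derivative r' k) (at p)"
  shows "((\<lambda>q. det (\<chi> k. r k q)) has_derivative
          (\<lambda>h. \<Sum>k\<in>UNIV. det (\<chi> l. if l = k then r' k h else r l p))) (at p)"
proof -
  have comp: "((\<lambda>q. r k q $ j) has_derivative (\<lambda>h. r' k h $ j)) (at p)" for k j
    by (rule bounded_linear.has_derivative[OF bounded_linear_vec_nth assms])
  have "((\<lambda>q. \<Sum>\<sigma> | \<sigma> permutes UNIV. of_int (sign \<sigma>) * (\<Prod>k\<in>UNIV. r k q $ \<sigma> k)) has_derivative
     (\<lambda>h. \<Sum>\<sigma> | \<sigma> permutes UNIV. of_int (sign \<sigma>) * (\<Sum>k\<in>UNIV. r' k h $ \<sigma> k * (\<Prod>l\<in>UNIV - {k}. r l p $ \<sigma> l)))) (at p)"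
    by (intro has_derivative_sum has_derivative_mult_right has_derivative_prod comp)
  moreover have "(\<Sum>\<sigma> | \<sigma> permutes UNIV. of_int (sign \<sigma>) * (\<Sum>k\<in>UNIV. r' k h $ \<sigma> k * (\<Prod>l\<in>UNIV - {k}. r l p $ \<sigma> l)))
     = (\<Sum>k\<in>UNIV. det (\<chi> l. if l = k then r' k h else r l p))" for h
  proof -
    have "(\<Prod>l\<in>UNIV. (if l = k then r' k h else r l p) $ \<sigma> l) = r' k h $ \<sigma> k * (\<Prod>l\<in>UNIV - {k}. r l p $ \<sigma> l)" for k \<sigma>
      by (subst prod.remove[of UNIV k]) auto
    then show ?thesis unfolding det_def
      by (subst sum.swap) (simp add: sum_distrib_left)
  qed
  ultimately show ?thesis unfolding det_def by simp
qed

lemma det_unit_rows_replace: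
  "det (\<chi> l. if l = k then v else (axis l 1 :: real^'n::finite)) = v $ k"
proof -
  have "(\<chi> l. if l = k then sum (\<lambda>i. v$i *s row i (mat 1)) (UNIV::'n set) else row l (mat 1)) = (\<chi> l. if l = k then v else (axis l 1 :: real^'n))"
  proof -
    have "row i (mat 1 :: real^'n^'n) = axis i 1" for i by (auto simp: row_def mat_def axis_def vec_eq_iff)
    then show ?thesis using vec_eq_sum_axis[of v] by (simp add: scalar_mult_eq_scaleR cong: if_cong)
  qed
  then show ?thesis using cramer_lemma_transpose[of k v "mat 1"] by simp
qed

text \<open>Let \<open>R\<close> be the matrix with rows \<open>r l\<close>. Both sides are the derivative at \<open>t = 0\<close> of
  \<open>det (R (1 + t N\<^sup>T)) = det R * det (1 + t N\<^sup>T)\<close>.\<close>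

lemma sum_det_linear_rows:
  fixes r :: "'n::finite \<Rightarrow> real^'n"
  assumes N: "linear N"
  shows "(\<Sum>k\<in>UNIV. det (\<chi> l. if l = k then N (r k) else r l)) = (\<Sum>k\<in>UNIV. N (axis k 1) $ k) * det (\<chi> l. r l)"
proof -
  have D: "((\<lambda>t::real. det (\<chi> l. s l + t *\<^sub>R N (s l))) has_derivative
     (\<lambda>h. \<Sum>k\<in>UNIV. det (\<chi> l. if l = k then h *\<^sub>R N (s k) else s l))) (at 0)" for s :: "'n \<Rightarrow> real^'n"
  proof -
    have "((\<lambda>t. s k + t *\<^sub>R N (s k)) has_derivative (\<lambda>h. h *\<^sub>R N (s k))) (at 0)" for k
      by (auto intro!: derivative_eq_intros)
    from has_derivative_det_rows[of "\<lambda>l t. s l + t *\<^sub>R N (s l)" "\<lambda>l h. h *\<^sub>R N (s l)" 0, OF this]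
    show ?thesis by (simp cong: if_cong)
  qed
  have prod: "det (\<chi> l. r l + t *\<^sub>R N (r l)) = det (\<chi> l. r l) * det (\<chi> l. axis l 1 + t *\<^sub>R N (axis l 1))" for t :: real
  proof -
    have "(\<chi> l. r l) ** (\<chi> l. axis l 1 + t *\<^sub>R N (axis l 1)) = (\<chi> l. r l + t *\<^sub>R N (r l))"
    proof -
      have "(\<Sum>k\<in>UNIV. r i $ k * (axis k 1 + t *\<^sub>R N (axis k 1)) $ j) = (r i + t *\<^sub>R N (r i)) $ j" for i j
      proof -
        have "(\<Sum>k\<in>UNIV. r i $ k * (axis k 1 + t *\<^sub>R N (axis k 1)) $ j) =
           (\<Sum>k\<in>UNIV. r i $ k *\<^sub>R axis k 1) $ j + t * (\<Sum>k\<in>UNIV. r i $ k *\<^sub>R N (axis k 1)) $ j"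
          by (simp add: sum.distrib sum_distrib_left algebra_simps)
        then show ?thesis unfolding vec_eq_sum_axis[symmetric] linear_eq_sum_axis[OF N, symmetric] by simp
      qed
      then show ?thesis by (simp add: matrix_matrix_mult_def vec_eq_iff)
    qed
    from arg_cong[OF this, of det] show ?thesis unfolding det_mul by (rule sym)
  qed
  have "((\<lambda>t. det (\<chi> l. r l) * det (\<chi> l. axis l 1 + t *\<^sub>R N (axis l 1))) has_derivative
     (\<lambda>h. det (\<chi> l. r l) * (\<Sum>k\<in>UNIV. det (\<chi> l. if l = k then h *\<^sub>R N (axis k 1) else axis l 1)))) (at 0)"
    by (rule has_derivative_mult_right[OF D])
  then have "(\<lambda>h. \<Sum>k\<in>UNIV. det (\<chi> l. if l = k then h *\<^sub>R N (r k) else r l))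
     = (\<lambda>h. det (\<chi> l. r l) * (\<Sum>k\<in>UNIV. det (\<chi> l. if l = k then h *\<^sub>R N (axis k 1) else axis l 1)))"
    using D[of r] unfolding prod by (rule has_derivative_unique[rotated])
  from fun_cong[OF this, of 1] show ?thesis
    by (simp add: det_unit_rows_replace mult.commute cong: if_cong)
qed


section \<open>A smooth cutoff function\<close>

lemma C_infinity_on_const: "C_infinity_on S (\<lambda>_. c)"
  unfolding C_infinity_on_def by (simp add: C_hoelder_on_const)

lemma C_infinity_on_bilinear:
  "bounded_bilinear h \<Longrightarrow> open S \<Longrightarrow> C_infinity_on S f \<Longrightarrow> C_infinity_on S g \<Longrightarrow> C_infinity_on S (\<lambda>x. h (f x) (g x))"
  unfolding C_infinity_on_def by (auto intro: C_hoelder_on_bilinear)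

lemma C_infinity_on_add:
  "open S \<Longrightarrow> C_infinity_on S f \<Longrightarrow> C_infinity_on S g \<Longrightarrow> C_infinity_on S (\<lambda>x. f x + g x)"
  unfolding C_infinity_on_def by (auto intro: C_hoelder_on_add)

lemma C_infinity_on_bounded_linear:
  "bounded_linear L \<Longrightarrow> open S \<Longrightarrow> C_infinity_on S f \<Longrightarrow> C_infinity_on S (\<lambda>x. L (f x))"
  unfolding C_infinity_on_def by (auto intro: C_hoelder_on_bounded_linear)

lemma C_infinity_on_diff:
  "open S \<Longrightarrow> C_infinity_on S f \<Longrightarrow> C_infinity_on S g \<Longrightarrow> C_infinity_on S (\<lambda>x. f x - g x)"
  using C_infinity_on_add[of S f "\<lambda>x. - g x"] C_infinity_on_bounded_linear[OF bounded_linear_minus[OF bounded_linear_ident], of S g]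
  by simp

lemma C_infinity_on_sum:
  "open S \<Longrightarrow> (\<And>i. i \<in> I \<Longrightarrow> C_infinity_on S (f i)) \<Longrightarrow> C_infinity_on S (\<lambda>x. \<Sum>i\<in>I. f i x)"
  unfolding C_infinity_on_def by (auto intro: C_hoelder_on_sum)

lemma C_infinity_on_subset: "C_infinity_on S f \<Longrightarrow> T \<subseteq> S \<Longrightarrow> C_infinity_on T f"
  unfolding C_infinity_on_def using C_hoelder_on_subset by blast

lemma C_infinity_on_cong: "open S \<Longrightarrow> C_infinity_on S f \<Longrightarrow> (\<And>x. x \<in> S \<Longrightarrow> f x = g x) \<Longrightarrow> C_infinity_on S g"
  unfolding C_infinity_on_def using C_hoelder_on_cong by blast

lemma C_infinity_on_ident: "C_infinity_on S (\<lambda>x::real^'n::finite. x)"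
  unfolding C_infinity_on_def
proof
  fix n show "C_hoelder_on 0 n S (\<lambda>x::real^'n. x)"
  proof (cases n)
    case (Suc k)
    have "partial_deriv i (\<lambda>x::real^'n. x) = (\<lambda>_. axis i 1)" for i
      by (rule ext) (simp add: partial_deriv_eq[OF has_derivative_ident])
    then show ?thesis using Suc by (simp add: C_hoelder_on_const)
  qed auto
qed

text \<open>A smooth function of one variable enters as a member of a family \<open>F\<close> of functions whose
  derivatives are linear combinations of members of the family. Powers of the inverse and the
  functions \<open>flat_exp\<close> below are of this kind.\<close>

lemma C_infinity_on_compose_real:
  fixes F :: "'k \<Rightarrow> real \<Rightarrow> real" and u :: "real^'n::finite \<Rightarrow> real"
  assumes S: "open S" and u: "C_infinity_on S u"
    and F: "\<And>k x. x \<in> S \<Longrightarrow> (F k has_real_derivative c k * F (d k) (u x) + c' k * F (d' k) (u x)) (at (u x))"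
  shows "C_infinity_on S (\<lambda>x. F k (u x))"
proof -
  have D: "((\<lambda>x. F k (u x)) has_derivative
      (\<lambda>h. frechet_derivative u (at x) h * (c k * F (d k) (u x) + c' k * F (d' k) (u x)))) (at x)" if "x \<in> S" for k x
  proof -
    have "(u has_derivative frechet_derivative u (at x)) (at x)"
      using C_infinity_on_differentiable[OF u that] frechet_derivative_works by blast
    from has_derivative_compose[OF this F[OF that, unfolded has_field_derivative_def]]
    show ?thesis by (simp add: mult.commute)
  qed
  have "C_hoelder_on 0 n S (\<lambda>x. F k (u x))" for n k
  proof (induction n arbitrary: k)
    case 0
    have "continuous_on S (\<lambda>x. F k (u x))"
      by (intro continuous_at_imp_continuous_on ballI has_derivative_continuous[OF D])
    then show ?case by simp
  next
    case (Suc n)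
    have "C_hoelder_on 0 n S (partial_deriv i (\<lambda>x. F k (u x)))" for i
    proof (rule C_hoelder_on_cong[OF S])
      show "C_hoelder_on 0 n S (\<lambda>x. partial_deriv i u x * (c k * F (d k) (u x) + c' k * F (d' k) (u x)))"
        using C_infinity_on_partial[OF u]
        by (intro C_hoelder_on_mult[OF S] C_hoelder_on_add[OF S] Suc.IH C_hoelder_on_const) (auto simp: C_infinity_on_def)
      show "partial_deriv i u x * (c k * F (d k) (u x) + c' k * F (d' k) (u x)) = partial_deriv i (\<lambda>x. F k (u x)) x"
        if "x \<in> S" for x using partial_deriv_eq[OF D[OF that]] by (simp add: partial_deriv_def)
    qed
    then show ?case using D by (auto simp: differentiable_def)
  qed
  then show ?thesis by (simp add: C_infinity_on_def)
qed

lemma C_infinity_on_inverse: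
  fixes u :: "real^'n::finite \<Rightarrow> real"
  assumes S: "open S" and u: "C_infinity_on S u" and nz: "\<And>x. x \<in> S \<Longrightarrow> u x \<noteq> 0"
  shows "C_infinity_on S (\<lambda>x. inverse (u x))"
proof -
  have "((\<lambda>y. inverse y ^ k) has_real_derivative - real k * inverse (u x) ^ Suc k + 0 * inverse (u x) ^ k) (at (u x))"
    if "x \<in> S" for k x
    using nz[OF that] by (auto intro!: derivative_eq_intros simp: power_Suc2 field_simps power2_eq_square)
      (cases k; simp add: field_simps)
  from C_infinity_on_compose_real[OF S u, of "\<lambda>k y. inverse y ^ k" "\<lambda>k. - real k" Suc "\<lambda>_. 0" "\<lambda>k. k" 1, OF this]
  show ?thesis by simp
qed

text \<open>The functions \<open>t\<^sup>-\<^sup>k exp (-1/t)\<close>, extended by \<open>0\<close>. They arise as derivatives of the case \<open>k = 0\<close>,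
  the standard smooth function that is flat at \<open>0\<close>.\<close>

definition flat_exp :: "nat \<Rightarrow> real \<Rightarrow> real" where
  "flat_exp k t = (if t > 0 then inverse t ^ k * exp (- inverse t) else 0)"

lemma flat_exp_tendsto_0: "(flat_exp k \<longlongrightarrow> 0) (at 0)"
proof -
  have "((\<lambda>t. inverse t ^ k / exp (inverse t)) \<longlongrightarrow> 0) (at_right (0::real))"
    using filterlim_compose[OF tendsto_power_div_exp_0 filterlim_inverse_at_top_right] .
  moreover have "\<forall>\<^sub>F t in at_right 0. inverse t ^ k / exp (inverse t) = flat_exp k t"
    using eventually_at_right_less[of 0] by eventually_elim (simp add: flat_exp_def exp_minus divide_inverse)
  ultimately have r: "(flat_exp k \<longlongrightarrow> 0) (at_right 0)" by (rule Lim_transform_eventually)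
  have "\<forall>\<^sub>F t in at_left 0. 0 = flat_exp k t"
    by (auto simp: eventually_at_filter flat_exp_def)
  then have "(flat_exp k \<longlongrightarrow> 0) (at_left 0)" by (rule Lim_transform_eventually[OF tendsto_const])
  then show ?thesis using r by (simp add: filterlim_split_at)
qed

text \<open>At \<open>0\<close> the difference quotient of the function with index \<open>k\<close> is the function with index
  \<open>k + 1\<close>, which tends to \<open>0\<close>.\<close>

lemma flat_exp_deriv:
  "(flat_exp k has_real_derivative - real k * flat_exp (k + 1) t + 1 * flat_exp (k + 2) t) (at t)"
proof -
  consider "t < 0" | "t = 0" | "t > 0" by linarith
  then show ?thesis
  proof cases
    case 1
    have "((\<lambda>_. 0) has_real_derivative 0) (at t)" by simp
    then have "(flat_exp k has_real_derivative 0) (at t)"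
      by (rule has_field_derivative_transform_within_open[of _ _ _ "{..<0}"]) (use 1 in \<open>auto simp: flat_exp_def\<close>)
    then show ?thesis using 1 by (simp add: flat_exp_def)
  next
    case 2
    have "((\<lambda>h. (flat_exp k (0 + h) - flat_exp k 0) / h) \<longlongrightarrow> 0) (at 0)"
    proof (rule Lim_transform_eventually[OF flat_exp_tendsto_0[of "k + 1"]])
      show "\<forall>\<^sub>F h in at 0. flat_exp (k + 1) h = (flat_exp k (0 + h) - flat_exp k 0) / h"
        by (auto simp: flat_exp_def eventually_at_filter field_simps)
    qed
    then have "(flat_exp k has_real_derivative 0) (at 0)" by (simp add: DERIV_def)
    then show ?thesis using 2 by (simp add: flat_exp_def)
  next
    case 3
    have "((\<lambda>t. inverse t ^ k * exp (- inverse t)) has_real_derivative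
       - real k * flat_exp (k + 1) t + 1 * flat_exp (k + 2) t) (at t)"
    proof -
      have a: "((\<lambda>t. inverse t ^ k) has_real_derivative real k * (inverse t ^ (k - 1) * - (inverse t ^ 2))) (at t)"
        using 3 by (auto intro!: derivative_eq_intros simp: power2_eq_square)
      have b: "((\<lambda>t. exp (- inverse t)) has_real_derivative exp (- inverse t) * inverse t ^ 2) (at t)"
        using 3 by (auto intro!: derivative_eq_intros simp: power2_eq_square)
      \<comment> \<open>for \<open>k = 0\<close> the truncated exponent \<open>k - 1\<close> is harmless because of the factor \<open>real k\<close>\<close>
      have c: "real k * inverse t ^ (k - 1) * inverse t = real k * inverse t ^ k" by (cases k) auto
      have "real k * (inverse t ^ (k - 1) * - (inverse t ^ 2)) * exp (- inverse t) + exp (- inverse t) * inverse t ^ 2 * inverse t ^ k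
          = - (real k * inverse t ^ (k - 1) * inverse t) * inverse t * exp (- inverse t) + inverse t ^ (k + 2) * exp (- inverse t)"
        by (simp add: power2_eq_square power_add algebra_simps)
      also have "\<dots> = - real k * flat_exp (k + 1) t + 1 * flat_exp (k + 2) t"
        unfolding c using 3 by (simp add: flat_exp_def algebra_simps)
      finally show ?thesis using DERIV_mult[OF a b] by simp
    qed
    then show ?thesis
      by (rule has_field_derivative_transform_within_open[of _ _ _ "{0<..}"]) (use 3 in \<open>auto simp: flat_exp_def\<close>)
  qed
qed

lemma smooth_cutoff_exists:
  obtains \<rho> :: "real^'n::finite \<Rightarrow> real" where "C_infinity_on UNIV \<rho>"
    "\<And>x. norm x \<le> 1/2 \<Longrightarrow> \<rho> x = 1" "\<And>x. norm x \<ge> 3/4 \<Longrightarrow> \<rho> x = 0"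
proof -
  let ?u = "\<lambda>x::real^'n. x \<bullet> x"
  have u: "C_infinity_on UNIV ?u"
    by (intro C_infinity_on_bilinear[OF bounded_bilinear_inner] C_infinity_on_ident) auto
  \<comment> \<open>\<open>?f\<close> vanishes for \<open>\<bar>x\<bar>\<^sup>2 \<ge> 1/2\<close>, \<open>?g\<close> for \<open>\<bar>x\<bar>\<^sup>2 \<le> 1/4\<close>, and nowhere do both vanish\<close>
  let ?f = "\<lambda>x. flat_exp 0 (1/2 - ?u x)" and ?g = "\<lambda>x. flat_exp 0 (?u x - 1/4)"
  have f: "C_infinity_on UNIV ?f"
    by (rule C_infinity_on_compose_real[OF _ _ flat_exp_deriv, of UNIV]) (auto intro!: C_infinity_on_diff C_infinity_on_const u)
  have g: "C_infinity_on UNIV ?g"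
    by (rule C_infinity_on_compose_real[OF _ _ flat_exp_deriv, of UNIV]) (auto intro!: C_infinity_on_diff C_infinity_on_const u)
  have pos: "?f x + ?g x > 0" for x by (auto simp: flat_exp_def add_pos_pos)
  let ?r = "\<lambda>x. ?f x * inverse (?f x + ?g x)"
  have "C_infinity_on UNIV ?r"
    using pos by (intro C_infinity_on_bilinear[OF bounded_bilinear_mult] C_infinity_on_inverse C_infinity_on_add f g) (auto simp: less_le)
  moreover have "?r x = 1" if "norm x \<le> 1/2" for x
  proof -
    have "(norm x)\<^sup>2 \<le> (1/2)\<^sup>2" using that by (intro power_mono) auto
    then have "?u x \<le> 1/4" by (simp add: power2_norm_eq_inner) (simp add: power2_eq_square)
    then show ?thesis using pos[of x] by (simp add: flat_exp_def)
  qed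
  moreover have "?r x = 0" if "norm x \<ge> 3/4" for x
  proof -
    have "(norm x)\<^sup>2 \<ge> (3/4)\<^sup>2" using that by (intro power_mono) auto
    then have "?u x \<ge> 9/16" by (simp add: power2_norm_eq_inner) (simp add: power2_eq_square)
    then show ?thesis by (simp add: flat_exp_def)
  qed
  ultimately show ?thesis by (rule that)
qed

section \<open>Radial averages\<close>

text \<open>For \<open>k = n - 2\<close> this is the average along rays in the homotopy formula of the Poincare lemma for
  \<open>(n - 1)\<close>-forms on \<open>\<real>\<^sup>n\<close>, which correspond to vector fields.\<close>

definition radial_mean :: "nat \<Rightarrow> (real^'n \<Rightarrow> 'b::euclidean_space) \<Rightarrow> real^'n \<Rightarrow> 'b" where
  "radial_mean k Y x = integral {0..1} (\<lambda>t. t ^ k *\<^sub>R Y (t *\<^sub>R x))"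

lemma scale_in_ball:
  assumes "x \<in> ball (0::'a::real_normed_vector) R" "t \<in> {0..1::real}" shows "t *\<^sub>R x \<in> ball 0 R"
proof -
  have "t * norm x \<le> 1 * norm x" using assms by (intro mult_right_mono) auto
  then show ?thesis using assms by simp
qed

lemma continuous_on_radial:
  fixes Y :: "'a::real_normed_vector \<Rightarrow> 'b::real_normed_vector"
  assumes "continuous_on (ball 0 R) Y" "x \<in> ball 0 R"
  shows "continuous_on {0..1} (\<lambda>t::real. t ^ k *\<^sub>R Y (t *\<^sub>R x))"
  by (intro continuous_intros continuous_on_compose2[OF assms(1)]) (use scale_in_ball[OF assms(2)] in auto)

lemma radial_mean_continuous:
  fixes Y :: "real^'n::finite \<Rightarrow> 'b::euclidean_space"
  assumes Y: "continuous_on (ball 0 R) Y"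
  shows "continuous_on (ball 0 R) (radial_mean k Y)"
proof -
  have "continuous_on (ball 0 R \<times> cbox 0 1) (\<lambda>(x, t::real). t ^ k *\<^sub>R Y (t *\<^sub>R x))"
    unfolding split_beta
    by (intro continuous_intros continuous_on_compose2[OF Y])
      (use scale_in_ball in \<open>force simp: cbox_interval\<close>)
  from integral_continuous_on_param[OF this] show ?thesis
    unfolding radial_mean_def cbox_interval .
qed

lemma radial_mean_norm_le:
  fixes Y :: "real^'n::finite \<Rightarrow> 'b::euclidean_space"
  assumes Y: "continuous_on (ball 0 R) Y" and x: "x \<in> ball 0 R"
    and B: "\<And>t. t \<in> {0..1} \<Longrightarrow> norm (Y (t *\<^sub>R x)) \<le> B"
  shows "norm (radial_mean k Y x) \<le> B"
proof -
  have "norm (integral {0..1} (\<lambda>t. t ^ k *\<^sub>R Y (t *\<^sub>R x))) \<le> B * (1 - 0)"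
  proof (rule integral_bound)
    fix t :: real assume t: "t \<in> {0..1}"
    have "t ^ k * norm (Y (t *\<^sub>R x)) \<le> 1 * B"
      using t B[OF t] by (intro mult_mono power_le_one) auto
    then show "norm (t ^ k *\<^sub>R Y (t *\<^sub>R x)) \<le> B" using t by simp
  qed (use continuous_on_radial[OF Y x] in auto)
  then show ?thesis by (simp add: radial_mean_def)
qed

lemma radial_mean_has_derivative:
  fixes Y :: "real^'n::finite \<Rightarrow> 'b::euclidean_space"
  assumes Y: "\<And>x. x \<in> ball 0 R \<Longrightarrow> Y differentiable (at x)"
    and cY: "\<And>i. continuous_on (ball 0 R) (partial_deriv i Y)" and x: "x \<in> ball 0 R"
  shows "partial_deriv i (radial_mean k Y) x = radial_mean (Suc k) (partial_deriv i Y) x"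
    and "radial_mean k Y differentiable (at x)"
proof -
  define nth :: "'n \<Rightarrow> (real^'n) \<Rightarrow>\<^sub>L real" where "nth = (\<lambda>i. Blinfun (\<lambda>h. h $ i))"
  have nth: "blinfun_apply (nth i) h = h $ i" for i h
    unfolding nth_def by (simp add: bounded_linear_Blinfun_apply bounded_linear_vec_nth)
  define fx where "fx = (\<lambda>x t. \<Sum>i\<in>UNIV. blinfun_scaleR_left (t ^ Suc k *\<^sub>R partial_deriv i Y (t *\<^sub>R x)) o\<^sub>L nth i)"
  have fx: "blinfun_apply (fx x t) h = t ^ Suc k *\<^sub>R (\<Sum>i\<in>UNIV. h $ i *\<^sub>R partial_deriv i Y (t *\<^sub>R x))" for x t h
    by (simp add: fx_def blinfun.sum_left nth scaleR_sum_right mult_ac)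
  have cY0: "continuous_on (ball 0 R) Y"
    using Y by (auto intro!: continuous_at_imp_continuous_on differentiable_imp_continuous_within)
  have D: "((\<lambda>x. t ^ k *\<^sub>R Y (t *\<^sub>R x)) has_derivative blinfun_apply (fx x t)) (at x within ball 0 R)"
    if "x \<in> ball 0 R" "t \<in> cbox 0 1" for x and t :: real
  proof -
    have "t *\<^sub>R x \<in> ball 0 R" using scale_in_ball that by (auto simp: cbox_interval)
    then have "(Y has_derivative (\<lambda>h. \<Sum>i\<in>UNIV. h $ i *\<^sub>R partial_deriv i Y (t *\<^sub>R x))) (at (t *\<^sub>R x))"
      using Y has_derivative_partials by blast
    then have "((\<lambda>x. Y (t *\<^sub>R x)) has_derivative (\<lambda>h. \<Sum>i\<in>UNIV. (t *\<^sub>R h) $ i *\<^sub>R partial_deriv i Y (t *\<^sub>R x))) (at x)"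
      by (rule has_derivative_compose[rotated]) (auto intro!: derivative_eq_intros)
    then have "((\<lambda>x. t ^ k *\<^sub>R Y (t *\<^sub>R x)) has_derivative (\<lambda>h. t ^ k *\<^sub>R (\<Sum>i\<in>UNIV. (t *\<^sub>R h) $ i *\<^sub>R partial_deriv i Y (t *\<^sub>R x)))) (at x)"
      by (rule has_derivative_scaleR_right)
    moreover have "(\<lambda>h. t ^ k *\<^sub>R (\<Sum>i\<in>UNIV. (t *\<^sub>R h) $ i *\<^sub>R partial_deriv i Y (t *\<^sub>R x))) = blinfun_apply (fx x t)"
      by (rule ext) (simp add: fx scaleR_sum_right mult_ac)
    ultimately show ?thesis using has_derivative_at_withinI by metis
  qed
  have c: "continuous_on (ball 0 R \<times> cbox 0 (1::real)) (\<lambda>(x, t). fx x t)"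
  proof -
    have "continuous_on (ball 0 R \<times> cbox 0 (1::real)) (\<lambda>z. partial_deriv i Y (snd z *\<^sub>R fst z))" for i
      by (intro continuous_intros continuous_on_compose2[OF cY])
        (use scale_in_ball in \<open>force simp: cbox_interval\<close>)
    then show ?thesis unfolding fx_def split_beta by (auto intro!: continuous_intros)
  qed
  have int: "(\<lambda>t. t ^ k *\<^sub>R Y (t *\<^sub>R x)) integrable_on cbox 0 1" if "x \<in> ball 0 R" for x
    unfolding cbox_interval by (rule integrable_continuous_interval[OF continuous_on_radial[OF cY0 that]])
  have "(radial_mean k Y has_derivative blinfun_apply (integral (cbox 0 1) (fx x))) (at x within ball 0 R)"
    using leibniz_rule[OF D int c x convex_ball] unfolding radial_mean_def[abs_def] cbox_interval .
  then have DR: "(radial_mean k Y has_derivative blinfun_apply (integral (cbox 0 1) (fx x))) (at x)"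
    using at_within_open[OF x open_ball] by simp
  then show "radial_mean k Y differentiable (at x)" by (auto simp: differentiable_def)
  have "fx x integrable_on cbox 0 1"
  proof (rule integrable_continuous)
    have "continuous_on (cbox 0 1) (\<lambda>t. (\<lambda>(x, t). fx x t) (x, t))"
      by (rule continuous_on_compose2[OF c]) (use x in \<open>auto intro!: continuous_intros\<close>)
    then show "continuous_on (cbox 0 1) (fx x)" by simp
  qed
  then have "blinfun_apply (integral (cbox 0 1) (fx x)) (axis i 1) = integral (cbox 0 1) (\<lambda>t. blinfun_apply (fx x t) (axis i 1))"
    by (rule blinfun_apply_integral)
  moreover have "blinfun_apply (fx x t) (axis i 1) = t ^ Suc k *\<^sub>R partial_deriv i Y (t *\<^sub>R x)" for t
    unfolding fx by (simp add: axis_def if_distrib if_distribR cong: if_cong)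
  ultimately show "partial_deriv i (radial_mean k Y) x = radial_mean (Suc k) (partial_deriv i Y) x"
    unfolding partial_deriv_eq[OF DR] by (simp add: radial_mean_def cbox_interval)
qed

text \<open>Averaging over the points \<open>t x\<close> with \<open>t \<le> 1\<close> does not increase a Hoelder constant, and a partial
  derivative of a radial mean is a radial mean of the same partial derivative with the next
  weight, so that no derivative is lost.\<close>

lemma C_hoelder_on_radial_mean:
  fixes Y :: "real^'n::finite \<Rightarrow> 'b::euclidean_space"
  assumes b: "0 \<le> b" "b \<le> 1"
  shows "C_hoelder_on b n (ball 0 R) Y \<Longrightarrow> C_hoelder_on b n (ball 0 R) (radial_mean k Y)"
proof (induction n arbitrary: k Y)
  case 0
  then have cY: "continuous_on (ball 0 R) Y" by simp
  have "\<exists>e>0. hoelder_on b (ball 0 R \<inter> ball p e) (radial_mean k Y)" if bp: "b > 0" and p: "p \<in> ball 0 R" for p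
  proof -
    define r where "r = (norm p + R) / 2"
    have r: "norm p < r" "r < R" using p by (auto simp: r_def)
    have "hoelder_on b (cball 0 r) Y"
      by (rule C_hoelder_on_compact[OF 0 bp]) (use r in auto)
    then obtain C where C: "C \<ge> 0" "\<And>x y. x \<in> cball 0 r \<Longrightarrow> y \<in> cball 0 r \<Longrightarrow> norm (Y x - Y y) \<le> C * norm (x - y) powr b"
      using hoelder_onE by blast
    have "norm (radial_mean k Y x - radial_mean k Y y) \<le> C * norm (x - y) powr b"
      if xy: "x \<in> ball 0 R \<inter> ball p (r - norm p)" "y \<in> ball 0 R \<inter> ball p (r - norm p)" for x y
    proof -
      have n: "norm x \<le> r" "norm y \<le> r"
        using xy norm_triangle_sub[of x p] norm_triangle_sub[of y p] by (auto simp: dist_norm norm_minus_commute)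
      have "radial_mean k Y x - radial_mean k Y y = integral {0..1} (\<lambda>t. t ^ k *\<^sub>R Y (t *\<^sub>R x) - t ^ k *\<^sub>R Y (t *\<^sub>R y))"
        unfolding radial_mean_def
        by (rule integral_diff[symmetric]; rule integrable_continuous_interval[OF continuous_on_radial[OF cY]]) (use xy in auto)
      also have "norm \<dots> \<le> (C * norm (x - y) powr b) * (1 - 0)"
      proof (rule integral_bound)
        show "continuous_on {0..1} (\<lambda>t. t ^ k *\<^sub>R Y (t *\<^sub>R x) - t ^ k *\<^sub>R Y (t *\<^sub>R y))"
          by (rule continuous_on_diff; rule continuous_on_radial[OF cY]) (use xy in auto)
        fix t :: real assume t: "t \<in> {0..1}"
        have tn: "t * norm z \<le> norm z" for z :: "real^'n" using t mult_right_mono[of t 1 "norm z"] by simp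
        have "norm (Y (t *\<^sub>R x) - Y (t *\<^sub>R y)) \<le> C * norm (t *\<^sub>R x - t *\<^sub>R y) powr b"
          by (rule C(2)) (use t n tn[of x] tn[of y] in auto)
        also have "norm (t *\<^sub>R x - t *\<^sub>R y) = t * norm (x - y)" using t by (simp add: scaleR_diff_right[symmetric])
        also have "C * (t * norm (x - y)) powr b \<le> C * norm (x - y) powr b"
          using t b C(1) tn by (intro mult_left_mono powr_mono2) auto
        finally have 1: "norm (Y (t *\<^sub>R x) - Y (t *\<^sub>R y)) \<le> C * norm (x - y) powr b" .
        have "t ^ k * norm (Y (t *\<^sub>R x) - Y (t *\<^sub>R y)) \<le> 1 * (C * norm (x - y) powr b)"
          by (rule mult_mono) (use t 1 in \<open>auto intro: power_le_one\<close>)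
        then show "norm (t ^ k *\<^sub>R Y (t *\<^sub>R x) - t ^ k *\<^sub>R Y (t *\<^sub>R y)) \<le> C * norm (x - y) powr b"
          using t by (simp add: scaleR_diff_right[symmetric])
      qed auto
      finally show ?thesis by simp
    qed
    then have "hoelder_on b (ball 0 R \<inter> ball p (r - norm p)) (radial_mean k Y)" by (rule hoelder_onI)
    then show ?thesis using r by (intro exI[of _ "r - norm p"]) auto
  qed
  then show ?case using radial_mean_continuous[OF cY] by simp
next
  case (Suc n)
  have d: "\<And>x. x \<in> ball 0 R \<Longrightarrow> Y differentiable (at x)" and c: "\<And>i. continuous_on (ball 0 R) (partial_deriv i Y)"
    using Suc.prems by (simp_all add: C_hoelder_on_continuous[of b n])
  have "C_hoelder_on b n (ball 0 R) (partial_deriv i (radial_mean k Y))" for i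
    by (rule C_hoelder_on_cong[of _ _ _ "radial_mean (Suc k) (partial_deriv i Y)"])
      (use Suc radial_mean_has_derivative(1)[OF d c] in auto)
  then show ?case using radial_mean_has_derivative(2)[OF d c] by auto
qed

text \<open>The left-hand side is the integral over \<open>[0, 1]\<close> of the derivative of
  \<open>t\<^sup>k\<^sup>+\<^sup>1 Y(t x)\<close>.\<close>

lemma radial_mean_euler:
  fixes Y :: "real^'n::finite \<Rightarrow> 'b::euclidean_space"
  assumes Y: "\<And>x. x \<in> ball 0 R \<Longrightarrow> Y differentiable (at x)"
    and cY: "\<And>i. continuous_on (ball 0 R) (partial_deriv i Y)" and x: "x \<in> ball 0 R"
  shows "real (Suc k) *\<^sub>R radial_mean k Y x + (\<Sum>i\<in>UNIV. x $ i *\<^sub>R partial_deriv i (radial_mean k Y) x) = Y x"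
proof -
  have cY0: "continuous_on (ball 0 R) Y"
    using Y by (auto intro!: continuous_at_imp_continuous_on differentiable_imp_continuous_within)
  let ?f = "\<lambda>t::real. t ^ Suc k *\<^sub>R Y (t *\<^sub>R x)"
  let ?f' = "\<lambda>t::real. real (Suc k) *\<^sub>R (t ^ k *\<^sub>R Y (t *\<^sub>R x)) + (\<Sum>i\<in>UNIV. x $ i *\<^sub>R (t ^ Suc k *\<^sub>R partial_deriv i Y (t *\<^sub>R x)))"
  have "(?f has_vector_derivative ?f' t) (at t within {0..1})" if t: "t \<in> {0..1}" for t
  proof -
    have "(Y has_derivative (\<lambda>h. \<Sum>i\<in>UNIV. h $ i *\<^sub>R partial_deriv i Y (t *\<^sub>R x))) (at (t *\<^sub>R x))"
      using Y[OF scale_in_ball[OF x t]] has_derivative_partials by blast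
    then have "((\<lambda>t. Y (t *\<^sub>R x)) has_derivative (\<lambda>h. \<Sum>i\<in>UNIV. (h *\<^sub>R x) $ i *\<^sub>R partial_deriv i Y (t *\<^sub>R x))) (at t)"
      by (rule has_derivative_compose[rotated]) (auto intro!: derivative_eq_intros)
    then have "((\<lambda>t. Y (t *\<^sub>R x)) has_vector_derivative (\<Sum>i\<in>UNIV. x $ i *\<^sub>R partial_deriv i Y (t *\<^sub>R x))) (at t)"
      by (simp add: has_vector_derivative_def scaleR_sum_right)
    moreover have "((\<lambda>t. t ^ Suc k) has_real_derivative real (Suc k) * t ^ k) (at t)"
      by (rule derivative_eq_intros refl)+ simp
    ultimately have "(?f has_vector_derivative (t ^ Suc k *\<^sub>R (\<Sum>i\<in>UNIV. x $ i *\<^sub>R partial_deriv i Y (t *\<^sub>R x)) + (real (Suc k) * t ^ k) *\<^sub>R Y (t *\<^sub>R x))) (at t)"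
      by (rule has_vector_derivative_scaleR[rotated])
    then show ?thesis
      by (simp add: has_vector_derivative_at_within scaleR_sum_right mult_ac add.commute)
  qed
  then have "(?f' has_integral (?f 1 - ?f 0)) {0..1}"
    by (intro fundamental_theorem_of_calculus) auto
  then have "integral {0..1} ?f' = Y x" by (simp add: integral_unique)
  moreover have "integral {0..1} ?f' = real (Suc k) *\<^sub>R radial_mean k Y x + (\<Sum>i\<in>UNIV. x $ i *\<^sub>R radial_mean (Suc k) (partial_deriv i Y) x)"
  proof -
    have 1: "(\<lambda>t. t ^ k *\<^sub>R Y (t *\<^sub>R x)) integrable_on {0..1}"
      by (rule integrable_continuous_interval[OF continuous_on_radial[OF cY0 x]])
    have 2: "(\<lambda>t. t ^ Suc k *\<^sub>R partial_deriv i Y (t *\<^sub>R x)) integrable_on {0..1}" for i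
      by (rule integrable_continuous_interval[OF continuous_on_radial[OF cY x]])
    have "integral {0..1} ?f' = integral {0..1} (\<lambda>t. real (Suc k) *\<^sub>R (t ^ k *\<^sub>R Y (t *\<^sub>R x))) +
       integral {0..1} (\<lambda>t. \<Sum>i\<in>UNIV. x $ i *\<^sub>R (t ^ Suc k *\<^sub>R partial_deriv i Y (t *\<^sub>R x)))"
      by (intro integral_add integrable_cmul integrable_sum 1 2) auto
    also have "integral {0..1} (\<lambda>t. \<Sum>i\<in>UNIV. x $ i *\<^sub>R (t ^ Suc k *\<^sub>R partial_deriv i Y (t *\<^sub>R x)))
       = (\<Sum>i\<in>UNIV. integral {0..1} (\<lambda>t. x $ i *\<^sub>R (t ^ Suc k *\<^sub>R partial_deriv i Y (t *\<^sub>R x))))"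
      by (intro integral_sum integrable_cmul 2) auto
    finally show ?thesis by (simp only: integral_cmul radial_mean_def)
  qed
  ultimately show ?thesis using radial_mean_has_derivative(1)[OF Y cY x] by simp
qed


section \<open>Localizing a divergence-free field\<close>

lemma frechet_derivative_axis: "frechet_derivative f (at p) (axis i 1) = partial_deriv i f p"
  by (simp add: partial_deriv_def)

lemma partial_deriv_const [simp]: "partial_deriv i (\<lambda>_. c) p = 0"
  using partial_deriv_eq[OF has_derivative_const] .

lemma partial_deriv_nth:
  assumes "f differentiable (at p)"
  shows "partial_deriv i (\<lambda>q. f q $ k) p = partial_deriv i f p $ k"
    and "(\<lambda>q. f q $ k) differentiable (at p)"
proof -
  have "(f has_derivative frechet_derivative f (at p)) (at p)" using assms frechet_derivative_works by blast
  from bounded_linear.has_derivative[OF bounded_linear_vec_nth this, of k]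
  show "partial_deriv i (\<lambda>q. f q $ k) p = partial_deriv i f p $ k" "(\<lambda>q. f q $ k) differentiable (at p)"
    by (auto simp: partial_deriv_eq differentiable_def) (simp add: partial_deriv_def)
qed

lemma partial_deriv_affine:
  fixes f :: "real^'n::finite \<Rightarrow> 'b::real_normed_vector"
  assumes "f differentiable (at (a + r *\<^sub>R x))"
  shows "partial_deriv i (\<lambda>x. f (a + r *\<^sub>R x)) x = r *\<^sub>R partial_deriv i f (a + r *\<^sub>R x)"
    and "(\<lambda>x. f (a + r *\<^sub>R x)) differentiable (at x)"
proof -
  let ?D = "frechet_derivative f (at (a + r *\<^sub>R x))"
  have D: "(f has_derivative ?D) (at (a + r *\<^sub>R x))"
    using assms frechet_derivative_works by blast
  then have l: "linear ?D" using has_derivative_linear by blast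
  have "((\<lambda>x. f (a + r *\<^sub>R x)) has_derivative (\<lambda>h. ?D (r *\<^sub>R h))) (at x)"
    by (rule has_derivative_compose[of "\<lambda>x. a + r *\<^sub>R x" "\<lambda>h. r *\<^sub>R h", OF _ D]) (auto intro!: derivative_eq_intros)
  then show "partial_deriv i (\<lambda>x. f (a + r *\<^sub>R x)) x = r *\<^sub>R partial_deriv i f (a + r *\<^sub>R x)"
    "(\<lambda>x. f (a + r *\<^sub>R x)) differentiable (at x)"
    by (auto simp: partial_deriv_eq differentiable_def) (simp add: partial_deriv_def linear_cmul[OF l])
qed

lemma C_infinity_on_affine: "C_infinity_on S (\<lambda>x::real^'n::finite. a + r *\<^sub>R x)"
proof -
  have "C_infinity_on UNIV (\<lambda>x::real^'n. a + r *\<^sub>R x)"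
    by (intro C_infinity_on_add C_infinity_on_const C_infinity_on_bounded_linear[OF bounded_linear_scaleR_right] C_infinity_on_ident) auto
  then show ?thesis using C_infinity_on_subset by blast
qed

definition gradient :: "(real^'n \<Rightarrow> real) \<Rightarrow> real^'n \<Rightarrow> real^'n::finite" where
  "gradient \<rho> x = (\<chi> i. partial_deriv i \<rho> x)"

lemma C_infinity_on_gradient:
  assumes "open S" "C_infinity_on S \<rho>" shows "C_infinity_on S (gradient \<rho>)"
proof (rule C_infinity_on_cong[OF assms(1)])
  show "C_infinity_on S (\<lambda>x. \<Sum>i\<in>UNIV. partial_deriv i \<rho> x *\<^sub>R axis i 1)"
    by (intro C_infinity_on_sum C_infinity_on_bilinear[OF bounded_bilinear_scaleR] C_infinity_on_const
        C_infinity_on_partial assms)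
  show "(\<Sum>i\<in>UNIV. partial_deriv i \<rho> x *\<^sub>R axis i 1) = gradient \<rho> x" for x
    using vec_eq_sum_axis[of "gradient \<rho> x"] by (simp add: gradient_def)
qed

lemma partial_deriv_gradient_commute:
  assumes "C_infinity_on UNIV \<rho>"
  shows "partial_deriv i (gradient \<rho>) x $ j = partial_deriv j (gradient \<rho>) x $ i"
proof -
  have d: "gradient \<rho> differentiable (at x)"
    using C_infinity_on_gradient[OF open_UNIV assms] C_infinity_on_differentiable by blast
  have e: "(\<lambda>q. gradient \<rho> q $ j) = partial_deriv j \<rho>" for j by (simp add: gradient_def fun_eq_iff)
  show ?thesis
    using partial_deriv_nth(1)[OF d, of i j] partial_deriv_nth(1)[OF d, of j i] unfolding e
    using mixed_partials_commute[of UNIV x \<rho> i j] C_infinity_on_differentiable[OF assms]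
      C_infinity_on_differentiable[OF C_infinity_on_partial[OF assms]] by simp
qed

text \<open>For divergence-free \<open>Y\<close> these are the row divergences of the antisymmetric tensor field
  \<open>\<rho> (G\<^sub>i x\<^sub>j - G\<^sub>j x\<^sub>i)\<close>; without the cutoff \<open>\<rho>\<close> they would be the components of \<open>Y\<close>.\<close>

definition localized_field :: "(real^'n \<Rightarrow> real) \<Rightarrow> (real^'n \<Rightarrow> real^'n) \<Rightarrow> real^'n \<Rightarrow> real^'n::finite" where
  "localized_field \<rho> Y x = (let G = radial_mean (CARD('n) - 2) Y x; g = gradient \<rho> x in
     \<rho> x *\<^sub>R Y x + (x \<bullet> g) *\<^sub>R G - (G \<bullet> g) *\<^sub>R x)"

lemma smooth_bounded_on_cball:
  assumes "C_infinity_on UNIV f"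
  shows "\<exists>M\<ge>0. \<forall>x\<in>cball a r. norm (f x) \<le> M"
proof -
  have "compact (f ` cball a r)"
    by (rule compact_continuous_image) (use C_infinity_on_continuous[OF assms] in \<open>auto intro: continuous_on_subset\<close>)
  then obtain M where "\<forall>x\<in>cball a r. norm (f x) \<le> M" using compact_imp_bounded bounded_iff by (metis image_eqI)
  then show ?thesis by (intro exI[of _ "\<bar>M\<bar>"]) auto
qed

text \<open>The construction takes place at unit scale, with \<open>\<rho>\<close> supported in the unit ball and \<open>Y\<close> given on the
  ball of radius \<open>2\<close>, so that its bounds involve constants of \<open>\<rho>\<close> and the dimension only.\<close>

locale localization =
  fixes \<rho> :: "real^'n::finite \<Rightarrow> real" and Y :: "real^'n \<Rightarrow> real^'n" and G g
  assumes dim: "CARD('n) \<ge> 2"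
    and \<rho>: "C_infinity_on UNIV \<rho>" "\<And>x. norm x \<le> 1/2 \<Longrightarrow> \<rho> x = 1" "\<And>x. norm x \<ge> 3/4 \<Longrightarrow> \<rho> x = 0"
    and Y: "\<And>x. x \<in> ball 0 2 \<Longrightarrow> Y differentiable (at x)"
    and cY: "\<And>i. continuous_on (ball 0 2) (partial_deriv i Y)"
    and divY: "\<And>x. x \<in> ball 0 2 \<Longrightarrow> coord_div Y x = 0"
  defines "G \<equiv> radial_mean (CARD('n) - 2) Y" and "g \<equiv> gradient \<rho>"
begin

lemma localized_field_eq: "localized_field \<rho> Y x = \<rho> x *\<^sub>R Y x + (x \<bullet> g x) *\<^sub>R G x - (G x \<bullet> g x) *\<^sub>R x"
  by (simp add: localized_field_def Let_def G_def g_def)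

lemma \<rho>_deriv_0:
  assumes "norm x < 1/2 \<or> norm x > 3/4" shows "g x = 0"
proof -
  have "partial_deriv i \<rho> x = 0" for i
  proof (cases "norm x < 1/2")
    case True
    have "partial_deriv i \<rho> x = partial_deriv i (\<lambda>_. 1) x"
      by (rule partial_deriv_cong_open[of "ball 0 (1/2)"]) (use True \<rho>(2) in auto)
    then show ?thesis using partial_deriv_eq[OF has_derivative_const, of i 1 x] by simp
  next
    case False
    have "partial_deriv i \<rho> x = partial_deriv i (\<lambda>_. 0) x"
      by (rule partial_deriv_cong_open[of "- cball 0 (3/4)"]) (use False assms \<rho>(3) in auto)
    then show ?thesis using partial_deriv_eq[OF has_derivative_const, of i 0 x] by simp
  qed
  then show ?thesis by (simp add: g_def gradient_def vec_eq_iff)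
qed

lemma localized_field_inner: "norm x < 1/2 \<Longrightarrow> localized_field \<rho> Y x = Y x"
  by (simp add: localized_field_eq \<rho> \<rho>_deriv_0)

lemma localized_field_outer: "norm x > 3/4 \<Longrightarrow> localized_field \<rho> Y x = 0"
  by (simp add: localized_field_eq \<rho> \<rho>_deriv_0)

text \<open>The function \<open>\<rho>\<close> and its gradient are smooth, and \<open>Y\<close> enters undifferentiated, once directly and
  once through its radial mean.\<close>

lemma C_hoelder_on_localized_field:
  assumes b: "0 \<le> b" "b \<le> 1" and Yn: "C_hoelder_on b n (ball 0 2) Y"
  shows "C_hoelder_on b n UNIV (localized_field \<rho> Y)"
proof (rule C_hoelder_on_local)
  fix p :: "real^'n"
  show "\<exists>U. open U \<and> p \<in> U \<and> C_hoelder_on b n U (localized_field \<rho> Y)"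
  proof (cases "norm p < 2")
    case True
    have sm: "C_hoelder_on b n (ball 0 2) f" if "C_infinity_on UNIV f" for f :: "real^'n \<Rightarrow> 'z::real_normed_vector"
      using C_infinity_onD[OF _ b(2) C_infinity_on_subset[OF that]] by auto
    have g: "C_hoelder_on b n (ball 0 2) g" unfolding g_def by (intro sm C_infinity_on_gradient \<rho>) auto
    have G: "C_hoelder_on b n (ball 0 2) G" unfolding G_def by (rule C_hoelder_on_radial_mean[OF b Yn])
    have id: "C_hoelder_on b n (ball 0 2) (\<lambda>x::real^'n. x)" by (intro sm C_infinity_on_ident)
    note bil = C_hoelder_on_bilinear[OF _ open_ball b(2)]
    have "C_hoelder_on b n (ball 0 2) (\<lambda>x. \<rho> x *\<^sub>R Y x + (x \<bullet> g x) *\<^sub>R G x + - ((G x \<bullet> g x) *\<^sub>R x))"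
      by (intro C_hoelder_on_add[OF open_ball] C_hoelder_on_bounded_linear[OF bounded_linear_minus[OF bounded_linear_ident]]
        bil[OF bounded_bilinear_scaleR] bil[OF bounded_bilinear_inner] sm[OF \<rho>(1)] g G id Yn open_ball)
    then have "C_hoelder_on b n (ball 0 2) (localized_field \<rho> Y)"
      by (rule C_hoelder_on_cong[rotated]) (auto simp: localized_field_eq)
    then show ?thesis using True by (intro exI[of _ "ball 0 2"]) auto
  next
    case False
    have "C_hoelder_on b n (- cball 0 (3/4)) (localized_field \<rho> Y)"
      by (rule C_hoelder_on_cong[OF _ C_hoelder_on_const[of _ _ _ 0]]) (auto simp: localized_field_outer)
    then show ?thesis using False by (intro exI[of _ "- cball 0 (3/4)"]) auto
  qed
qed

lemma G_diff: "x \<in> ball 0 2 \<Longrightarrow> G differentiable (at x)"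
  unfolding G_def by (rule radial_mean_has_derivative(2)[OF Y cY])

lemma partial_G: "x \<in> ball 0 2 \<Longrightarrow> partial_deriv i G x = radial_mean (Suc (CARD('n) - 2)) (partial_deriv i Y) x"
  unfolding G_def by (rule radial_mean_has_derivative(1)[OF Y cY])

lemma div_G: assumes x: "x \<in> ball 0 2" shows "coord_div G x = 0"
proof -
  let ?k = "Suc (CARD('n) - 2)"
  have int: "(\<lambda>t. t ^ ?k *\<^sub>R partial_deriv i Y (t *\<^sub>R x)) integrable_on {0..1}" for i
    by (rule integrable_continuous_interval[OF continuous_on_radial[OF cY x]])
  have "coord_div G x = (\<Sum>i\<in>UNIV. integral {0..1} (\<lambda>t. t ^ ?k *\<^sub>R partial_deriv i Y (t *\<^sub>R x)) $ i)"
    using partial_G[OF x] by (simp add: radial_mean_def)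
  also have "\<dots> = (\<Sum>i\<in>UNIV. integral {0..1} (\<lambda>t. (t ^ ?k *\<^sub>R partial_deriv i Y (t *\<^sub>R x)) $ i))"
    using integral_linear[OF int bounded_linear_vec_nth] by (simp add: o_def)
  also have "\<dots> = integral {0..1} (\<lambda>t. \<Sum>i\<in>UNIV. (t ^ ?k *\<^sub>R partial_deriv i Y (t *\<^sub>R x)) $ i)"
    using integrable_linear[OF int bounded_linear_vec_nth] by (intro integral_sum[symmetric]) (auto simp: o_def)
  also have "\<dots> = integral {0..1} (\<lambda>t::real. 0::real)"
  proof (rule integral_cong)
    fix t :: real assume "t \<in> {0..1}"
    then show "(\<Sum>i\<in>UNIV. (t ^ ?k *\<^sub>R partial_deriv i Y (t *\<^sub>R x)) $ i) = 0"
      using divY[OF scale_in_ball[OF x]] by (simp add: sum_distrib_left[symmetric])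
  qed
  finally show ?thesis by simp
qed

text \<open>The weight of the mean turns Euler's identity into a first-order equation with coefficient
  \<open>n - 1\<close>, which is the coefficient that makes the divergence below cancel.\<close>

lemma euler_G: assumes x: "x \<in> ball 0 2"
  shows "(real CARD('n) - 1) *\<^sub>R G x + (\<Sum>i\<in>UNIV. x $ i *\<^sub>R partial_deriv i G x) = Y x"
proof -
  have "real (Suc (CARD('n) - 2)) = real CARD('n) - 1" using dim by (simp add: of_nat_diff)
  then show ?thesis using radial_mean_euler[OF Y cY x, of "CARD('n) - 2"] unfolding G_def by simp
qed

lemma g_diff: "g differentiable (at x)"
  unfolding g_def by (rule C_infinity_on_differentiable[OF C_infinity_on_gradient[OF open_UNIV \<rho>(1)]]) simp

lemma localized_field_deriv:
  assumes x: "x \<in> ball 0 2"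
  shows "localized_field \<rho> Y differentiable (at x)"
    and "partial_deriv i (localized_field \<rho> Y) x = g x $ i *\<^sub>R Y x + \<rho> x *\<^sub>R partial_deriv i Y x
        + (g x $ i + x \<bullet> partial_deriv i g x) *\<^sub>R G x + (x \<bullet> g x) *\<^sub>R partial_deriv i G x
        - (partial_deriv i G x \<bullet> g x + G x \<bullet> partial_deriv i g x) *\<^sub>R x - (G x \<bullet> g x) *\<^sub>R axis i 1"
proof -
  have W: "localized_field \<rho> Y = (\<lambda>x. \<rho> x *\<^sub>R Y x + (x \<bullet> g x) *\<^sub>R G x - (G x \<bullet> g x) *\<^sub>R x)"
    by (rule ext) (rule localized_field_eq)
  have dr: "(\<rho> has_derivative frechet_derivative \<rho> (at x)) (at x)"
    and dY: "(Y has_derivative frechet_derivative Y (at x)) (at x)"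
    and dG: "(G has_derivative frechet_derivative G (at x)) (at x)"
    and dg: "(g has_derivative frechet_derivative g (at x)) (at x)"
    using C_infinity_on_differentiable[OF \<rho>(1)] Y[OF x] G_diff[OF x] g_diff frechet_derivative_works by blast+
  have D: "(localized_field \<rho> Y has_derivative (\<lambda>h. (\<rho> x *\<^sub>R frechet_derivative Y (at x) h + frechet_derivative \<rho> (at x) h *\<^sub>R Y x)
      + ((x \<bullet> g x) *\<^sub>R frechet_derivative G (at x) h + (x \<bullet> frechet_derivative g (at x) h + h \<bullet> g x) *\<^sub>R G x)
      - ((G x \<bullet> g x) *\<^sub>R h + (G x \<bullet> frechet_derivative g (at x) h + frechet_derivative G (at x) h \<bullet> g x) *\<^sub>R x))) (at x)"
    unfolding W
    by (intro has_derivative_diff has_derivative_add has_derivative_scaleR has_derivative_inner dr dY dG dg has_derivative_ident)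
  then show "localized_field \<rho> Y differentiable (at x)" by (auto simp: differentiable_def)
  have r: "partial_deriv i \<rho> x = g x $ i" by (simp add: g_def gradient_def)
  show "partial_deriv i (localized_field \<rho> Y) x = g x $ i *\<^sub>R Y x + \<rho> x *\<^sub>R partial_deriv i Y x
        + (g x $ i + x \<bullet> partial_deriv i g x) *\<^sub>R G x + (x \<bullet> g x) *\<^sub>R partial_deriv i G x
        - (partial_deriv i G x \<bullet> g x + G x \<bullet> partial_deriv i g x) *\<^sub>R x - (G x \<bullet> g x) *\<^sub>R axis i 1"
    unfolding partial_deriv_eq[OF D] frechet_derivative_axis r
    by (simp add: inner_axis' algebra_simps)
qed

text \<open>Since \<open>Y\<close> and \<open>G\<close> are divergence-free, the divergence of the three terms is
  \<open>g \<bullet> Y + g \<bullet> G - n (G \<bullet> g) - (x \<bullet> \<nabla>) G \<bullet> g\<close> plus two terms with the Hessian of \<open>\<rho>\<close>, which cancel because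
  the Hessian is symmetric. Euler's identity for \<open>G\<close> shows that the rest is \<open>0\<close>.\<close>

lemma div_localized_field: "coord_div (localized_field \<rho> Y) x = 0"
proof (cases "norm x < 2")
  case True
  then have x: "x \<in> ball 0 2" by simp
  let ?n = "real CARD('n)"
  have sym: "(\<Sum>i\<in>UNIV. (x \<bullet> partial_deriv i g x) * G x $ i) = (\<Sum>i\<in>UNIV. (G x \<bullet> partial_deriv i g x) * x $ i)"
  proof -
    have "(\<Sum>i\<in>UNIV. (x \<bullet> partial_deriv i g x) * G x $ i) = (\<Sum>i\<in>UNIV. \<Sum>j\<in>UNIV. x $ j * partial_deriv i g x $ j * G x $ i)"
      by (simp add: inner_vec_def sum_distrib_right)
    also have "\<dots> = (\<Sum>j\<in>UNIV. \<Sum>i\<in>UNIV. x $ j * partial_deriv i g x $ j * G x $ i)" by (rule sum.swap)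
    also have "\<dots> = (\<Sum>j\<in>UNIV. \<Sum>i\<in>UNIV. G x $ i * partial_deriv j g x $ i * x $ j)"
    proof -
      have "partial_deriv i g x $ j = partial_deriv j g x $ i" for i j
        unfolding g_def by (rule partial_deriv_gradient_commute[OF \<rho>(1)])
      then show ?thesis by (simp add: mult_ac)
    qed
    finally show ?thesis by (simp add: inner_vec_def sum_distrib_right)
  qed
  have e: "(\<Sum>i\<in>UNIV. (partial_deriv i G x \<bullet> g x) * x $ i) = Y x \<bullet> g x - (?n - 1) * (G x \<bullet> g x)"
  proof -
    have "(\<Sum>i\<in>UNIV. (partial_deriv i G x \<bullet> g x) * x $ i) = (\<Sum>i\<in>UNIV. x $ i *\<^sub>R partial_deriv i G x) \<bullet> g x"
      by (simp add: inner_sum_left mult.commute)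
    also have "(\<Sum>i\<in>UNIV. x $ i *\<^sub>R partial_deriv i G x) = Y x - (?n - 1) *\<^sub>R G x"
      using euler_G[OF x] by (simp add: algebra_simps)
    finally show ?thesis by (simp add: inner_diff_left)
  qed
  have "coord_div (localized_field \<rho> Y) x =
      (\<Sum>i\<in>UNIV. g x $ i * Y x $ i) + \<rho> x * coord_div Y x
      + (\<Sum>i\<in>UNIV. g x $ i * G x $ i) + (\<Sum>i\<in>UNIV. (x \<bullet> partial_deriv i g x) * G x $ i)
      + (x \<bullet> g x) * coord_div G x
      - (\<Sum>i\<in>UNIV. (partial_deriv i G x \<bullet> g x) * x $ i) - (\<Sum>i\<in>UNIV. (G x \<bullet> partial_deriv i g x) * x $ i)
      - (\<Sum>i\<in>(UNIV::'n set). G x \<bullet> g x)"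
    unfolding localized_field_deriv(2)[OF x]
    by (simp add: sum.distrib sum_subtractf sum_distrib_left distrib_right axis_def)
  also have "\<dots> = g x \<bullet> Y x + g x \<bullet> G x - (Y x \<bullet> g x - (?n - 1) * (G x \<bullet> g x)) - ?n * (G x \<bullet> g x)"
    unfolding sym e div_G[OF x] divY[OF x] by (simp add: inner_vec_def)
  also have "\<dots> = 0" by (simp add: inner_commute algebra_simps)
  finally show ?thesis .
next
  case False
  have "partial_deriv i (localized_field \<rho> Y) x = partial_deriv i (\<lambda>_. 0) x" for i
    by (rule partial_deriv_cong_open[of "- cball 0 (3/4)"]) (use False localized_field_outer in auto)
  then show ?thesis by simp
qed

text \<open>On the unit ball \<open>\<bar>Y\<bar>\<close> and \<open>\<bar>G\<bar>\<close> are at most \<open>n \<eta>\<close>, as \<open>Y\<close> vanishes at the centre, and the derivatives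
  of \<open>G\<close> are at most \<open>\<eta>\<close>. The derivative of the localized field is a sum of eight products of
  such a bound with \<open>M\<close>; the constant \<open>9\<close> leaves room.\<close>

lemma localized_field_bounds:
  assumes Y0: "Y 0 = 0" and \<eta>: "\<And>i x. x \<in> ball 0 1 \<Longrightarrow> norm (partial_deriv i Y x) \<le> \<eta>"
    and M: "\<And>x. x \<in> cball 0 1 \<Longrightarrow> \<bar>\<rho> x\<bar> \<le> M" "\<And>x. x \<in> cball 0 1 \<Longrightarrow> norm (g x) \<le> M"
      "\<And>i x. x \<in> cball 0 1 \<Longrightarrow> norm (partial_deriv i g x) \<le> M"
  shows "norm (localized_field \<rho> Y x) \<le> (9 * real CARD('n) * M) * \<eta>"
    and "norm (partial_deriv i (localized_field \<rho> Y) x) \<le> (9 * real CARD('n) * M) * \<eta>"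
proof -
  let ?n = "real CARD('n)"
  have n1: "?n \<ge> 1" using dim by simp
  have e0: "0 \<le> \<eta>" by (rule order_trans[OF norm_ge_zero \<eta>[of 0]]) simp
  have M0: "0 \<le> M" by (rule order_trans[OF norm_ge_zero M(2)[of 0]]) simp
  have Ye: "norm (Y y) \<le> ?n * \<eta>" if "y \<in> ball 0 1" for y
  proof -
    have "norm (Y y - Y 0) \<le> (?n * \<eta>) * norm (y - 0)"
    proof (rule differentiable_bound[of "ball 0 1" Y "\<lambda>x. frechet_derivative Y (at x)"])
      fix x :: "real^'n" assume x: "x \<in> ball 0 1"
      then have d: "Y differentiable (at x)" using Y[of x] by simp
      then show "(Y has_derivative frechet_derivative Y (at x)) (at x within ball 0 1)"
        using frechet_derivative_works has_derivative_at_withinI by blast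
      show "onorm (frechet_derivative Y (at x)) \<le> ?n * \<eta>"
        by (rule onorm_frechet_le[OF d \<eta>[OF x]])
    qed (use that in auto)
    also have "\<dots> \<le> (?n * \<eta>) * 1" using that e0 by (intro mult_left_mono) auto
    finally show ?thesis using Y0 by simp
  qed
  have sub: "ball 0 1 \<subseteq> ball (0::real^'n) 2" by auto
  have cY0: "continuous_on (ball 0 2) Y"
    using Y by (auto intro!: continuous_at_imp_continuous_on differentiable_imp_continuous_within)
  have Ge: "norm (G y) \<le> ?n * \<eta>" if "y \<in> ball 0 1" for y
    unfolding G_def by (rule radial_mean_norm_le[OF cY0]) (use that sub Ye scale_in_ball[OF that] in auto)
  have dGe: "norm (partial_deriv i G y) \<le> \<eta>" if y: "y \<in> ball 0 1" for y i
  proof -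
    have y2: "y \<in> ball 0 2" using y by auto
    show ?thesis unfolding partial_G[OF y2]
      by (rule radial_mean_norm_le[OF cY y2]) (use \<eta> scale_in_ball[OF y] in auto)
  qed
  have far: "norm (localized_field \<rho> Y x) = 0 \<and> norm (partial_deriv i (localized_field \<rho> Y) x) = 0" if "x \<notin> ball 0 1"
  proof -
    have "partial_deriv i (localized_field \<rho> Y) x = partial_deriv i (\<lambda>_. 0) x"
      by (rule partial_deriv_cong_open[of "- cball 0 (3/4)"]) (use that localized_field_outer in auto)
    then show ?thesis using that partial_deriv_eq[OF has_derivative_const, of i 0 x] localized_field_outer[of x] by simp
  qed
  have tri: "norm (a + b - c) \<le> norm a + norm b + norm c" for a b c :: "real^'n" by norm
  have tri6: "norm (a + b + c + d - e - f) \<le> norm a + norm b + norm c + norm d + norm e + norm f"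
    for a b c d e f :: "real^'n" by norm
  have B0: "0 \<le> (9 * ?n * M) * \<eta>" using e0 M0 by simp
  have nh: "M * \<eta> \<le> ?n * M * \<eta>" using mult_right_mono[OF n1, of "M * \<eta>"] M0 e0 by simp
  { assume x: "x \<in> ball 0 1"
    then have xc: "x \<in> cball 0 1" and x2: "x \<in> ball 0 2" by auto
    have nx: "norm x \<le> 1" using x by simp
    have in1: "\<bar>x \<bullet> z\<bar> \<le> norm z" for z
      using Cauchy_Schwarz_ineq2[of x z] mult_right_mono[OF nx, of "norm z"] by simp
    have sc: "norm (a *\<^sub>R z) \<le> A * B" if "\<bar>a\<bar> \<le> A" "norm z \<le> B" for a A B and z :: "real^'n"
      using mult_mono[OF that(1) that(2)] that(1) by (simp add: order_trans[OF abs_ge_zero])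
    have inn: "\<bar>y \<bullet> z\<bar> \<le> A * B" if "norm y \<le> A" "norm z \<le> B" for A B and y z :: "real^'n"
      using Cauchy_Schwarz_ineq2[of y z] mult_mono[OF that(1) that(2)] order_trans[OF norm_ge_zero that(1)] norm_ge_zero[of z] by linarith
    have gi: "\<bar>g x $ i\<bar> \<le> M" using component_le_norm_cart[of "g x" i] M(2)[OF xc] by linarith
    have xg: "\<bar>x \<bullet> g x\<bar> \<le> M" using in1[of "g x"] M(2)[OF xc] by linarith
    have xgi: "\<bar>x \<bullet> partial_deriv i g x\<bar> \<le> M" using in1[of "partial_deriv i g x"] M(3)[OF xc] by (meson order_trans)
    have Gg: "\<bar>G x \<bullet> g x\<bar> \<le> (?n * \<eta>) * M" by (rule inn[OF Ge[OF x] M(2)[OF xc]])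
    have Ggi: "\<bar>G x \<bullet> partial_deriv i g x\<bar> \<le> (?n * \<eta>) * M" by (rule inn[OF Ge[OF x] M(3)[OF xc]])
    have Gig: "\<bar>partial_deriv i G x \<bullet> g x\<bar> \<le> \<eta> * M" by (rule inn[OF dGe[OF x] M(2)[OF xc]])
    have 1: "norm (\<rho> x *\<^sub>R Y x) \<le> M * (?n * \<eta>)" by (rule sc[OF M(1)[OF xc] Ye[OF x]])
    have 2: "norm ((x \<bullet> g x) *\<^sub>R G x) \<le> M * (?n * \<eta>)" by (rule sc[OF xg Ge[OF x]])
    have 3: "norm ((G x \<bullet> g x) *\<^sub>R x) \<le> (?n * \<eta> * M) * 1" by (rule sc[OF Gg nx])
    have "norm (localized_field \<rho> Y x) \<le> norm (\<rho> x *\<^sub>R Y x) + norm ((x \<bullet> g x) *\<^sub>R G x) + norm ((G x \<bullet> g x) *\<^sub>R x)"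
      unfolding localized_field_eq by (rule tri)
    also have "\<dots> \<le> 3 * (?n * M * \<eta>)" using 1 2 3 by (simp add: mult_ac)
    also have "\<dots> \<le> (9 * ?n * M) * \<eta>" using M0 e0 by (simp add: mult_ac)
    finally have b0: "norm (localized_field \<rho> Y x) \<le> (9 * ?n * M) * \<eta>" .
    have t1: "norm (g x $ i *\<^sub>R Y x) \<le> M * (?n * \<eta>)" by (rule sc[OF gi Ye[OF x]])
    have t2: "norm (\<rho> x *\<^sub>R partial_deriv i Y x) \<le> M * \<eta>" by (rule sc[OF M(1)[OF xc] \<eta>[OF x]])
    have t3: "norm ((g x $ i + x \<bullet> partial_deriv i g x) *\<^sub>R G x) \<le> (M + M) * (?n * \<eta>)"
      by (rule sc[OF _ Ge[OF x]]) (use gi xgi in linarith)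
    have t4: "norm ((x \<bullet> g x) *\<^sub>R partial_deriv i G x) \<le> M * \<eta>" by (rule sc[OF xg dGe[OF x]])
    have t5: "norm ((partial_deriv i G x \<bullet> g x + G x \<bullet> partial_deriv i g x) *\<^sub>R x) \<le> (\<eta> * M + ?n * \<eta> * M) * 1"
      by (rule sc[OF _ nx]) (use Gig Ggi in linarith)
    have t6: "norm ((G x \<bullet> g x) *\<^sub>R (axis i 1 :: real^'n)) \<le> (?n * \<eta> * M) * 1"
      by (rule sc[OF Gg]) simp
    have "norm (partial_deriv i (localized_field \<rho> Y) x) \<le> norm (g x $ i *\<^sub>R Y x) + norm (\<rho> x *\<^sub>R partial_deriv i Y x)
        + norm ((g x $ i + x \<bullet> partial_deriv i g x) *\<^sub>R G x) + norm ((x \<bullet> g x) *\<^sub>R partial_deriv i G x)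
        + norm ((partial_deriv i G x \<bullet> g x + G x \<bullet> partial_deriv i g x) *\<^sub>R x) + norm ((G x \<bullet> g x) *\<^sub>R (axis i 1 :: real^'n))"
      unfolding localized_field_deriv(2)[OF x2] by (rule tri6)
    also have "\<dots> \<le> 5 * (?n * M * \<eta>) + 3 * (M * \<eta>)" using t1 t2 t3 t4 t5 t6 by (simp add: algebra_simps)
    also have "\<dots> \<le> 8 * (?n * M * \<eta>)" using nh by linarith
    also have "\<dots> \<le> (9 * ?n * M) * \<eta>" using M0 e0 by (simp add: mult_ac)
    finally have "norm (partial_deriv i (localized_field \<rho> Y) x) \<le> (9 * ?n * M) * \<eta>" .
    note b0 this
  } note near = this
  show "norm (localized_field \<rho> Y x) \<le> (9 * ?n * M) * \<eta>" using near(1) far B0 by fastforce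
  show "norm (partial_deriv i (localized_field \<rho> Y) x) \<le> (9 * ?n * M) * \<eta>" using near(2) far B0 by fastforce
qed

lemma localized_field_differentiable: "localized_field \<rho> Y differentiable (at x)"
proof (cases "norm x < 2")
  case True
  then show ?thesis by (intro localized_field_deriv(1)) simp
next
  case False
  show ?thesis
    by (rule differentiable_cong_open[of "- cball 0 (3/4)" _ "\<lambda>_. 0"]) (use False localized_field_outer in auto)
qed

end

text \<open>The hypotheses under which \<open>v\<close> can be made affine near \<open>p\<close>: it is continuously differentiable and
  divergence-free around \<open>p\<close>, and its derivative stays within \<open>\<eta>\<close> of a traceless \<open>A\<close>.\<close>

definition nearly_linear ::
    "(real^'n::finite \<Rightarrow> real^'n) \<Rightarrow> (real^'n \<Rightarrow> real^'n) \<Rightarrow> real^'n \<Rightarrow> real \<Rightarrow> real \<Rightarrow> bool" where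
  "nearly_linear v A p r \<eta> \<longleftrightarrow> r > 0 \<and> linear A \<and> (\<Sum>i\<in>UNIV. A (axis i 1) $ i) = 0 \<and>
     (\<forall>x\<in>ball p (2 * r). v differentiable (at x) \<and> coord_div v x = 0) \<and>
     (\<forall>i. continuous_on (ball p (2 * r)) (partial_deriv i v)) \<and>
     (\<forall>x\<in>ball p r. \<forall>i. norm (A (axis i 1) - partial_deriv i v x) \<le> \<eta>)"

text \<open>The field \<open>w\<close> is a correction: \<open>v + w\<close> is affine near \<open>p\<close>, and \<open>w\<close> has the bounds that the scale \<open>r\<close>
  dictates.\<close>

definition linearizes ::
    "real \<Rightarrow> (real^'n::finite \<Rightarrow> real^'n) \<Rightarrow> (real^'n \<Rightarrow> real^'n) \<Rightarrow> (real^'n \<Rightarrow> real^'n) \<Rightarrow> real^'n \<Rightarrow>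
     real \<Rightarrow> real \<Rightarrow> bool" where
  "linearizes C w v A p r \<eta> \<longleftrightarrow>
     (\<forall>y\<in>ball p (r/2). w y = v p + A (y - p) - v y) \<and> (\<forall>y. y \<notin> ball p r \<longrightarrow> w y = 0) \<and>
     (\<forall>y. w differentiable (at y) \<and> coord_div w y = 0 \<and> norm (w y) \<le> C * r * \<eta> \<and>
        (\<forall>i. norm (partial_deriv i w y) \<le> C * \<eta>)) \<and>
     (\<forall>b n. 0 \<le> b \<longrightarrow> b \<le> 1 \<longrightarrow> C_hoelder_on b n (ball p (2 * r)) v \<longrightarrow> C_hoelder_on b n UNIV w)"

text \<open>The field \<open>Y(z) = A z + (v(p) - v(p + r z)) / r\<close> lives at unit scale, and its derivative
  \<open>A - Dv(p + r z)\<close> does not depend on the scale. Localizing it and scaling back costs a factor \<open>r\<close> in the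
  values and nothing in the derivatives, whence the uniform constant.\<close>

lemma linearizing_perturbation:
  assumes dim: "CARD('n::finite) \<ge> 2"
  obtains C where "C > 0"
    "\<And>(v :: real^'n \<Rightarrow> real^'n) A p r \<eta>. nearly_linear v A p r \<eta> \<Longrightarrow> \<exists>w. linearizes C w v A p r \<eta>"
proof -
  obtain \<rho> :: "real^'n \<Rightarrow> real" where \<rho>: "C_infinity_on UNIV \<rho>"
    "\<And>x. norm x \<le> 1/2 \<Longrightarrow> \<rho> x = 1" "\<And>x. norm x \<ge> 3/4 \<Longrightarrow> \<rho> x = 0"
    using smooth_cutoff_exists by blast
  have sg: "C_infinity_on UNIV (gradient \<rho>)" using C_infinity_on_gradient[OF open_UNIV \<rho>(1)] .
  obtain M1 where M1: "M1 \<ge> 0" "\<And>x. x \<in> cball 0 1 \<Longrightarrow> \<bar>\<rho> x\<bar> \<le> M1"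
    using smooth_bounded_on_cball[OF \<rho>(1), of 0 1] by auto
  obtain M2 where M2: "M2 \<ge> 0" "\<And>x. x \<in> cball 0 1 \<Longrightarrow> norm (gradient \<rho> x) \<le> M2"
    using smooth_bounded_on_cball[OF sg, of 0 1] by blast
  have "\<exists>M\<ge>0. \<forall>x\<in>cball 0 1. norm (partial_deriv i (gradient \<rho>) x) \<le> M" for i
    by (rule smooth_bounded_on_cball[OF C_infinity_on_partial[OF sg]])
  then obtain M3 where M3: "\<And>i. M3 i \<ge> 0" "\<And>i x. x \<in> cball 0 1 \<Longrightarrow> norm (partial_deriv i (gradient \<rho>) x) \<le> M3 i"
    by metis
  define M where "M = 1 + M1 + M2 + (\<Sum>i\<in>UNIV. M3 i)"
  have s3: "M3 i \<le> (\<Sum>i\<in>UNIV. M3 i)" for i by (rule member_le_sum) (use M3 in auto)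
  have s30: "0 \<le> (\<Sum>i\<in>UNIV. M3 i)" by (rule sum_nonneg) (use M3 in auto)
  have M: "M > 0" "\<And>x. x \<in> cball 0 1 \<Longrightarrow> \<bar>\<rho> x\<bar> \<le> M" "\<And>x. x \<in> cball 0 1 \<Longrightarrow> norm (gradient \<rho> x) \<le> M"
    "\<And>i x. x \<in> cball 0 1 \<Longrightarrow> norm (partial_deriv i (gradient \<rho>) x) \<le> M"
  proof -
    show "M > 0" using M1(1) M2(1) s30 by (simp add: M_def)
    fix x :: "real^'n" and i :: 'n assume x: "x \<in> cball 0 1"
    show "\<bar>\<rho> x\<bar> \<le> M" "norm (gradient \<rho> x) \<le> M" "norm (partial_deriv i (gradient \<rho>) x) \<le> M"
      using M1(2)[OF x] M2(2)[OF x] M3(2)[OF x, of i] M1(1) M2(1) s30 s3[of i] unfolding M_def by linarith+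
  qed
  define C where "C = 9 * real CARD('n) * M"
  have C: "C > 0" using M(1) dim by (simp add: C_def)
  show ?thesis
  proof (rule that[OF C])
    fix v A :: "real^'n \<Rightarrow> real^'n" and p :: "real^'n" and r \<eta> :: real
    assume "nearly_linear v A p r \<eta>"
    then have r: "r > 0" and A: "linear A" and trA: "(\<Sum>i\<in>UNIV. A (axis i 1) $ i) = 0"
      and v: "\<And>x. x \<in> ball p (2 * r) \<Longrightarrow> v differentiable (at x)"
      and cv: "\<And>i. continuous_on (ball p (2 * r)) (partial_deriv i v)"
      and divv: "\<And>x. x \<in> ball p (2 * r) \<Longrightarrow> coord_div v x = 0"
      and close: "\<And>i x. x \<in> ball p r \<Longrightarrow> norm (A (axis i 1) - partial_deriv i v x) \<le> \<eta>"
      unfolding nearly_linear_def by blast+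
    have bA: "bounded_linear A" using A linear_conv_bounded_linear by blast
    define Y where "Y z = A z + ((1/r) *\<^sub>R v p + (- (1/r)) *\<^sub>R v (p + r *\<^sub>R z))" for z
    have inb: "p + r *\<^sub>R z \<in> ball p (s * r) \<longleftrightarrow> z \<in> ball 0 s" for z s
      using r by (simp add: dist_norm)
    have dY: "Y differentiable (at z)" and pY: "partial_deriv i Y z = A (axis i 1) - partial_deriv i v (p + r *\<^sub>R z)"
      if z: "z \<in> ball 0 2" for z i
    proof -
      have dv: "v differentiable (at (p + r *\<^sub>R z))" using v inb[of z 2] z by blast
      let ?f = "\<lambda>z. v (p + r *\<^sub>R z)"
      have "(?f has_derivative frechet_derivative ?f (at z)) (at z)"
        using partial_deriv_affine(2)[OF dv] frechet_derivative_works by blast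
      then have D: "(Y has_derivative (\<lambda>h. A h + (0 + (- (1/r)) *\<^sub>R frechet_derivative ?f (at z) h))) (at z)"
        unfolding Y_def[abs_def]
        by (intro has_derivative_add has_derivative_const has_derivative_scaleR_right bounded_linear_imp_has_derivative bA)
      then show "Y differentiable (at z)" by (auto simp: differentiable_def)
      have "partial_deriv i Y z = A (axis i 1) - (1/r) *\<^sub>R partial_deriv i ?f z"
        using partial_deriv_eq[OF D, of i] by (simp add: partial_deriv_def)
      then show "partial_deriv i Y z = A (axis i 1) - partial_deriv i v (p + r *\<^sub>R z)"
        using partial_deriv_affine(1)[OF dv, of i] r by simp
    qed
    interpret L: localization \<rho> Y "radial_mean (CARD('n) - 2) Y" "gradient \<rho>"
    proof unfold_locales
      show "continuous_on (ball 0 2) (partial_deriv i Y)" for i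
      proof (rule continuous_on_eq)
        have "continuous_on (ball 0 2) (\<lambda>z. partial_deriv i v (p + r *\<^sub>R z))"
          by (rule continuous_on_compose2[OF cv]) (use inb in \<open>auto intro!: continuous_intros simp del: mem_ball\<close>)
        then show "continuous_on (ball 0 2) (\<lambda>z. A (axis i 1) - partial_deriv i v (p + r *\<^sub>R z))"
          by (intro continuous_intros)
      qed (simp add: pY)
      show "coord_div Y z = 0" if "z \<in> ball 0 2" for z
        using trA divv inb[of z 2] that by (simp add: pY sum_subtractf)
    qed (use dim \<rho> dY in auto)
    define W where "W = localized_field \<rho> Y"
    define w where "w = (\<lambda>y. r *\<^sub>R W ((- (1/r)) *\<^sub>R p + (1/r) *\<^sub>R y))"
    have sc: "(- (1/r)) *\<^sub>R p + (1/r) *\<^sub>R y = (1/r) *\<^sub>R (y - p)" for y by (simp add: algebra_simps)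
    have nsc: "norm ((1/r) *\<^sub>R (y - p)) = norm (y - p) / r" for y using r by simp
    have Y0: "Y 0 = 0" using A by (simp add: Y_def linear_0)
    have small: "norm (partial_deriv i Y x) \<le> \<eta>" if "x \<in> ball 0 1" for i x
      using close[of "p + r *\<^sub>R x" i] inb[of x 1] that pY[of x i] by simp
    have Wb: "norm (W x) \<le> C * \<eta>" "norm (partial_deriv i W x) \<le> C * \<eta>" for x i
      using L.localized_field_bounds[OF Y0 small M(2,3,4)] by (auto simp: W_def C_def)
    have dW: "W differentiable (at x)" for x unfolding W_def by (rule L.localized_field_differentiable)
    have dw: "w differentiable (at y)" and pw: "partial_deriv i w y = partial_deriv i W ((- (1/r)) *\<^sub>R p + (1/r) *\<^sub>R y)" for y i
    proof -
      let ?f = "\<lambda>y. W ((- (1/r)) *\<^sub>R p + (1/r) *\<^sub>R y)"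
      have "(?f has_derivative frechet_derivative ?f (at y)) (at y)"
        using partial_deriv_affine(2)[OF dW] frechet_derivative_works by blast
      then have D: "(w has_derivative (\<lambda>h. r *\<^sub>R frechet_derivative ?f (at y) h)) (at y)"
        unfolding w_def by (rule has_derivative_scaleR_right)
      then show "w differentiable (at y)" by (auto simp: differentiable_def)
      have "partial_deriv i w y = r *\<^sub>R partial_deriv i ?f y"
        using partial_deriv_eq[OF D, of i] by (simp add: partial_deriv_def)
      then show "partial_deriv i w y = partial_deriv i W ((- (1/r)) *\<^sub>R p + (1/r) *\<^sub>R y)"
        using partial_deriv_affine(1)[OF dW, where a="(- (1/r)) *\<^sub>R p" and r="1/r" and x=y and i=i] r by simp
    qed
    have near: "w y = v p + A (y - p) - v y" if "y \<in> ball p (r/2)" for y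
    proof -
      have "norm ((1/r) *\<^sub>R (y - p)) < 1/2" unfolding nsc using that r by (simp add: dist_norm norm_minus_commute field_simps)
      then have "w y = r *\<^sub>R Y ((1/r) *\<^sub>R (y - p))"
        unfolding w_def sc W_def by (simp only: L.localized_field_inner)
      moreover have "p + r *\<^sub>R (1/r) *\<^sub>R (y - p) = y" using r by simp
      ultimately have "w y = r *\<^sub>R ((1/r) *\<^sub>R A (y - p) + ((1/r) *\<^sub>R v p + (- (1/r)) *\<^sub>R v y))"
        by (simp only: Y_def linear_cmul[OF A])
      then show ?thesis using r by (simp add: scaleR_add_right scaleR_diff_right)
    qed
    have far: "w y = 0" if "y \<notin> ball p r" for y
    proof -
      have "norm ((1/r) *\<^sub>R (y - p)) > 3/4" unfolding nsc using that r by (simp add: dist_norm norm_minus_commute field_simps)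
      then show ?thesis unfolding w_def sc W_def by (simp only: L.localized_field_outer) simp
    qed
    have hoelder: "C_hoelder_on b n UNIV w" if b: "0 \<le> b" "b \<le> 1" and vn: "C_hoelder_on b n (ball p (2 * r)) v" for b n
    proof -
      have "C_hoelder_on b n (ball 0 2) (\<lambda>z. v (p + r *\<^sub>R z))"
        by (rule C_hoelder_on_compose_smooth[OF _ _ b C_infinity_on_affine _ vn]) (use inb[of _ 2] in auto)
      moreover have "C_hoelder_on b n (ball 0 2) A"
        by (rule C_hoelder_on_bounded_linear[OF bA C_infinity_onD[OF _ b(2) C_infinity_on_ident]]) auto
      ultimately have "C_hoelder_on b n (ball 0 2) Y" unfolding Y_def[abs_def]
        by (intro C_hoelder_on_add C_hoelder_on_const C_hoelder_on_bounded_linear[OF bounded_linear_scaleR_right]) auto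
      then have "C_hoelder_on b n UNIV W" unfolding W_def by (rule L.C_hoelder_on_localized_field[OF b])
      then have "C_hoelder_on b n UNIV (\<lambda>y. W ((- (1/r)) *\<^sub>R p + (1/r) *\<^sub>R y))"
        by (intro C_hoelder_on_compose_smooth[OF _ _ b C_infinity_on_affine]) auto
      then show ?thesis unfolding w_def
        by (intro C_hoelder_on_bounded_linear[OF bounded_linear_scaleR_right]) auto
    qed
    have div0: "coord_div w y = 0" for y
      unfolding pw W_def by (rule L.div_localized_field)
    have nw: "norm (w y) \<le> C * r * \<eta>" for y
    proof -
      have "norm (w y) = r * norm (W ((- (1/r)) *\<^sub>R p + (1/r) *\<^sub>R y))" using r by (simp add: w_def)
      also have "\<dots> \<le> r * (C * \<eta>)" using Wb(1) r by (intro mult_left_mono) auto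
      finally show ?thesis by (simp add: mult_ac)
    qed
    show "\<exists>w. linearizes C w v A p r \<eta>"
      unfolding linearizes_def
    proof (intro exI[of _ w] conjI allI ballI impI)
      show "norm (partial_deriv i w y) \<le> C * \<eta>" for i y unfolding pw by (rule Wb(2))
    qed (fact near far dw div0 nw hoelder)+
  qed
qed

section \<open>Divergence under changes of coordinates\<close>

text \<open>Let \<open>M\<close> be the matrix with rows \<open>\<partial>\<^sub>k \<tau>\<close>. Its determinant times the trace of \<open>DX\<close> is the sum of the
  determinants in which one row \<open>\<partial>\<^sub>j \<tau>\<close> is replaced by \<open>DX(\<partial>\<^sub>j \<tau>)\<close>. Differentiating the transformation
  law expresses this row through \<open>\<partial>\<^sub>j X'\<close> and the second derivatives of \<open>\<tau>\<close>. The first part contributes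
  \<open>det M\<close> times the divergence of \<open>X'\<close>, and by the symmetry of the second derivatives the second part
  contributes the derivative of \<open>det M\<close> in the direction \<open>X'\<close>.\<close>

lemma divergence_pullback:
  fixes \<tau> X X' :: "real^'n::finite \<Rightarrow> real^'n"
  assumes S: "open S" "p \<in> S" and \<tau>: "\<And>q. q \<in> S \<Longrightarrow> \<tau> differentiable (at q)"
    and \<tau>2: "\<And>i. partial_deriv i \<tau> differentiable (at p)"
    and X': "X' differentiable (at p)" and X: "X differentiable (at (\<tau> p))"
    and eq: "\<And>q. q \<in> S \<Longrightarrow> X (\<tau> q) = (\<Sum>i\<in>UNIV. X' q $ i *\<^sub>R partial_deriv i \<tau> q)"
  shows "(\<Sum>i\<in>UNIV. partial_deriv i (\<lambda>q. det (\<chi> k. partial_deriv k \<tau> q) * X' q $ i) p)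
       = det (\<chi> k. partial_deriv k \<tau> p) * coord_div X (\<tau> p)"
proof -
  define f where "f = (\<lambda>q. det (\<chi> k. partial_deriv k \<tau> q))"
  define N where "N = frechet_derivative X (at (\<tau> p))"
  define H where "H i k = partial_deriv i (partial_deriv k \<tau>) p" for i k
  have N: "(X has_derivative N) (at (\<tau> p))" "linear N"
    unfolding N_def using X frechet_derivative_works linear_frechet_derivative by blast+
  have H: "H i k = H k i" for i k
  proof -
    have "H i k $ j = H k i $ j" for j
    proof -
      have "partial_deriv i (partial_deriv k (\<lambda>q. \<tau> q $ j)) p = H i k $ j" for i k
      proof -
        have "partial_deriv i (partial_deriv k (\<lambda>q. \<tau> q $ j)) p = partial_deriv i (\<lambda>q. partial_deriv k \<tau> q $ j) p"
          by (rule partial_deriv_cong_open[OF S]) (rule partial_deriv_nth(1)[OF \<tau>])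
        then show ?thesis unfolding H_def using partial_deriv_nth(1)[OF \<tau>2] by simp
      qed
      moreover have "partial_deriv i (partial_deriv k (\<lambda>q. \<tau> q $ j)) p = partial_deriv k (partial_deriv i (\<lambda>q. \<tau> q $ j)) p"
      proof (rule mixed_partials_commute[OF S partial_deriv_nth(2)[OF \<tau>]])
        show "partial_deriv i (\<lambda>q. \<tau> q $ j) differentiable (at p)" for i
          by (rule differentiable_cong_open[OF S, of "\<lambda>q. partial_deriv i \<tau> q $ j"])
            (use partial_deriv_nth[OF \<tau>] partial_deriv_nth(2)[OF \<tau>2] in auto)
      qed
      ultimately show ?thesis by metis
    qed
    then show ?thesis by (simp add: vec_eq_iff)
  qed
  have D\<tau>: "(partial_deriv k \<tau> has_derivative frechet_derivative (partial_deriv k \<tau>) (at p)) (at p)" for k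
    using \<tau>2 frechet_derivative_works by blast
  have Df: "(f has_derivative (\<lambda>h. \<Sum>k\<in>UNIV. det (\<chi> l. if l = k then frechet_derivative (partial_deriv k \<tau>) (at p) h else partial_deriv l \<tau> p))) (at p)"
    unfolding f_def by (rule has_derivative_det_rows[OF D\<tau>])
  have pf: "partial_deriv i f p = (\<Sum>k\<in>UNIV. det (\<chi> l. if l = k then H i k else partial_deriv l \<tau> p))" for i
    unfolding partial_deriv_eq[OF Df] H_def frechet_derivative_axis by (rule refl)
  have pf': "partial_deriv i f p = (\<Sum>k\<in>UNIV. det (\<chi> l. if l = k then H k i else partial_deriv l \<tau> p))" for i
    unfolding pf
  proof (rule sum.cong[OF refl])
    fix k
    show "det (\<chi> l. if l = k then H i k else partial_deriv l \<tau> p) = det (\<chi> l. if l = k then H k i else partial_deriv l \<tau> p)"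
      by (subst H[of i k]) (rule refl)
  qed
  have NX: "N (partial_deriv j \<tau> p) = (\<Sum>i\<in>UNIV. partial_deriv j X' p $ i *\<^sub>R partial_deriv i \<tau> p + X' p $ i *\<^sub>R H j i)" for j
  proof -
    have 1: "((\<lambda>q. X (\<tau> q)) has_derivative (\<lambda>h. N (frechet_derivative \<tau> (at p) h))) (at p)"
      using has_derivative_compose[of \<tau> "frechet_derivative \<tau> (at p)" p UNIV X N, OF _ N(1)] \<tau>[OF S(2)] frechet_derivative_works by blast
    have "(X' has_derivative frechet_derivative X' (at p)) (at p)" using X' frechet_derivative_works by blast
    then have DX: "((\<lambda>q. X' q $ i) has_derivative (\<lambda>h. frechet_derivative X' (at p) h $ i)) (at p)" for i
      by (rule bounded_linear.has_derivative[OF bounded_linear_vec_nth])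
    have 2: "((\<lambda>q. \<Sum>i\<in>UNIV. X' q $ i *\<^sub>R partial_deriv i \<tau> q) has_derivative
        (\<lambda>h. \<Sum>i\<in>UNIV. X' p $ i *\<^sub>R frechet_derivative (partial_deriv i \<tau>) (at p) h + frechet_derivative X' (at p) h $ i *\<^sub>R partial_deriv i \<tau> p)) (at p)"
      by (intro has_derivative_sum has_derivative_scaleR DX D\<tau>)
    have "partial_deriv j (\<lambda>q. X (\<tau> q)) p = partial_deriv j (\<lambda>q. \<Sum>i\<in>UNIV. X' q $ i *\<^sub>R partial_deriv i \<tau> q) p"
      by (rule partial_deriv_cong_open[OF S eq])
    then show ?thesis unfolding partial_deriv_eq[OF 1] partial_deriv_eq[OF 2]
      by (simp add: frechet_derivative_axis H_def add.commute)
  qed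
  have rowdet: "det (\<chi> l. if l = j then partial_deriv i \<tau> p else partial_deriv l \<tau> p) = (if i = j then f p else 0)" for i j
  proof (cases "i = j")
    case True
    then have "(\<chi> l. if l = j then partial_deriv i \<tau> p else partial_deriv l \<tau> p) = (\<chi> l. partial_deriv l \<tau> p)"
      by (simp add: vec_eq_iff)
    then show ?thesis using True by (simp add: f_def)
  next
    case False
    have "det (\<chi> l. if l = j then partial_deriv i \<tau> p else partial_deriv l \<tau> p) = 0"
      by (rule det_identical_rows[OF False]) (use False in \<open>simp add: row_def vec_eq_iff\<close>)
    then show ?thesis using False by simp
  qed
  have drs: "det (\<chi> l. if l = j then N (partial_deriv j \<tau> p) else partial_deriv l \<tau> p)
     = partial_deriv j X' p $ j * f p + (\<Sum>i\<in>UNIV. X' p $ i * det (\<chi> l. if l = j then H j i else partial_deriv l \<tau> p))" for j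
  proof -
    have "det (\<chi> l. if l = j then N (partial_deriv j \<tau> p) else partial_deriv l \<tau> p)
      = (\<Sum>i\<in>UNIV. det (\<chi> l. if l = j then partial_deriv j X' p $ i *\<^sub>R partial_deriv i \<tau> p + X' p $ i *\<^sub>R H j i else partial_deriv l \<tau> p))"
      unfolding NX by (rule det_linear_row_sum) simp
    also have "\<dots> = (\<Sum>i\<in>UNIV. partial_deriv j X' p $ i * det (\<chi> l. if l = j then partial_deriv i \<tau> p else partial_deriv l \<tau> p)
        + X' p $ i * det (\<chi> l. if l = j then H j i else partial_deriv l \<tau> p))"
    proof -
      have "det (\<chi> l. if l = j then c *\<^sub>R a else partial_deriv l \<tau> p) = c * det (\<chi> l. if l = j then a else partial_deriv l \<tau> p)" for c a
        using det_row_mul[of j c "\<lambda>_. a" "\<lambda>l. partial_deriv l \<tau> p"] unfolding scalar_mult_eq_scaleR .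
      then show ?thesis unfolding det_row_add by simp
    qed
    also have "\<dots> = partial_deriv j X' p $ j * f p + (\<Sum>i\<in>UNIV. X' p $ i * det (\<chi> l. if l = j then H j i else partial_deriv l \<tau> p))"
      unfolding rowdet sum.distrib by (simp add: if_distrib cong: if_cong)
    finally show ?thesis .
  qed
  have "f p * coord_div X (\<tau> p) = (\<Sum>j\<in>UNIV. det (\<chi> l. if l = j then N (partial_deriv j \<tau> p) else partial_deriv l \<tau> p))"
    unfolding sum_det_linear_rows[OF N(2)] by (simp add: partial_deriv_def N_def f_def mult.commute)
  also have "\<dots> = (\<Sum>j\<in>UNIV. partial_deriv j X' p $ j * f p) + (\<Sum>j\<in>UNIV. \<Sum>i\<in>UNIV. X' p $ i * det (\<chi> l. if l = j then H j i else partial_deriv l \<tau> p))"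
    unfolding drs sum.distrib by (rule refl)
  also have "(\<Sum>j\<in>UNIV. \<Sum>i\<in>UNIV. X' p $ i * det (\<chi> l. if l = j then H j i else partial_deriv l \<tau> p))
     = (\<Sum>i\<in>UNIV. \<Sum>j\<in>UNIV. X' p $ i * det (\<chi> l. if l = j then H j i else partial_deriv l \<tau> p))" by (rule sum.swap)
  also have "\<dots> = (\<Sum>i\<in>UNIV. X' p $ i * partial_deriv i f p)"
    unfolding pf' sum_distrib_left by (rule refl)
  finally have "f p * coord_div X (\<tau> p) = (\<Sum>i\<in>UNIV. f p * partial_deriv i X' p $ i + partial_deriv i f p * X' p $ i)"
    by (simp add: sum.distrib mult_ac)
  moreover have "partial_deriv i (\<lambda>q. f q * X' q $ i) p = f p * partial_deriv i X' p $ i + partial_deriv i f p * X' p $ i" for i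
  proof -
    have "((\<lambda>q. X' q $ i) has_derivative (\<lambda>h. frechet_derivative X' (at p) h $ i)) (at p)"
      using bounded_linear.has_derivative[OF bounded_linear_vec_nth] X' frechet_derivative_works by blast
    from partial_deriv_eq[OF has_derivative_mult[OF Df this], of i]
    show ?thesis using partial_deriv_eq[OF Df, of i] by (simp add: partial_deriv_def)
  qed
  ultimately show ?thesis by (simp add: f_def)
qed


section \<open>Charts and transition maps\<close>

abbreviation overlap :: "('a, 'n::finite) chart \<Rightarrow> ('a, 'n) chart \<Rightarrow> (real^'n) set" where
  "overlap \<kappa> \<kappa>' \<equiv> snd \<kappa> ` (fst \<kappa> \<inter> fst \<kappa>')"

definition tangent_field :: "'a topology \<Rightarrow> ('a, 'n::finite) chart set \<Rightarrow> ('a, 'n) field \<Rightarrow> bool" where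
  "tangent_field T \<A> X \<longleftrightarrow> (\<forall>x\<in>topspace T. X x \<in> tangent_space \<A> x)"

locale smooth_atlas =
  fixes T :: "'a topology" and \<A> :: "('a, 'n::finite) chart set"
  assumes smooth: "smooth_structure T \<A>"
begin

lemma chart:
  assumes "\<kappa> \<in> \<A>"
  shows chart_open: "openin T (fst \<kappa>)" and chart_image_open: "open (snd \<kappa> ` fst \<kappa>)"
    and chart_subset: "fst \<kappa> \<subseteq> topspace T"
    and chart_homeo: "homeomorphic_map (subtopology T (fst \<kappa>)) (top_of_set (snd \<kappa> ` fst \<kappa>)) (snd \<kappa>)"
    and chart_inj: "inj_on (snd \<kappa>) (fst \<kappa>)"
proof -
  have c: "is_chart T \<kappa>" using smooth assms by (simp add: smooth_structure_def)
  then show o: "openin T (fst \<kappa>)" and "open (snd \<kappa> ` fst \<kappa>)"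
    and h: "homeomorphic_map (subtopology T (fst \<kappa>)) (top_of_set (snd \<kappa> ` fst \<kappa>)) (snd \<kappa>)"
    by (auto simp: is_chart_def)
  show s: "fst \<kappa> \<subseteq> topspace T" using o openin_subset by blast
  show "inj_on (snd \<kappa>) (fst \<kappa>)"
    using homeomorphic_imp_injective_map[OF h] s by (simp add: topspace_subtopology Int_absorb1)
qed

lemma topspace_chart:
  assumes "x \<in> topspace T" obtains \<kappa> where "\<kappa> \<in> \<A>" "x \<in> fst \<kappa>"
  using smooth assms unfolding smooth_structure_def by blast

lemma chart_inv_eq: "\<kappa> \<in> \<A> \<Longrightarrow> x \<in> fst \<kappa> \<Longrightarrow> chart_inv \<kappa> (snd \<kappa> x) = x"
  unfolding chart_inv_def by (rule inv_into_f_f[OF chart_inj])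

lemma chart_inv_in: "p \<in> snd \<kappa> ` fst \<kappa> \<Longrightarrow> chart_inv \<kappa> p \<in> fst \<kappa>"
  unfolding chart_inv_def by (rule inv_into_into)

lemma chart_of_inv: "p \<in> snd \<kappa> ` fst \<kappa> \<Longrightarrow> snd \<kappa> (chart_inv \<kappa> p) = p"
  unfolding chart_inv_def by (rule f_inv_into_f)

lemma open_chart_image:
  assumes "\<kappa> \<in> \<A>" "openin T N"
  shows "open (snd \<kappa> ` (fst \<kappa> \<inter> N))"
proof -
  have "openin (subtopology T (fst \<kappa>)) (fst \<kappa> \<inter> N)"
    using assms(2) by (simp add: openin_subtopology_Int2)
  then have "openin (top_of_set (snd \<kappa> ` fst \<kappa>)) (snd \<kappa> ` (fst \<kappa> \<inter> N))"
    using homeomorphic_imp_open_map[OF chart_homeo[OF assms(1)]] unfolding open_map_def by blast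
  then show ?thesis using chart_image_open[OF assms(1)] openin_open_trans by blast
qed

lemma open_chart_preimage:
  assumes "\<kappa> \<in> \<A>" "open O'"
  shows "openin T {x \<in> fst \<kappa>. snd \<kappa> x \<in> O'}"
proof -
  have "continuous_map (subtopology T (fst \<kappa>)) (top_of_set (snd \<kappa> ` fst \<kappa>)) (snd \<kappa>)"
    using homeomorphic_imp_continuous_map[OF chart_homeo[OF assms(1)]] .
  then have "continuous_map (subtopology T (fst \<kappa>)) euclidean (snd \<kappa>)"
    by (simp add: continuous_map_in_subtopology)
  then have "openin (subtopology T (fst \<kappa>)) {x \<in> topspace (subtopology T (fst \<kappa>)). snd \<kappa> x \<in> O'}"
    by (rule openin_continuous_map_preimage) (use assms(2) in \<open>simp add: open_openin[symmetric]\<close>)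
  moreover have "topspace (subtopology T (fst \<kappa>)) = fst \<kappa>"
    using chart_subset[OF assms(1)] by auto
  ultimately have "openin (subtopology T (fst \<kappa>)) {x \<in> fst \<kappa>. snd \<kappa> x \<in> O'}" by (simp only:)
  then show ?thesis by (rule openin_trans_full[OF _ chart_open[OF assms(1)]])
qed

lemma compact_chart_image:
  assumes "\<kappa> \<in> \<A>" "K \<subseteq> fst \<kappa>"
  shows "compactin T K \<longleftrightarrow> compact (snd \<kappa> ` K)"
proof -
  have s: "K \<subseteq> topspace (subtopology T (fst \<kappa>))" using assms chart_subset[OF assms(1)] by auto
  have "compactin (top_of_set (snd \<kappa> ` fst \<kappa>)) (snd \<kappa> ` K) \<longleftrightarrow> compactin (subtopology T (fst \<kappa>)) K"
    using homeomorphic_map_compactness[OF chart_homeo[OF assms(1)] s] .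
  then show ?thesis using assms(2) by (auto simp: compactin_subtopology image_mono)
qed

lemma open_overlap: "\<kappa> \<in> \<A> \<Longrightarrow> \<kappa>' \<in> \<A> \<Longrightarrow> open (overlap \<kappa> \<kappa>')"
  using open_chart_image chart_open by blast

lemma transition_eq: "\<kappa> \<in> \<A> \<Longrightarrow> x \<in> fst \<kappa> \<Longrightarrow> transition \<kappa> \<kappa>' (snd \<kappa> x) = snd \<kappa>' x"
  by (simp add: transition_def chart_inv_eq)

lemma smooth_transition:
  assumes "\<kappa> \<in> \<A>" "\<kappa>' \<in> \<A>"
  shows "C_infinity_on (overlap \<kappa> \<kappa>') (transition \<kappa> \<kappa>')"
proof -
  have "compatible \<kappa> \<kappa>'" using smooth assms unfolding smooth_structure_def by blast
  then show ?thesis using C_on_infinity_iff[OF open_overlap[OF assms]] unfolding compatible_def by blast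
qed

lemma transition_differentiable:
  "\<kappa> \<in> \<A> \<Longrightarrow> \<kappa>' \<in> \<A> \<Longrightarrow> x \<in> fst \<kappa> \<Longrightarrow> x \<in> fst \<kappa>' \<Longrightarrow> transition \<kappa> \<kappa>' differentiable (at (snd \<kappa> x))"
  by (rule C_infinity_on_differentiable[OF smooth_transition]) auto

lemma dtransition_eq:
  assumes "\<kappa> \<in> \<A>" "\<kappa>' \<in> \<A>" "x \<in> fst \<kappa>" "x \<in> fst \<kappa>'"
  shows "dtransition \<kappa> \<kappa>' x = (\<lambda>h. \<Sum>i\<in>UNIV. h $ i *\<^sub>R partial_deriv i (transition \<kappa> \<kappa>') (snd \<kappa> x))"
    and "linear (dtransition \<kappa> \<kappa>' x)"
    and "(transition \<kappa> \<kappa>' has_derivative dtransition \<kappa> \<kappa>' x) (at (snd \<kappa> x))"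
  unfolding dtransition_def
  using frechet_derivative_partials linear_frechet_derivative frechet_derivative_works transition_differentiable[OF assms] by blast+

lemma dtransition_restriction:
  assumes "\<kappa> \<in> \<A>" "x \<in> fst \<kappa>" "\<And>y. y \<in> fst \<kappa> \<Longrightarrow> snd \<kappa>' y = snd \<kappa> y"
  shows "dtransition \<kappa> \<kappa>' x h = h"
proof -
  have "(transition \<kappa> \<kappa>' has_derivative (\<lambda>h. h)) (at (snd \<kappa> x))"
    by (rule has_derivative_transform_within_open[OF has_derivative_ident chart_image_open[OF assms(1)]])
      (use assms in \<open>auto simp: transition_eq\<close>)
  then show ?thesis unfolding dtransition_def by (metis frechet_derivative_at)
qed

lemma dtransition_self: "\<kappa> \<in> \<A> \<Longrightarrow> x \<in> fst \<kappa> \<Longrightarrow> dtransition \<kappa> \<kappa> x h = h"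
  by (rule dtransition_restriction) auto

text \<open>The chain rule. It is what makes the components of a vector, prescribed in one chart, extend to
  a tangent vector.\<close>

lemma dtransition_cocycle:
  assumes "\<kappa> \<in> \<A>" "\<kappa>' \<in> \<A>" "\<kappa>'' \<in> \<A>" "x \<in> fst \<kappa>" "x \<in> fst \<kappa>'" "x \<in> fst \<kappa>''"
  shows "dtransition \<kappa>' \<kappa>'' x (dtransition \<kappa> \<kappa>' x h) = dtransition \<kappa> \<kappa>'' x h"
proof -
  have 1: "(transition \<kappa> \<kappa>' has_derivative dtransition \<kappa> \<kappa>' x) (at (snd \<kappa> x))"
    using dtransition_eq(3) assms by blast
  have 2: "(transition \<kappa>' \<kappa>'' has_derivative dtransition \<kappa>' \<kappa>'' x) (at (transition \<kappa> \<kappa>' (snd \<kappa> x)))"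
    using dtransition_eq(3)[of \<kappa>' \<kappa>'' x] assms transition_eq[of \<kappa> x \<kappa>'] by simp
  have "((\<lambda>p. transition \<kappa>' \<kappa>'' (transition \<kappa> \<kappa>' p)) has_derivative (\<lambda>h. dtransition \<kappa>' \<kappa>'' x (dtransition \<kappa> \<kappa>' x h))) (at (snd \<kappa> x))"
    by (rule has_derivative_compose[OF 1 2])
  then have "(transition \<kappa> \<kappa>'' has_derivative (\<lambda>h. dtransition \<kappa>' \<kappa>'' x (dtransition \<kappa> \<kappa>' x h))) (at (snd \<kappa> x))"
    by (rule has_derivative_transform_within_open[OF _ open_overlap[OF assms(1,2)]])
      (use assms in \<open>auto simp del: split_paired_All simp: transition_eq\<close>)
  then show ?thesis unfolding dtransition_def[of \<kappa> \<kappa>''] by (metis frechet_derivative_at)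
qed

section \<open>Vector fields in charts\<close>

lemma expression_at: "\<kappa> \<in> \<A> \<Longrightarrow> x \<in> fst \<kappa> \<Longrightarrow> expression X \<kappa> (snd \<kappa> x) = X x \<kappa>"
  by (simp add: expression_def chart_inv_eq)

lemma tangent_field_transform:
  assumes "tangent_field T \<A> X" "\<kappa> \<in> \<A>" "\<kappa>' \<in> \<A>" "x \<in> fst \<kappa>" "x \<in> fst \<kappa>'"
  shows "X x \<kappa>' = dtransition \<kappa> \<kappa>' x (X x \<kappa>)"
proof -
  have "x \<in> topspace T" using assms chart_subset by blast
  then have "X x \<in> tangent_space \<A> x" using assms(1) by (simp add: tangent_field_def)
  then show ?thesis using assms(2-) unfolding tangent_space_def charts_at_def by blast
qed

lemma expression_change:
  assumes "tangent_field T \<A> X" "\<kappa> \<in> \<A>" "\<kappa>' \<in> \<A>" "q \<in> overlap \<kappa>' \<kappa>"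
  shows "expression X \<kappa>' q = (\<Sum>i\<in>UNIV. expression X \<kappa> (transition \<kappa>' \<kappa> q) $ i *\<^sub>R
           partial_deriv i (transition \<kappa> \<kappa>') (transition \<kappa>' \<kappa> q))"
proof -
  obtain x where x: "x \<in> fst \<kappa>'" "x \<in> fst \<kappa>" "q = snd \<kappa>' x" using assms(4) by auto
  show ?thesis
    using tangent_field_transform[OF assms(1-3) x(2,1)] dtransition_eq(1)[OF assms(2,3) x(2,1)]
      expression_at[OF assms(3) x(1)] expression_at[OF assms(2) x(2)] transition_eq[OF assms(3) x(1)] x(3) by simp
qed

lemma transition_image:
  assumes "\<kappa> \<in> \<A>" "\<kappa>' \<in> \<A>"
  shows "transition \<kappa>' \<kappa> ` (snd \<kappa>' ` (fst \<kappa>' \<inter> fst \<kappa> \<inter> N)) = snd \<kappa> ` (fst \<kappa> \<inter> fst \<kappa>' \<inter> N)"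
proof -
  have "transition \<kappa>' \<kappa> ` (snd \<kappa>' ` (fst \<kappa>' \<inter> fst \<kappa> \<inter> N)) = (\<lambda>x. transition \<kappa>' \<kappa> (snd \<kappa>' x)) ` (fst \<kappa> \<inter> fst \<kappa>' \<inter> N)"
    by (simp add: image_image Int_commute)
  also have "\<dots> = snd \<kappa> ` (fst \<kappa> \<inter> fst \<kappa>' \<inter> N)"
    by (rule image_cong[OF refl]) (simp add: transition_eq[OF assms(2)])
  finally show ?thesis .
qed

lemma C_hoelder_on_change_chart:
  assumes X: "tangent_field T \<A> X" and \<kappa>: "\<kappa> \<in> \<A>" "\<kappa>' \<in> \<A>" and N: "openin T N" and b: "0 \<le> b" "b \<le> 1"
    and c: "C_hoelder_on b n (snd \<kappa> ` (fst \<kappa> \<inter> N)) (expression X \<kappa>)"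
  shows "C_hoelder_on b n (snd \<kappa>' ` (fst \<kappa>' \<inter> fst \<kappa> \<inter> N)) (expression X \<kappa>')"
proof -
  let ?S = "snd \<kappa>' ` (fst \<kappa>' \<inter> fst \<kappa> \<inter> N)" and ?R = "snd \<kappa> ` (fst \<kappa> \<inter> fst \<kappa>' \<inter> N)"
  have S: "open ?S" and R: "open ?R"
    using open_chart_image[OF \<kappa>(2), of "fst \<kappa> \<inter> N"] open_chart_image[OF \<kappa>(1), of "fst \<kappa>' \<inter> N"]
      chart_open[OF \<kappa>(1)] chart_open[OF \<kappa>(2)] N by (auto simp: Int_assoc)
  have t: "C_infinity_on ?S (transition \<kappa>' \<kappa>)"
    by (rule C_infinity_on_subset[OF smooth_transition[OF \<kappa>(2,1)]]) auto
  have t': "C_infinity_on ?R (transition \<kappa> \<kappa>')"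
    by (rule C_infinity_on_subset[OF smooth_transition[OF \<kappa>]]) auto
  have X\<kappa>: "C_hoelder_on b n ?R (expression X \<kappa>)" by (rule C_hoelder_on_subset[OF c]) auto
  have h: "C_hoelder_on b n ?R (\<lambda>p. \<Sum>i\<in>UNIV. expression X \<kappa> p $ i *\<^sub>R partial_deriv i (transition \<kappa> \<kappa>') p)"
    by (intro C_hoelder_on_sum[OF R] C_hoelder_on_scaleR[OF R b(2)] C_hoelder_on_nth[OF R] X\<kappa>
        C_infinity_onD[OF R b(2)] C_infinity_on_partial t')
  show ?thesis
  proof (rule C_hoelder_on_cong[OF S])
    show "C_hoelder_on b n ?S (\<lambda>q. (\<lambda>p. \<Sum>i\<in>UNIV. expression X \<kappa> p $ i *\<^sub>R partial_deriv i (transition \<kappa> \<kappa>') p) (transition \<kappa>' \<kappa> q))"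
      by (rule C_hoelder_on_compose_smooth[OF S R b t _ h]) (simp add: transition_image[OF \<kappa>])
    show "(\<Sum>i\<in>UNIV. expression X \<kappa> (transition \<kappa>' \<kappa> q) $ i *\<^sub>R partial_deriv i (transition \<kappa> \<kappa>') (transition \<kappa>' \<kappa> q)) = expression X \<kappa>' q"
      if "q \<in> ?S" for q
      by (rule expression_change[OF X \<kappa>, symmetric]) (use that in auto)
  qed
qed

text \<open>One chart around each point suffices, because the transition maps are smooth.\<close>

lemma C_hoelder_on_all_charts:
  assumes X: "tangent_field T \<A> X" and b: "0 \<le> b" "b \<le> 1"
    and loc: "\<And>x. x \<in> topspace T \<Longrightarrow> \<exists>\<kappa>\<in>\<A>. \<exists>N. openin T N \<and> x \<in> fst \<kappa> \<and> x \<in> N \<and>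
        C_hoelder_on b n (snd \<kappa> ` (fst \<kappa> \<inter> N)) (expression X \<kappa>)"
    and \<kappa>': "\<kappa>' \<in> \<A>"
  shows "C_hoelder_on b n (snd \<kappa>' ` fst \<kappa>') (expression X \<kappa>')"
proof (rule C_hoelder_on_local)
  fix p assume "p \<in> snd \<kappa>' ` fst \<kappa>'"
  then obtain x where x: "x \<in> fst \<kappa>'" "p = snd \<kappa>' x" by auto
  then have "x \<in> topspace T" using chart_subset[OF \<kappa>'] by blast
  then obtain \<kappa> N where k: "\<kappa> \<in> \<A>" "openin T N" "x \<in> fst \<kappa>" "x \<in> N"
    "C_hoelder_on b n (snd \<kappa> ` (fst \<kappa> \<inter> N)) (expression X \<kappa>)" using loc by blast
  have "open (snd \<kappa>' ` (fst \<kappa>' \<inter> (fst \<kappa> \<inter> N)))"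
    by (rule open_chart_image[OF \<kappa>']) (use chart_open[OF k(1)] k in auto)
  then show "\<exists>U. open U \<and> p \<in> U \<and> C_hoelder_on b n U (expression X \<kappa>')"
    using C_hoelder_on_change_chart[OF X k(1) \<kappa>' k(2) b k(5)] x k
    by (intro exI[of _ "snd \<kappa>' ` (fst \<kappa>' \<inter> fst \<kappa> \<inter> N)"]) (auto simp: Int_assoc)
qed

lemma tangent_field_restriction:
  assumes X: "tangent_field T \<A> X" and \<kappa>: "\<kappa> \<in> \<A>" "\<kappa>' \<in> \<A>" and sub: "fst \<kappa> \<subseteq> fst \<kappa>'"
    and eq: "\<And>y. y \<in> fst \<kappa> \<Longrightarrow> snd \<kappa>' y = snd \<kappa> y"
  shows "x \<in> fst \<kappa> \<Longrightarrow> X x \<kappa>' = X x \<kappa>"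
    and "p \<in> snd \<kappa> ` fst \<kappa> \<Longrightarrow> expression X \<kappa>' p = expression X \<kappa> p"
proof -
  show 1: "X x \<kappa>' = X x \<kappa>" if "x \<in> fst \<kappa>" for x
    using tangent_field_transform[OF X \<kappa> that] dtransition_restriction[OF \<kappa>(1) that eq] that sub by auto
  show "expression X \<kappa>' p = expression X \<kappa> p" if p: "p \<in> snd \<kappa> ` fst \<kappa>"
  proof -
    obtain x where x: "x \<in> fst \<kappa>" "p = snd \<kappa> x" using p by blast
    then show ?thesis using 1[OF x(1)] expression_at[OF \<kappa>(1) x(1)] expression_at[OF \<kappa>(2), of x] eq[OF x(1)] sub by auto
  qed
qed

lemma coord_vector_tangent:
  assumes "\<kappa> \<in> \<A>" "x \<in> fst \<kappa>"
  shows "coord_vector \<A> \<kappa> x i \<in> tangent_space \<A> x"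
proof -
  have "coord_vector \<A> \<kappa> x i \<kappa>2 = dtransition \<kappa>1 \<kappa>2 x (coord_vector \<A> \<kappa> x i \<kappa>1)"
    if k: "\<kappa>1 \<in> charts_at \<A> x" "\<kappa>2 \<in> charts_at \<A> x" for \<kappa>1 \<kappa>2
    using k dtransition_cocycle[OF assms(1), of \<kappa>1 \<kappa>2 x] assms(2)
    by (simp add: coord_vector_def charts_at_def)
  moreover have "coord_vector \<A> \<kappa> x i \<kappa>' = 0" if "\<kappa>' \<notin> charts_at \<A> x" for \<kappa>'
    using that by (simp add: coord_vector_def)
  ultimately show ?thesis unfolding tangent_space_def by (intro CollectI conjI ballI allI impI)
qed

text \<open>In a conservative chart \<open>\<omega>\<close> is the determinant, and the components of the coordinate vectors of
  \<open>\<kappa>'\<close> in that chart are the partial derivatives of the transition map.\<close>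

lemma form_coeff_conservative:
  assumes \<kappa>: "\<kappa> \<in> \<A>" "\<kappa>' \<in> \<A>" and cons: "conservative_chart \<A> \<omega> \<kappa>" and q: "q \<in> overlap \<kappa>' \<kappa>"
  shows "form_coeff \<A> \<omega> \<kappa>' q = det (\<chi> i. partial_deriv i (transition \<kappa>' \<kappa>) q)"
proof -
  obtain x where x: "x \<in> fst \<kappa>'" "x \<in> fst \<kappa>" "q = snd \<kappa>' x" using q by auto
  have "form_coeff \<A> \<omega> \<kappa>' q = \<omega> x (coord_vector \<A> \<kappa>' x)"
    using x \<kappa> by (simp add: form_coeff_def chart_inv_eq)
  also have "\<dots> = det (\<chi> i. coord_vector \<A> \<kappa>' x i \<kappa>)"
    using cons x(2) coord_vector_tangent[OF \<kappa>(2) x(1)] unfolding conservative_chart_def by blast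
  also have "(\<chi> i. coord_vector \<A> \<kappa>' x i \<kappa>) = (\<chi> i. partial_deriv i (transition \<kappa>' \<kappa>) q)"
    using x \<kappa> by (simp add: coord_vector_def charts_at_def dtransition_def partial_deriv_def)
  finally show ?thesis .
qed

text \<open>The quotient is left uncancelled: only the case in which one of the two divergences is \<open>0\<close>
  and the case of coefficient \<open>1\<close> will matter.\<close>

lemma divergence_conservative:
  assumes X: "tangent_field T \<A> X" and \<kappa>: "\<kappa> \<in> \<A>" "\<kappa>' \<in> \<A>" and cons: "conservative_chart \<A> \<omega> \<kappa>"
    and x: "x \<in> fst \<kappa>" "x \<in> fst \<kappa>'"
    and d: "expression X \<kappa> differentiable (at (snd \<kappa> x))" "expression X \<kappa>' differentiable (at (snd \<kappa>' x))"
  shows "divergence \<A> \<omega> X \<kappa>' (snd \<kappa>' x) = form_coeff \<A> \<omega> \<kappa>' (snd \<kappa>' x)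
      * coord_div (expression X \<kappa>) (snd \<kappa> x) / form_coeff \<A> \<omega> \<kappa>' (snd \<kappa>' x)"
proof -
  let ?S = "overlap \<kappa>' \<kappa>" and ?\<tau> = "transition \<kappa>' \<kappa>" and ?p = "snd \<kappa>' x"
  have S: "open ?S" "?p \<in> ?S" using open_overlap[OF \<kappa>(2,1)] x by auto
  have sm: "C_infinity_on ?S ?\<tau>" by (rule smooth_transition[OF \<kappa>(2,1)])
  have tx: "?\<tau> ?p = snd \<kappa> x" by (rule transition_eq[OF \<kappa>(2) x(2)])
  have "(\<Sum>i\<in>UNIV. partial_deriv i (\<lambda>q. det (\<chi> k. partial_deriv k ?\<tau> q) * expression X \<kappa>' q $ i) ?p)
       = det (\<chi> k. partial_deriv k ?\<tau> ?p) * coord_div (expression X \<kappa>) (?\<tau> ?p)"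
  proof (rule divergence_pullback[OF S])
    show "?\<tau> differentiable (at q)" if "q \<in> ?S" for q using C_infinity_on_differentiable[OF sm that] .
    show "partial_deriv i ?\<tau> differentiable (at ?p)" for i
      using C_infinity_on_differentiable[OF C_infinity_on_partial[OF sm] S(2)] .
    show "expression X \<kappa> (?\<tau> q) = (\<Sum>i\<in>UNIV. expression X \<kappa>' q $ i *\<^sub>R partial_deriv i ?\<tau> q)" if q: "q \<in> ?S" for q
    proof -
      obtain y where y: "y \<in> fst \<kappa>'" "y \<in> fst \<kappa>" "q = snd \<kappa>' y" using q by blast
      then have o: "?\<tau> q \<in> overlap \<kappa> \<kappa>'" and tt: "transition \<kappa> \<kappa>' (?\<tau> q) = q"
        using transition_eq[OF \<kappa>(2) y(1)] transition_eq[OF \<kappa>(1) y(2)] by auto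
      show ?thesis using expression_change[OF X \<kappa>(2,1) o] unfolding tt .
    qed
  qed (use d tx in auto)
  moreover have "partial_deriv i (\<lambda>q. det (\<chi> k. partial_deriv k ?\<tau> q) * expression X \<kappa>' q $ i) ?p
      = partial_deriv i (\<lambda>q. form_coeff \<A> \<omega> \<kappa>' q * expression X \<kappa>' q $ i) ?p" for i
    by (rule partial_deriv_cong_open[OF S]) (simp add: form_coeff_conservative[OF \<kappa> cons])
  ultimately show ?thesis
    unfolding divergence_def tx by (simp add: form_coeff_conservative[OF \<kappa> cons S(2)])
qed

lemma form_coeff_conservative_self:
  assumes "\<kappa> \<in> \<A>" "conservative_chart \<A> \<omega> \<kappa>" "x \<in> fst \<kappa>"
  shows "form_coeff \<A> \<omega> \<kappa> (snd \<kappa> x) = 1"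
proof -
  have "partial_deriv i (transition \<kappa> \<kappa>) (snd \<kappa> x) = axis i 1" for i
    using dtransition_self[OF assms(1,3), of "axis i 1"] by (simp add: dtransition_def partial_deriv_def)
  then have "(\<chi> i. partial_deriv i (transition \<kappa> \<kappa>) (snd \<kappa> x)) = mat 1"
    by (simp add: mat_def vec_eq_iff axis_def eq_commute)
  then show ?thesis using form_coeff_conservative[OF assms(1,1,2)] assms(3) by simp
qed

section \<open>Fields supported in a chart\<close>

text \<open>The vector field given by \<open>w\<close> in the chart \<open>\<kappa>\<close> and by \<open>0\<close> outside its domain. It inherits the
  regularity of \<open>w\<close> if \<open>w\<close> vanishes outside a compact subset of the image of the chart.\<close>

definition chart_field :: "('a, 'n) chart \<Rightarrow> (real^'n \<Rightarrow> real^'n) \<Rightarrow> ('a, 'n) field" where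
  "chart_field \<kappa> w y = (\<lambda>\<kappa>'. if y \<in> fst \<kappa> \<and> \<kappa>' \<in> charts_at \<A> y then dtransition \<kappa> \<kappa>' y (w (snd \<kappa> y)) else 0)"

lemma tangent_field_chart_field:
  assumes "\<kappa> \<in> \<A>" shows "tangent_field T \<A> (chart_field \<kappa> w)"
  unfolding tangent_field_def
proof
  fix x assume "x \<in> topspace T"
  have "chart_field \<kappa> w x \<kappa>2 = dtransition \<kappa>1 \<kappa>2 x (chart_field \<kappa> w x \<kappa>1)"
    if k: "\<kappa>1 \<in> charts_at \<A> x" "\<kappa>2 \<in> charts_at \<A> x" for \<kappa>1 \<kappa>2
  proof (cases "x \<in> fst \<kappa>")
    case True
    then show ?thesis using k dtransition_cocycle[OF assms, of \<kappa>1 \<kappa>2 x]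
      by (simp add: chart_field_def charts_at_def)
  next
    case False
    then show ?thesis using k dtransition_eq(2)[of \<kappa>1 \<kappa>2 x]
      by (simp add: chart_field_def charts_at_def linear_0)
  qed
  moreover have "chart_field \<kappa> w x \<kappa>' = 0" if "\<kappa>' \<notin> charts_at \<A> x" for \<kappa>'
    using that by (simp add: chart_field_def)
  ultimately show "chart_field \<kappa> w x \<in> tangent_space \<A> x"
    unfolding tangent_space_def by (intro CollectI conjI ballI allI impI)
qed

lemma expression_chart_field:
  assumes "\<kappa> \<in> \<A>" "p \<in> snd \<kappa> ` fst \<kappa>"
  shows "expression (chart_field \<kappa> w) \<kappa> p = w p"
  using assms chart_inv_in[of p \<kappa>] chart_of_inv[of p \<kappa>]
  by (simp add: expression_def chart_field_def charts_at_def dtransition_self)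

lemma chart_field_eq_0:
  assumes "\<kappa> \<in> \<A>" "y \<in> fst \<kappa> \<Longrightarrow> w (snd \<kappa> y) = 0"
  shows "chart_field \<kappa> w y = (\<lambda>_. 0)"
  using assms dtransition_eq(2)[OF assms(1)] unfolding chart_field_def charts_at_def by (auto simp: linear_0 fun_eq_iff)

end

lemma tangent_space_add:
  assumes "smooth_atlas T \<A>" "u \<in> tangent_space \<A> x" "w \<in> tangent_space \<A> x"
  shows "(\<lambda>\<kappa>. u \<kappa> + w \<kappa>) \<in> tangent_space \<A> x"
proof -
  interpret smooth_atlas T \<A> by fact
  have u: "u \<kappa>' = dtransition \<kappa> \<kappa>' x (u \<kappa>)" and w: "w \<kappa>' = dtransition \<kappa> \<kappa>' x (w \<kappa>)"
    if "\<kappa> \<in> charts_at \<A> x" "\<kappa>' \<in> charts_at \<A> x" for \<kappa> \<kappa>'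
    using assms(2,3) that unfolding tangent_space_def by blast+
  have "u \<kappa>' + w \<kappa>' = dtransition \<kappa> \<kappa>' x (u \<kappa> + w \<kappa>)"
    if k: "\<kappa> \<in> charts_at \<A> x" "\<kappa>' \<in> charts_at \<A> x" for \<kappa> \<kappa>'
  proof -
    have "linear (dtransition \<kappa> \<kappa>' x)" using dtransition_eq(2)[of \<kappa> \<kappa>' x] k by (simp add: charts_at_def)
    from linear_add[OF this] show ?thesis unfolding u[OF k] w[OF k] by (rule sym)
  qed
  moreover have "u \<kappa> + w \<kappa> = 0" if "\<kappa> \<notin> charts_at \<A> x" for \<kappa>
  proof -
    have "u \<kappa> = 0" "w \<kappa> = 0" using assms(2,3) that unfolding tangent_space_def by blast+
    then show ?thesis by simp
  qed
  ultimately show ?thesis unfolding tangent_space_def by (intro CollectI conjI ballI allI impI)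
qed


section \<open>Regularity in all charts\<close>

lemma iter_partial_Nil [simp]: "iter_partial [] f = f"
  and iter_partial_Cons: "iter_partial (i # is) f = partial_deriv i (iter_partial is f)"
  and iter_partial_snoc: "iter_partial (is @ [i]) f = iter_partial is (partial_deriv i f)"
  by (simp_all add: iter_partial_def)

lemma iter_partial_cong_open:
  assumes "open S" "\<And>q. q \<in> S \<Longrightarrow> f q = g q"
  shows "p \<in> S \<Longrightarrow> iter_partial is f p = iter_partial is g p"
proof (induction "is" arbitrary: p)
  case (Cons i "is")
  show ?case unfolding iter_partial_Cons by (rule partial_deriv_cong_open[OF assms(1) Cons.prems Cons.IH])
qed (simp add: assms)

lemma C_hoelder_on_iter_partial:
  "C_hoelder_on b (length is) S f \<Longrightarrow> C_hoelder_on b 0 S (iter_partial is f)"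
proof (induction "is" arbitrary: f rule: rev_induct)
  case (snoc i "is")
  then have "C_hoelder_on b (length is) S (partial_deriv i f)" by simp
  from snoc.IH[OF this] show ?case unfolding iter_partial_snoc .
qed simp

text \<open>The pairs of an exponent and an order that describe the class \<open>C\<^sup>s\<^sup>,\<^sup>\<beta>\<close>. For \<open>s = \<infinity>\<close> these are all
  finite orders without Hoelder condition.\<close>

definition regularity_index :: "enat \<Rightarrow> real \<Rightarrow> real \<Rightarrow> nat \<Rightarrow> bool" where
  "regularity_index s \<beta> b n \<longleftrightarrow> (if s = \<infinity> then b = 0 else b = \<beta> \<and> enat n = s)"

lemma regularity_index_C1:
  assumes s: "1 \<le> s" and f: "\<And>b n. regularity_index s \<beta> b n \<Longrightarrow> C_hoelder_on b n S f"
  shows "\<And>p. p \<in> S \<Longrightarrow> f differentiable (at p)" and "\<And>i. continuous_on S (partial_deriv i f)"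
proof -
  obtain b n where "C_hoelder_on b (Suc n) S f"
  proof (cases "s = \<infinity>")
    case True
    have "C_hoelder_on 0 (Suc 0) S f" by (rule f) (simp add: regularity_index_def True)
    then show ?thesis by (rule that)
  next
    case False
    then obtain k where k: "s = enat k" by auto
    then obtain n where n: "k = Suc n" using s by (cases k) (auto simp: zero_enat_def[symmetric])
    have "C_hoelder_on \<beta> (Suc n) S f" by (rule f) (simp add: regularity_index_def k n)
    then show ?thesis by (rule that)
  qed
  then show "\<And>p. p \<in> S \<Longrightarrow> f differentiable (at p)" "\<And>i. continuous_on S (partial_deriv i f)"
    using C_hoelder_on_continuous[of b n S] by auto
qed

text \<open>The given atlas is \<open>c\<close>, and \<open>d\<close> is the larger atlas from the definition of regularity. All
  constructions are carried out in \<open>d\<close>, whose charts contain the closures of the domains of \<open>c\<close>.\<close>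

locale conservative_manifold = smooth_atlas T \<A>
  for T :: "'a topology" and \<A> :: "('a, 'n::finite) chart set" +
  fixes \<omega> :: "('a, 'n) top_form" and m :: nat and c d :: "nat \<Rightarrow> ('a, 'n) chart" and r0 :: real
  assumes Hausdorff: "Hausdorff_space T" and compact: "compact_space T" and nonempty: "topspace T \<noteq> {}"
    and form: "volume_form T \<A> \<omega>"
    and c_atlas: "\<And>j. j \<in> {1..m} \<Longrightarrow> c j \<in> \<A>" and d_atlas: "\<And>j. j \<in> {1..m} \<Longrightarrow> d j \<in> \<A>"
    and conservative: "\<And>j. j \<in> {1..m} \<Longrightarrow> conservative_chart \<A> \<omega> (d j)"
    and cover: "(\<Union>j\<in>{1..m}. fst (c j)) = topspace T"
    and r0: "r0 > 0" and c_image: "\<And>j. j \<in> {1..m} \<Longrightarrow> snd (c j) ` fst (c j) = ball 0 r0"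
    and closure_sub: "\<And>j. j \<in> {1..m} \<Longrightarrow> T closure_of fst (c j) \<subseteq> fst (d j)"
    and agree: "\<And>j x. j \<in> {1..m} \<Longrightarrow> x \<in> fst (c j) \<Longrightarrow> snd (d j) x = snd (c j) x"
begin

lemma c_sub_closure: "j \<in> {1..m} \<Longrightarrow> fst (c j) \<subseteq> T closure_of fst (c j)"
  by (rule closure_of_subset) (rule chart_subset[OF c_atlas])

lemma c_sub_d: "j \<in> {1..m} \<Longrightarrow> fst (c j) \<subseteq> fst (d j)"
  using c_sub_closure closure_sub by blast

lemma d_eq_c:
  assumes "tangent_field T \<A> X" "j \<in> {1..m}"
  shows "x \<in> fst (c j) \<Longrightarrow> X x (d j) = X x (c j)"
    and "p \<in> ball 0 r0 \<Longrightarrow> expression X (d j) p = expression X (c j) p"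
  using tangent_field_restriction[OF assms(1) c_atlas[OF assms(2)] d_atlas[OF assms(2)] c_sub_d[OF assms(2)] agree[OF assms(2)]]
    c_image[OF assms(2)] by blast+

lemma cball_sub_d:
  assumes j: "j \<in> {1..m}" shows "cball 0 r0 \<subseteq> snd (d j) ` fst (d j)"
proof -
  let ?K = "T closure_of fst (c j)"
  have "compactin T ?K" by (rule closedin_compact_space[OF compact closedin_closure_of])
  then have k: "compact (snd (d j) ` ?K)"
    using compact_chart_image[OF d_atlas[OF j] closure_sub[OF j]] by blast
  have "ball 0 r0 \<subseteq> snd (d j) ` ?K"
  proof
    fix p assume "p \<in> ball (0::real^'n) r0"
    then obtain x where x: "x \<in> fst (c j)" "p = snd (c j) x" using c_image[OF j] by blast
    then have "p = snd (d j) x" "x \<in> ?K" using agree[OF j] c_sub_closure[OF j] by auto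
    then show "p \<in> snd (d j) ` ?K" by blast
  qed
  then have "closure (ball 0 r0) \<subseteq> snd (d j) ` ?K" by (rule closure_minimal) (rule compact_imp_closed[OF k])
  then show ?thesis using r0 closure_sub[OF j] by auto
qed

text \<open>From left to right, the Hoelder condition on the balls of the given atlas is carried to the other
  charts by the smooth transition maps. From right to left, the closed ball is a compact subset of the
  larger chart, so the local condition there becomes a uniform one on the ball.\<close>

lemma regular_field_iff:
  assumes b: "0 \<le> \<beta>" "\<beta> \<le> 1"
  shows "X \<in> vector_fields T \<A> m c s \<beta> \<longleftrightarrow> tangent_field T \<A> X \<and>
    (\<forall>b n. regularity_index s \<beta> b n \<longrightarrow> (\<forall>\<kappa>\<in>\<A>. C_hoelder_on b n (snd \<kappa> ` fst \<kappa>) (expression X \<kappa>)))"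
proof
  assume X: "X \<in> vector_fields T \<A> m c s \<beta>"
  then have tX: "tangent_field T \<A> X" and CX: "\<And>\<kappa>. \<kappa> \<in> \<A> \<Longrightarrow> C_on s (snd \<kappa> ` fst \<kappa>) (expression X \<kappa>)"
    and HX: "\<And>j is. \<beta> > 0 \<Longrightarrow> j \<in> {1..m} \<Longrightarrow> enat (length is) = s \<Longrightarrow>
        hoelder_on \<beta> (snd (c j) ` fst (c j)) (iter_partial is (expression X (c j)))"
    by (auto simp: vector_fields_def tangent_field_def)
  have "C_hoelder_on b n (snd \<kappa> ` fst \<kappa>) (expression X \<kappa>)" if i: "regularity_index s \<beta> b n" and \<kappa>: "\<kappa> \<in> \<A>" for b n \<kappa>
  proof (cases "s = \<infinity>")
    case True
    then show ?thesis using CX[OF \<kappa>] i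
      by (simp add: regularity_index_def C_infinity_on_def C_on_infinity_iff[OF chart_image_open[OF \<kappa>]])
  next
    case False
    then have bn: "b = \<beta>" "s = enat n" using i by (auto simp: regularity_index_def)
    show ?thesis
    proof (cases "\<beta> = 0")
      case True
      then show ?thesis using CX[OF \<kappa>] bn by (simp add: C_on_enat_iff(1)[OF chart_image_open[OF \<kappa>]])
    next
      case False
      then have bp: "\<beta> > 0" using b by simp
      show ?thesis unfolding bn(1)
      proof (rule C_hoelder_on_all_charts[OF tX b _ \<kappa>])
        fix x assume x: "x \<in> topspace T"
        then obtain j where j: "j \<in> {1..m}" "x \<in> fst (c j)" using cover by blast
        have "C_hoelder_on \<beta> n (snd (c j) ` fst (c j)) (expression X (c j))"
          unfolding C_on_enat_iff(2)[OF chart_image_open[OF c_atlas[OF j(1)]] bp]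
        proof (intro conjI allI impI ballI)
          show "C_on (enat n) (snd (c j) ` fst (c j)) (expression X (c j))" using CX[OF c_atlas[OF j(1)]] bn by simp
          fix "is" :: "'n list" and p assume "length is = n"
          then have "hoelder_on \<beta> (snd (c j) ` fst (c j)) (iter_partial is (expression X (c j)))"
            using HX[OF bp j(1)] bn by simp
          then have "hoelder_on \<beta> (snd (c j) ` fst (c j) \<inter> ball p 1) (iter_partial is (expression X (c j)))"
            by (rule hoelder_on_subset) auto
          then show "\<exists>e>0. hoelder_on \<beta> (snd (c j) ` fst (c j) \<inter> ball p e) (iter_partial is (expression X (c j)))"
            by (intro exI[of _ 1]) simp
        qed
        then have "C_hoelder_on \<beta> n (snd (c j) ` (fst (c j) \<inter> fst (c j))) (expression X (c j))" by simp
        then show "\<exists>\<kappa>\<in>\<A>. \<exists>N. openin T N \<and> x \<in> fst \<kappa> \<and> x \<in> N \<and> C_hoelder_on \<beta> n (snd \<kappa> ` (fst \<kappa> \<inter> N)) (expression X \<kappa>)"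
          using j c_atlas[OF j(1)] chart_open[OF c_atlas[OF j(1)]]
          by (intro bexI[of _ "c j"] exI[of _ "fst (c j)"] conjI)
      qed
    qed
  qed
  then show "tangent_field T \<A> X \<and>
    (\<forall>b n. regularity_index s \<beta> b n \<longrightarrow> (\<forall>\<kappa>\<in>\<A>. C_hoelder_on b n (snd \<kappa> ` fst \<kappa>) (expression X \<kappa>)))"
    using tX by blast
next
  assume R: "tangent_field T \<A> X \<and>
    (\<forall>b n. regularity_index s \<beta> b n \<longrightarrow> (\<forall>\<kappa>\<in>\<A>. C_hoelder_on b n (snd \<kappa> ` fst \<kappa>) (expression X \<kappa>)))"
  then have tX: "tangent_field T \<A> X" by simp
  have RX: "C_hoelder_on b n (snd \<kappa> ` fst \<kappa>) (expression X \<kappa>)" if "regularity_index s \<beta> b n" "\<kappa> \<in> \<A>" for b n \<kappa>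
    using R that by blast
  have "C_on s (snd \<kappa> ` fst \<kappa>) (expression X \<kappa>)" if \<kappa>: "\<kappa> \<in> \<A>" for \<kappa>
  proof (cases "s = \<infinity>")
    case True
    then show ?thesis using RX[OF _ \<kappa>, of 0]
      by (simp add: regularity_index_def C_infinity_on_def C_on_infinity_iff[OF chart_image_open[OF \<kappa>]])
  next
    case False
    then obtain n where n: "s = enat n" by auto
    have "C_hoelder_on \<beta> n (snd \<kappa> ` fst \<kappa>) (expression X \<kappa>)"
      by (rule RX[OF _ \<kappa>]) (simp add: regularity_index_def n)
    then show ?thesis unfolding n
      using b by (cases "\<beta> = 0") (simp_all add: C_on_enat_iff[OF chart_image_open[OF \<kappa>]])
  qed
  moreover have "hoelder_on \<beta> (snd (c j) ` fst (c j)) (iter_partial is (expression X (c j)))"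
    if bp: "\<beta> > 0" and j: "j \<in> {1..m}" and l: "enat (length is) = s" for j "is"
  proof -
    have "C_hoelder_on \<beta> (length is) (snd (d j) ` fst (d j)) (expression X (d j))"
      by (rule RX[OF _ d_atlas[OF j]]) (use l in \<open>auto simp: regularity_index_def\<close>)
    then have "hoelder_on \<beta> (cball 0 r0) (iter_partial is (expression X (d j)))"
      by (intro C_hoelder_on_compact[OF C_hoelder_on_iter_partial bp _ cball_sub_d[OF j] chart_image_open[OF d_atlas[OF j]]])
        simp_all
    then have "hoelder_on \<beta> (ball 0 r0) (iter_partial is (expression X (d j)))"
      by (rule hoelder_on_subset) auto
    then show ?thesis unfolding c_image[OF j]
      by (rule hoelder_on_cong[rotated]) (rule iter_partial_cong_open[OF open_ball d_eq_c(2)[OF tX j]])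
  qed
  ultimately show "X \<in> vector_fields T \<A> m c s \<beta>"
    using tX by (simp add: vector_fields_def tangent_field_def)
qed

section \<open>Sums of divergence-free fields\<close>

lemma form_coeff_differentiable:
  "\<kappa> \<in> \<A> \<Longrightarrow> p \<in> snd \<kappa> ` fst \<kappa> \<Longrightarrow> form_coeff \<A> \<omega> \<kappa> differentiable (at p)"
  using form C_on_infinity_iff[OF chart_image_open] C_infinity_on_differentiable unfolding volume_form_def by blast

definition field_add :: "('a, 'n) field \<Rightarrow> ('a, 'n) field \<Rightarrow> ('a, 'n) field" where
  "field_add X Y = (\<lambda>x \<kappa>. X x \<kappa> + Y x \<kappa>)"

lemma expression_field_add: "expression (field_add X Y) \<kappa> = (\<lambda>p. expression X \<kappa> p + expression Y \<kappa> p)"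
  by (simp add: expression_def field_add_def fun_eq_iff)

lemma tangent_field_add:
  "tangent_field T \<A> X \<Longrightarrow> tangent_field T \<A> Y \<Longrightarrow> tangent_field T \<A> (field_add X Y)"
  unfolding tangent_field_def field_add_def using tangent_space_add[OF smooth_atlas_axioms] by blast

lemma divergence_field_add:
  assumes \<kappa>: "\<kappa> \<in> \<A>" and p: "p \<in> snd \<kappa> ` fst \<kappa>"
    and d: "expression X \<kappa> differentiable (at p)" "expression Y \<kappa> differentiable (at p)"
  shows "divergence \<A> \<omega> (field_add X Y) \<kappa> p = divergence \<A> \<omega> X \<kappa> p + divergence \<A> \<omega> Y \<kappa> p"
proof -
  let ?f = "form_coeff \<A> \<omega> \<kappa>"
  have D: "((\<lambda>q. ?f q * expression Z \<kappa> q $ i) has_derivative frechet_derivative (\<lambda>q. ?f q * expression Z \<kappa> q $ i) (at p)) (at p)"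
    if "expression Z \<kappa> differentiable (at p)" for Z :: "('a, 'n) field" and i
    using differentiable_mult[OF form_coeff_differentiable[OF \<kappa> p] partial_deriv_nth(2)[OF that]] frechet_derivative_works by blast
  have "partial_deriv i (\<lambda>q. ?f q * expression (field_add X Y) \<kappa> q $ i) p
      = partial_deriv i (\<lambda>q. ?f q * expression X \<kappa> q $ i) p + partial_deriv i (\<lambda>q. ?f q * expression Y \<kappa> q $ i) p" for i
    using partial_deriv_eq[OF has_derivative_add[OF D[OF d(1), of i] D[OF d(2), of i]], of i]
    by (simp add: expression_field_add distrib_left frechet_derivative_axis)
  then show ?thesis by (simp add: divergence_def sum.distrib add_divide_distrib)
qed

lemma div_free_field_add:
  assumes s: "1 \<le> s" and b: "0 \<le> \<beta>" "\<beta> \<le> 1"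
    and X: "X \<in> div_free_fields T \<A> \<omega> m c s \<beta>" and Y: "Y \<in> div_free_fields T \<A> \<omega> m c s \<beta>"
  shows "field_add X Y \<in> div_free_fields T \<A> \<omega> m c s \<beta>"
proof -
  have RX: "C_hoelder_on b n (snd \<kappa> ` fst \<kappa>) (expression X \<kappa>)" and RY: "C_hoelder_on b n (snd \<kappa> ` fst \<kappa>) (expression Y \<kappa>)"
    if "regularity_index s \<beta> b n" "\<kappa> \<in> \<A>" for b n \<kappa>
    using X Y that unfolding div_free_fields_def regular_field_iff[OF b] by blast+
  have "field_add X Y \<in> vector_fields T \<A> m c s \<beta>"
    unfolding regular_field_iff[OF b] expression_field_add
  proof (intro conjI allI impI ballI)
    have "tangent_field T \<A> X" "tangent_field T \<A> Y"
      using X Y unfolding div_free_fields_def regular_field_iff[OF b] by blast+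
    then show "tangent_field T \<A> (field_add X Y)" by (rule tangent_field_add)
    show "C_hoelder_on b n (snd \<kappa> ` fst \<kappa>) (\<lambda>p. expression X \<kappa> p + expression Y \<kappa> p)"
      if "regularity_index s \<beta> b n" "\<kappa> \<in> \<A>" for b n \<kappa>
      by (rule C_hoelder_on_add[OF chart_image_open[OF that(2)] RX[OF that] RY[OF that]])
  qed
  moreover have "divergence \<A> \<omega> (field_add X Y) \<kappa> p = 0" if \<kappa>: "\<kappa> \<in> \<A>" and p: "p \<in> snd \<kappa> ` fst \<kappa>" for \<kappa> p
  proof -
    have "expression X \<kappa> differentiable (at p)" by (rule regularity_index_C1(1)[OF s RX[OF _ \<kappa>] p])
    moreover have "expression Y \<kappa> differentiable (at p)" by (rule regularity_index_C1(1)[OF s RY[OF _ \<kappa>] p])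
    ultimately have "divergence \<A> \<omega> (field_add X Y) \<kappa> p = divergence \<A> \<omega> X \<kappa> p + divergence \<A> \<omega> Y \<kappa> p"
      by (rule divergence_field_add[OF \<kappa> p])
    moreover have "divergence \<A> \<omega> X \<kappa> p = 0" "divergence \<A> \<omega> Y \<kappa> p = 0"
      using X Y \<kappa> p unfolding div_free_fields_def by blast+
    ultimately show ?thesis by simp
  qed
  ultimately show ?thesis unfolding div_free_fields_def by blast
qed

lemma div_free_field_sum:
  assumes s: "1 \<le> s" and b: "0 \<le> \<beta>" "\<beta> \<le> 1" and "finite I"
    and v: "v \<in> div_free_fields T \<A> \<omega> m c s \<beta>" and E: "\<And>x. x \<in> I \<Longrightarrow> E x \<in> div_free_fields T \<A> \<omega> m c s \<beta>"
  shows "(\<lambda>y \<kappa>. v y \<kappa> + (\<Sum>x\<in>I. E x y \<kappa>)) \<in> div_free_fields T \<A> \<omega> m c s \<beta>"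
  using assms(4) E
proof (induction I rule: finite_induct)
  case empty
  then show ?case using v by simp
next
  case (insert x I)
  then have "field_add (\<lambda>y \<kappa>. v y \<kappa> + (\<Sum>x\<in>I. E x y \<kappa>)) (E x) \<in> div_free_fields T \<A> \<omega> m c s \<beta>"
    by (intro div_free_field_add[OF s b]) auto
  then show ?case using insert by (simp add: field_add_def add_ac)
qed

section \<open>Uniform control of the transition maps\<close>

text \<open>The intersection of the closures of two chart domains is compact and lies in the overlap of the
  larger charts, where the derivatives of the transition map are continuous. The bound is strict so
  that it persists in a neighbourhood.\<close>

lemma transition_partials_bounded:
  obtains L where "L \<ge> 1"
    "\<And>j k x i. j \<in> {1..m} \<Longrightarrow> k \<in> {1..m} \<Longrightarrow> x \<in> T closure_of fst (c j) \<Longrightarrow> x \<in> T closure_of fst (c k) \<Longrightarrow>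
       norm (partial_deriv i (transition (d k) (d j)) (snd (d k) x)) < L"
proof -
  let ?P = "\<lambda>(j, k, i) B. \<forall>x. x \<in> T closure_of fst (c j) \<longrightarrow> x \<in> T closure_of fst (c k) \<longrightarrow>
       norm (partial_deriv i (transition (d k) (d j)) (snd (d k) x)) \<le> B"
  let ?I = "{1..m} \<times> {1..m} \<times> (UNIV :: 'n set)"
  have "\<exists>B. ?P z B" if z: "z \<in> ?I" for z
  proof -
    obtain j k i where z': "z = (j, k, i)" "j \<in> {1..m}" "k \<in> {1..m}" using z by auto
    let ?K = "T closure_of fst (c j) \<inter> T closure_of fst (c k)"
    have "compactin T ?K" by (rule closedin_compact_space[OF compact]) (intro closedin_Int closedin_closure_of)
    moreover have sub: "?K \<subseteq> fst (d k) \<inter> fst (d j)" using closure_sub z' by blast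
    ultimately have "compact (snd (d k) ` ?K)" using compact_chart_image[OF d_atlas[OF z'(3)], of ?K] by blast
    moreover have "continuous_on (snd (d k) ` ?K) (partial_deriv i (transition (d k) (d j)))"
      by (rule continuous_on_subset[OF C_infinity_on_continuous[OF C_infinity_on_partial[OF
              smooth_transition[OF d_atlas[OF z'(3)] d_atlas[OF z'(2)]]]] image_mono[OF sub]])
    ultimately have "bounded (partial_deriv i (transition (d k) (d j)) ` snd (d k) ` ?K)"
      using compact_continuous_image compact_imp_bounded by blast
    then show ?thesis unfolding z'(1) bounded_iff by auto
  qed
  then have "\<exists>B. \<forall>z\<in>?I. ?P z (B z)" by (intro bchoice ballI)
  then obtain B where B: "\<forall>z\<in>?I. ?P z (B z)" by (elim exE)
  define L where "L = 1 + (\<Sum>z\<in>?I. \<bar>B z\<bar>)"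
  have BL: "B z < L" if "z \<in> ?I" for z
    using member_le_sum[of z ?I "\<lambda>z. \<bar>B z\<bar>"] that unfolding L_def by fastforce
  show ?thesis
  proof (rule that)
    show "1 \<le> L" by (simp add: L_def sum_nonneg)
    fix j k x i assume "j \<in> {1..m}" "k \<in> {1..m}" "x \<in> T closure_of fst (c j)" "x \<in> T closure_of fst (c k)"
    then show "norm (partial_deriv i (transition (d k) (d j)) (snd (d k) x)) < L"
      using bspec[OF B, of "(j, k, i)"] BL[of "(j, k, i)"] by force
  qed
qed

lemma finite_nbhd:
  assumes "finite I" "x \<in> topspace T" "\<And>i. i \<in> I \<Longrightarrow> \<exists>N. openin T N \<and> x \<in> N \<and> (\<forall>y\<in>N. P i y)"
  shows "\<exists>N. openin T N \<and> x \<in> N \<and> (\<forall>y\<in>N. \<forall>i\<in>I. P i y)"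
  using assms(1,3)
proof (induction I rule: finite_induct)
  case empty
  then show ?case using assms(2) by (intro exI[of _ "topspace T"]) auto
next
  case (insert i I)
  obtain N where N: "openin T N" "x \<in> N" "\<forall>y\<in>N. \<forall>i\<in>I. P i y" using insert by blast
  obtain N' where N': "openin T N'" "x \<in> N'" "\<forall>y\<in>N'. P i y" using insert.prems by blast
  show ?case by (rule exI[of _ "N \<inter> N'"]) (use N N' in auto)
qed

lemma nbhd_norm_less:
  assumes "\<kappa> \<in> \<A>" "open S" "continuous_on S f" "x \<in> fst \<kappa>" "snd \<kappa> x \<in> S" "norm (f (snd \<kappa> x)) < B"
  shows "\<exists>N. openin T N \<and> x \<in> N \<and> (\<forall>y\<in>N. y \<in> fst \<kappa> \<and> norm (f (snd \<kappa> y)) < B)"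
proof -
  have "open {p \<in> S. f p \<in> ball 0 B}"
    using continuous_open_preimage[OF assms(3,2) open_ball[of 0 B]] by (simp add: vimage_def Int_def)
  then have "openin T {y \<in> fst \<kappa>. snd \<kappa> y \<in> {p \<in> S. f p \<in> ball 0 B}}" by (rule open_chart_preimage[OF assms(1)])
  then show ?thesis using assms by (intro exI[of _ "{y \<in> fst \<kappa>. snd \<kappa> y \<in> {p \<in> S. f p \<in> ball 0 B}}"]) auto
qed

text \<open>If \<open>x\<close> is outside the closure of the domain of \<open>c j\<close>, a neighbourhood misses this domain and nothing
  is to be shown. Otherwise \<open>x\<close> lies in both larger charts, and the bounds at \<open>x\<close> persist nearby. In
  contrast to \<open>L\<close>, the bound \<open>L'\<close> for the second derivatives depends on \<open>x\<close>.\<close>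

lemma transition_control:
  assumes L: "\<And>j k x i. j \<in> {1..m} \<Longrightarrow> k \<in> {1..m} \<Longrightarrow> x \<in> T closure_of fst (c j) \<Longrightarrow> x \<in> T closure_of fst (c k) \<Longrightarrow>
       norm (partial_deriv i (transition (d k) (d j)) (snd (d k) x)) < L"
    and j: "j \<in> {1..m}" and k: "k \<in> {1..m}" and x: "x \<in> fst (c k)"
  shows "\<exists>L'. \<exists>N. openin T N \<and> x \<in> N \<and> (\<forall>y\<in>N. y \<in> fst (c j) \<longrightarrow>
     (\<forall>i. norm (partial_deriv i (transition (d k) (d j)) (snd (d k) y)) \<le> L \<and>
          norm (partial_deriv i (transition (d j) (d k)) (snd (d j) y)) \<le> L \<and>
          (\<forall>a. norm (partial_deriv a (partial_deriv i (transition (d k) (d j))) (snd (d k) y)) \<le> L')))"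
proof (cases "x \<in> T closure_of fst (c j)")
  case False
  have "openin T (topspace T - T closure_of fst (c j))" by (rule openin_diff) auto
  then show ?thesis using False x c_sub_closure[OF j] chart_subset[OF c_atlas[OF k]]
    by (intro exI[of _ 0] exI[of _ "topspace T - T closure_of fst (c j)"]) blast
next
  case True
  let ?\<tau> = "transition (d k) (d j)" and ?\<tau>' = "transition (d j) (d k)"
  have dk: "d k \<in> \<A>" and dj: "d j \<in> \<A>" using d_atlas j k by auto
  have xk: "x \<in> T closure_of fst (c k)" using x c_sub_closure[OF k] by blast
  have xd: "x \<in> fst (d k)" "x \<in> fst (d j)" using xk True closure_sub j k by blast+
  have xT: "x \<in> topspace T" using xd chart_subset[OF dk] by blast
  have sm: "C_infinity_on (overlap (d k) (d j)) ?\<tau>" "C_infinity_on (overlap (d j) (d k)) ?\<tau>'"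
    using smooth_transition dk dj by blast+
  note op = open_overlap[OF dk dj] open_overlap[OF dj dk]
  have in_o: "snd (d k) x \<in> overlap (d k) (d j)" "snd (d j) x \<in> overlap (d j) (d k)" using xd by auto
  define B where "B i a = norm (partial_deriv a (partial_deriv i ?\<tau>) (snd (d k) x)) + 1" for i a
  define L' where "L' = (\<Sum>i\<in>UNIV. \<Sum>a\<in>UNIV. B i a)"
  have BL: "B i a \<le> L'" for i a
  proof -
    have "B i a \<le> (\<Sum>a\<in>UNIV. B i a)" by (rule member_le_sum) (auto simp: B_def)
    also have "\<dots> \<le> L'" unfolding L'_def by (rule member_le_sum) (auto simp: B_def intro: sum_nonneg)
    finally show ?thesis .
  qed
  have 1: "\<exists>N. openin T N \<and> x \<in> N \<and> (\<forall>y\<in>N. \<forall>i\<in>UNIV. norm (partial_deriv i ?\<tau> (snd (d k) y)) < L)"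
  proof (rule finite_nbhd[OF finite xT])
    fix i
    show "\<exists>N. openin T N \<and> x \<in> N \<and> (\<forall>y\<in>N. norm (partial_deriv i ?\<tau> (snd (d k) y)) < L)"
      using nbhd_norm_less[OF dk op(1) C_infinity_on_continuous[OF C_infinity_on_partial[OF sm(1)]] xd(1) in_o(1) L[OF j k True xk], of i] by blast
  qed
  have 2: "\<exists>N. openin T N \<and> x \<in> N \<and> (\<forall>y\<in>N. \<forall>i\<in>UNIV. norm (partial_deriv i ?\<tau>' (snd (d j) y)) < L)"
  proof (rule finite_nbhd[OF finite xT])
    fix i
    show "\<exists>N. openin T N \<and> x \<in> N \<and> (\<forall>y\<in>N. norm (partial_deriv i ?\<tau>' (snd (d j) y)) < L)"
      using nbhd_norm_less[OF dj op(2) C_infinity_on_continuous[OF C_infinity_on_partial[OF sm(2)]] xd(2) in_o(2) L[OF k j xk True], of i] by blast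
  qed
  have 3: "\<exists>N. openin T N \<and> x \<in> N \<and> (\<forall>y\<in>N. \<forall>z\<in>UNIV. norm (partial_deriv (snd z) (partial_deriv (fst z) ?\<tau>) (snd (d k) y)) < B (fst z) (snd z))"
  proof (rule finite_nbhd[OF finite xT])
    fix z :: "'n \<times> 'n"
    show "\<exists>N. openin T N \<and> x \<in> N \<and> (\<forall>y\<in>N. norm (partial_deriv (snd z) (partial_deriv (fst z) ?\<tau>) (snd (d k) y)) < B (fst z) (snd z))"
      using nbhd_norm_less[OF dk op(1) C_infinity_on_continuous[OF C_infinity_on_partial[OF C_infinity_on_partial[OF sm(1)]]] xd(1) in_o(1), of "snd z" "fst z" "B (fst z) (snd z)"]
      unfolding B_def by simp blast
  qed
  obtain N1 where N1: "openin T N1" "x \<in> N1" "\<And>y i. y \<in> N1 \<Longrightarrow> norm (partial_deriv i ?\<tau> (snd (d k) y)) < L" using 1 by blast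
  obtain N2 where N2: "openin T N2" "x \<in> N2" "\<And>y i. y \<in> N2 \<Longrightarrow> norm (partial_deriv i ?\<tau>' (snd (d j) y)) < L" using 2 by blast
  obtain N3 where N3: "openin T N3" "x \<in> N3" "\<And>y z. y \<in> N3 \<Longrightarrow> norm (partial_deriv (snd z) (partial_deriv (fst z) ?\<tau>) (snd (d k) y)) < B (fst z) (snd z)"
    using 3 by blast
  have L': "norm (partial_deriv a (partial_deriv i ?\<tau>) (snd (d k) y)) \<le> L'" if "y \<in> N3" for y a i
    using N3(3)[OF that, of "(i, a)"] BL[of i a] by simp
  show ?thesis
  proof (intro exI[of _ L'] exI[of _ "N1 \<inter> (N2 \<inter> N3)"] conjI ballI allI impI)
    show "openin T (N1 \<inter> (N2 \<inter> N3))" using N1 N2 N3 by auto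
    show "x \<in> N1 \<inter> (N2 \<inter> N3)" using N1 N2 N3 by auto
    fix y i a assume "y \<in> N1 \<inter> (N2 \<inter> N3)"
    then show "norm (partial_deriv i ?\<tau> (snd (d k) y)) \<le> L" "norm (partial_deriv i ?\<tau>' (snd (d j) y)) \<le> L"
      "norm (partial_deriv a (partial_deriv i ?\<tau>) (snd (d k) y)) \<le> L'"
      using N1(3)[of y i] N2(3)[of y i] L'[of y a i] by auto
  qed
qed

end

text \<open>The product rule for \<open>z \<mapsto> D\<tau>(z) w(z)\<close> followed by the chain rule for \<open>\<tau>'\<close>. The second derivatives of
  \<open>\<tau>\<close> multiply \<open>W0\<close> only, which is of the order of the radius in the application.\<close>

lemma pushforward_bounds:
  fixes w \<tau> \<tau>' :: "real^'n::finite \<Rightarrow> real^'n"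
  assumes S: "open S" "q \<in> S" and F: "\<And>q. q \<in> S \<Longrightarrow> F q = (\<Sum>i\<in>UNIV. w (\<tau>' q) $ i *\<^sub>R partial_deriv i \<tau> (\<tau>' q))"
    and w: "w differentiable (at (\<tau>' q))" and \<tau>: "\<And>i. partial_deriv i \<tau> differentiable (at (\<tau>' q))"
    and \<tau>': "\<tau>' differentiable (at q)"
    and W0: "norm (w (\<tau>' q)) \<le> W0" and W1: "\<And>b. norm (partial_deriv b w (\<tau>' q)) \<le> W1"
    and L: "\<And>i. norm (partial_deriv i \<tau> (\<tau>' q)) \<le> L" "\<And>a. norm (partial_deriv a \<tau>' q) \<le> L"
    and L': "\<And>b i. norm (partial_deriv b (partial_deriv i \<tau>) (\<tau>' q)) \<le> L'"
  shows "norm (F q) \<le> real CARD('n) * L * W0"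
    and "onorm (frechet_derivative F (at q)) \<le> real CARD('n) * (real CARD('n) * (real CARD('n) * (W1 * L + W0 * L')) * L)"
proof -
  let ?n = "real CARD('n)" and ?z = "\<tau>' q"
  define h where "h z = (\<Sum>i\<in>UNIV. w z $ i *\<^sub>R partial_deriv i \<tau> z)" for z
  have W00: "0 \<le> W0" by (rule order_trans[OF norm_ge_zero W0])
  have W10: "0 \<le> W1" by (rule order_trans[OF norm_ge_zero W1[of undefined]])
  have L0: "0 \<le> L" by (rule order_trans[OF norm_ge_zero L(1)[of undefined]])
  have L'0: "0 \<le> L'" by (rule order_trans[OF norm_ge_zero L'[of undefined undefined]])
  have "norm (h ?z) \<le> ?n * L * norm (w ?z)" unfolding h_def by (rule norm_sum_partials_le[OF L(1)])
  also have "\<dots> \<le> ?n * L * W0" using W0 L0 by (intro mult_left_mono) auto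
  finally show "norm (F q) \<le> ?n * L * W0" using F[OF S(2)] by (simp add: h_def)
  have dw: "(w has_derivative frechet_derivative w (at ?z)) (at ?z)" using w frechet_derivative_works by blast
  have dw': "((\<lambda>z. w z $ i) has_derivative (\<lambda>u. frechet_derivative w (at ?z) u $ i)) (at ?z)" for i
    by (rule bounded_linear.has_derivative[OF bounded_linear_vec_nth dw])
  have d\<tau>: "(partial_deriv i \<tau> has_derivative frechet_derivative (partial_deriv i \<tau>) (at ?z)) (at ?z)" for i
    using \<tau> frechet_derivative_works by blast
  have Dh: "(h has_derivative (\<lambda>u. \<Sum>i\<in>UNIV. w ?z $ i *\<^sub>R frechet_derivative (partial_deriv i \<tau>) (at ?z) u
      + frechet_derivative w (at ?z) u $ i *\<^sub>R partial_deriv i \<tau> ?z)) (at ?z)"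
    unfolding h_def by (intro has_derivative_sum has_derivative_scaleR dw' d\<tau>)
  have ph: "norm (partial_deriv b h ?z) \<le> ?n * (W1 * L + W0 * L')" for b
  proof -
    have "norm (partial_deriv b h ?z) \<le> (\<Sum>i\<in>(UNIV::'n set). W0 * L' + W1 * L)"
      unfolding partial_deriv_eq[OF Dh] frechet_derivative_axis
    proof (rule sum_norm_le)
      fix i
      have "norm (w ?z $ i *\<^sub>R partial_deriv b (partial_deriv i \<tau>) ?z) \<le> W0 * L'"
        using mult_mono[OF order_trans[OF component_le_norm_cart[of "w ?z" i] W0] L'[of b i] W00 norm_ge_zero] by simp
      moreover have "norm (partial_deriv b w ?z $ i *\<^sub>R partial_deriv i \<tau> ?z) \<le> W1 * L"
        using mult_mono[OF order_trans[OF component_le_norm_cart[of "partial_deriv b w ?z" i] W1] L(1)[of i] W10 norm_ge_zero] by simp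
      ultimately show "norm (w ?z $ i *\<^sub>R partial_deriv b (partial_deriv i \<tau>) ?z + partial_deriv b w ?z $ i *\<^sub>R partial_deriv i \<tau> ?z) \<le> W0 * L' + W1 * L"
        by (rule norm_triangle_mono)
    qed
    then show ?thesis by (simp add: add.commute)
  qed
  have dh: "h differentiable (at ?z)" using Dh by (auto simp: differentiable_def)
  have hF: "\<And>q. q \<in> S \<Longrightarrow> h (\<tau>' q) = F q" using F by (simp add: h_def)
  have dF: "F differentiable (at q)"
    by (rule differentiable_cong_open[OF S hF partial_deriv_compose(2)[OF dh \<tau>']])
  show "onorm (frechet_derivative F (at q)) \<le> ?n * (?n * (?n * (W1 * L + W0 * L')) * L)"
  proof (rule onorm_frechet_le[OF dF])
    fix a
    have "partial_deriv a F q = partial_deriv a (\<lambda>q. h (\<tau>' q)) q"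
      by (rule partial_deriv_cong_open[OF S hF[symmetric]])
    also have "norm \<dots> \<le> ?n * (?n * (W1 * L + W0 * L')) * norm (partial_deriv a \<tau>' q)"
      unfolding partial_deriv_compose(1)[OF dh \<tau>'] by (rule norm_sum_partials_le[OF ph])
    also have "\<dots> \<le> ?n * (?n * (W1 * L + W0 * L')) * L"
      using L(2) W00 W10 L0 L'0 by (intro mult_left_mono) auto
    finally show "norm (partial_deriv a F q) \<le> ?n * (?n * (W1 * L + W0 * L')) * L" .
  qed
qed


section \<open>Perturbation near a point\<close>

context conservative_manifold begin

lemma div_free_coordinates:
  assumes s: "1 \<le> s" and b: "0 \<le> \<beta>" "\<beta> \<le> 1" and v: "v \<in> div_free_fields T \<A> \<omega> m c s \<beta>" and k: "k \<in> {1..m}"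
    and p: "p \<in> snd (d k) ` fst (d k)"
  shows "coord_div (expression v (d k)) p = 0"
proof -
  have dk: "d k \<in> \<A>" by (rule d_atlas[OF k])
  have tv: "tangent_field T \<A> v"
    and R: "\<And>b n. regularity_index s \<beta> b n \<Longrightarrow> C_hoelder_on b n (snd (d k) ` fst (d k)) (expression v (d k))"
    using v dk unfolding div_free_fields_def regular_field_iff[OF b] by blast+
  have df: "expression v (d k) differentiable (at p)" by (rule regularity_index_C1(1)[OF s R p])
  obtain x where x: "x \<in> fst (d k)" "p = snd (d k) x" using p by blast
  have "divergence \<A> \<omega> v (d k) p = 0" using v dk p unfolding div_free_fields_def by blast
  then show ?thesis
    using divergence_conservative[OF tv dk dk conservative[OF k] x(1) x(1)] df
      form_coeff_conservative_self[OF dk conservative[OF k] x(1)] x(2) by simp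
qed

text \<open>At points of the chart \<open>d k\<close> the regularity and the divergence of the field are those of \<open>w\<close>, and every
  other point has a neighbourhood on which the field is \<open>0\<close>, because \<open>B\<close> is closed.\<close>

lemma chart_field_div_free:
  assumes s: "1 \<le> s" and b: "0 \<le> \<beta>" "\<beta> \<le> 1" and k: "k \<in> {1..m}"
    and B: "compactin T B" and supp: "\<And>y. y \<in> fst (d k) \<Longrightarrow> y \<notin> B \<Longrightarrow> w (snd (d k) y) = 0" and Bk: "B \<subseteq> fst (d k)"
    and R: "\<And>b n. regularity_index s \<beta> b n \<Longrightarrow> C_hoelder_on b n UNIV w"
    and div: "\<And>p. coord_div w p = 0"
  shows "chart_field (d k) w \<in> div_free_fields T \<A> \<omega> m c s \<beta>"
proof -
  let ?E = "chart_field (d k) w"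
  have dk: "d k \<in> \<A>" by (rule d_atlas[OF k])
  have tE: "tangent_field T \<A> ?E" by (rule tangent_field_chart_field[OF dk])
  have cl: "openin T (topspace T - B)"
    by (rule openin_diff[OF openin_topspace compactin_imp_closedin[OF Hausdorff B]])
  have E0: "?E y = (\<lambda>_. 0)" if "y \<notin> B" for y
    by (rule chart_field_eq_0[OF dk]) (use supp that in blast)
  have ex0: "expression ?E \<kappa> q = 0" if \<kappa>: "\<kappa> \<in> \<A>" and q: "q \<in> snd \<kappa> ` (fst \<kappa> \<inter> (topspace T - B))" for \<kappa> q
  proof -
    obtain y where y: "y \<in> fst \<kappa>" "y \<notin> B" "q = snd \<kappa> y" using q by blast
    then show ?thesis using expression_at[OF \<kappa> y(1), of ?E] E0[OF y(2)] by simp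
  qed
  have RE: "C_hoelder_on b n (snd \<kappa> ` fst \<kappa>) (expression ?E \<kappa>)"
    if i: "regularity_index s \<beta> b n" and \<kappa>: "\<kappa> \<in> \<A>" for b n \<kappa>
  proof (rule C_hoelder_on_all_charts[OF tE _ _ _ \<kappa>])
    show "0 \<le> b" "b \<le> 1" using i b unfolding regularity_index_def by (auto split: if_splits)
    fix y assume y: "y \<in> topspace T"
    show "\<exists>\<kappa>\<in>\<A>. \<exists>N. openin T N \<and> y \<in> fst \<kappa> \<and> y \<in> N \<and> C_hoelder_on b n (snd \<kappa> ` (fst \<kappa> \<inter> N)) (expression ?E \<kappa>)"
    proof (cases "y \<in> fst (d k)")
      case True
      have "C_hoelder_on b n (snd (d k) ` fst (d k)) (expression ?E (d k))"
        by (rule C_hoelder_on_cong[OF chart_image_open[OF dk] C_hoelder_on_subset[OF R[OF i]]])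
          (simp_all add: expression_chart_field[OF dk])
      then have "C_hoelder_on b n (snd (d k) ` (fst (d k) \<inter> fst (d k))) (expression ?E (d k))" by simp
      then show ?thesis using True dk chart_open[OF dk] by blast
    next
      case False
      then have yB: "y \<in> topspace T - B" using Bk y by blast
      obtain \<kappa> where \<kappa>: "\<kappa> \<in> \<A>" "y \<in> fst \<kappa>" using topspace_chart[OF y] .
      have "C_hoelder_on b n (snd \<kappa> ` (fst \<kappa> \<inter> (topspace T - B))) (expression ?E \<kappa>)"
        by (rule C_hoelder_on_cong[OF open_chart_image[OF \<kappa>(1) cl] C_hoelder_on_const[of _ _ _ 0]]) (simp only: ex0[OF \<kappa>(1)])
      then show ?thesis using \<kappa> yB cl by blast
    qed
  qed
  have dE: "expression ?E \<kappa> differentiable (at q)" if "\<kappa> \<in> \<A>" "q \<in> snd \<kappa> ` fst \<kappa>" for \<kappa> q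
    by (rule regularity_index_C1(1)[OF s RE[OF _ that(1)] that(2)])
  have "divergence \<A> \<omega> ?E \<kappa> q = 0" if \<kappa>: "\<kappa> \<in> \<A>" and q: "q \<in> snd \<kappa> ` fst \<kappa>" for \<kappa> q
  proof -
    obtain y where y: "y \<in> fst \<kappa>" "q = snd \<kappa> y" using q by blast
    show ?thesis
    proof (cases "y \<in> fst (d k)")
      case True
      have "partial_deriv i (expression ?E (d k)) (snd (d k) y) = partial_deriv i w (snd (d k) y)" for i
        by (rule partial_deriv_cong_open[OF chart_image_open[OF dk]]) (use True in \<open>auto simp: expression_chart_field[OF dk]\<close>)
      then show ?thesis
        using divergence_conservative[OF tE dk \<kappa> conservative[OF k] True y(1) dE[OF dk] dE[OF \<kappa>]] True y div by simp
    next
      case False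
      then have "y \<in> topspace T - B" using Bk y(1) chart_subset[OF \<kappa>] by blast
      then have qS: "q \<in> snd \<kappa> ` (fst \<kappa> \<inter> (topspace T - B))" using y by blast
      have "partial_deriv i (\<lambda>q. form_coeff \<A> \<omega> \<kappa> q * expression ?E \<kappa> q $ i) q = partial_deriv i (\<lambda>_. 0) q" for i
        by (rule partial_deriv_cong_open[OF open_chart_image[OF \<kappa> cl] qS]) (simp add: ex0[OF \<kappa>])
      then show ?thesis by (simp add: divergence_def)
    qed
  qed
  then show ?thesis
    unfolding div_free_fields_def regular_field_iff[OF b] using tE RE by blast
qed

text \<open>The field \<open>E\<close> is a correction of \<open>v\<close> supported in \<open>B\<close>. Its bounds are stated pointwise with \<open>\<epsilon>/2\<close>, so that
  suprema over the charts remain below \<open>\<epsilon>\<close>.\<close>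

definition perturbs_at ::
    "real \<Rightarrow> enat \<Rightarrow> real \<Rightarrow> ('a, 'n) field \<Rightarrow> nat \<Rightarrow> 'a \<Rightarrow> (real^'n \<Rightarrow> real^'n) \<Rightarrow> 'a set \<Rightarrow> ('a, 'n) field \<Rightarrow> bool" where
  "perturbs_at \<epsilon> s \<beta> v k x A B E \<longleftrightarrow> compactin T B \<and> E \<in> div_free_fields T \<A> \<omega> m c s \<beta> \<and>
     (\<forall>y. y \<notin> B \<longrightarrow> E y = (\<lambda>_. 0)) \<and>
     (\<forall>\<^sub>F y in nhds (snd (c k) x).
        expression v (c k) y + expression E (c k) y = v x (c k) + A (y - snd (c k) x)) \<and>
     (\<forall>j\<in>{1..m}. \<forall>p\<in>ball 0 r0. norm (expression E (c j) p) \<le> \<epsilon>/2 \<and>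
        onorm (frechet_derivative (expression E (c j)) (at p)) \<le> \<epsilon>/2)"

text \<open>The constant \<open>\<delta>\<close> makes the term of the pushed forward derivative that contains no second
  derivatives of transition maps at most \<open>\<epsilon>/4\<close>; the radius is then chosen such that the other term
  is at most \<open>\<epsilon>/4\<close> as well.\<close>

lemma perturbation_at_point:
  assumes dim: "CARD('n) \<ge> 2"
  obtains \<delta> :: real where "\<delta> > 0"
    "\<And>\<epsilon> s \<beta> v k x N A. \<epsilon> > 0 \<Longrightarrow> 1 \<le> s \<Longrightarrow> 0 \<le> \<beta> \<Longrightarrow> \<beta> \<le> 1 \<Longrightarrow> v \<in> div_free_fields T \<A> \<omega> m c s \<beta> \<Longrightarrow>
      k \<in> {1..m} \<Longrightarrow> x \<in> fst (c k) \<Longrightarrow> openin T N \<Longrightarrow> x \<in> N \<Longrightarrow> linear A \<Longrightarrow> trace (matrix A) = 0 \<Longrightarrow>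
      onorm (\<lambda>h. A h - frechet_derivative (expression v (c k)) (at (snd (c k) x)) h) < \<delta> * \<epsilon> \<Longrightarrow>
      \<exists>B\<subseteq>N. \<exists>E. perturbs_at \<epsilon> s \<beta> v k x A B E"
proof -
  obtain L where L1: "L \<ge> 1" and L: "\<And>j k x i. j \<in> {1..m} \<Longrightarrow> k \<in> {1..m} \<Longrightarrow> x \<in> T closure_of fst (c j) \<Longrightarrow> x \<in> T closure_of fst (c k) \<Longrightarrow>
       norm (partial_deriv i (transition (d k) (d j)) (snd (d k) x)) < L"
    by (rule transition_partials_bounded) blast
  obtain C where C: "C > 0" and linearize:
    "\<And>(v :: real^'n \<Rightarrow> real^'n) A p r \<eta>. nearly_linear v A p r \<eta> \<Longrightarrow> \<exists>w. linearizes C w v A p r \<eta>"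
    using linearizing_perturbation[OF dim] by blast
  let ?n = "real CARD('n)"
  have n1: "?n \<ge> 1" using dim by simp
  define \<delta> where "\<delta> = 1 / (4 * ?n ^ 3 * L ^ 2 * C)"
  have \<delta>: "\<delta> > 0" using n1 L1 C by (simp add: \<delta>_def)
  show ?thesis
  proof (rule that[OF \<delta>])
    fix \<epsilon> :: real and s \<beta> v k x N and A :: "real^'n \<Rightarrow> real^'n"
    assume \<epsilon>: "\<epsilon> > 0" and s: "1 \<le> s" and b: "0 \<le> \<beta>" "\<beta> \<le> 1" and v: "v \<in> div_free_fields T \<A> \<omega> m c s \<beta>"
      and k: "k \<in> {1..m}" and x: "x \<in> fst (c k)" and N: "openin T N" "x \<in> N" and A: "linear A" and trA: "trace (matrix A) = 0"
      and close: "onorm (\<lambda>h. A h - frechet_derivative (expression v (c k)) (at (snd (c k) x)) h) < \<delta> * \<epsilon>"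
    let ?\<kappa> = "d k" and ?V = "snd (d k) ` fst (d k)" and ?v = "expression v (d k)" and ?\<eta> = "\<delta> * \<epsilon>"
    define p where "p = snd (d k) x"
    have ck: "c k \<in> \<A>" and dk: "d k \<in> \<A>" by (rule c_atlas[OF k], rule d_atlas[OF k])
    have pc: "snd (c k) x = p" using agree[OF k x] by (simp add: p_def)
    have xd: "x \<in> fst (d k)" using c_sub_d[OF k] x by blast
    have xT: "x \<in> topspace T" using chart_subset[OF dk] xd by blast
    have p0: "p \<in> ball 0 r0" using c_image[OF k] x pc by blast
    have tv: "tangent_field T \<A> v"
      and Rv: "\<And>b n. regularity_index s \<beta> b n \<Longrightarrow> C_hoelder_on b n ?V ?v"
      using v dk unfolding div_free_fields_def regular_field_iff[OF b] by blast+
    have v_diff: "?v differentiable (at q)" if "q \<in> ?V" for q by (rule regularity_index_C1(1)[OF s Rv that])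
    have v_cont: "continuous_on ?V (partial_deriv i ?v)" for i by (rule regularity_index_C1(2)[OF s Rv])
    have trA': "(\<Sum>i\<in>UNIV. A (axis i 1) $ i) = 0" using trA by (simp add: trace_def matrix_def)
    have Veq: "?v q = expression v (c k) q" if "q \<in> ball 0 r0" for q by (rule d_eq_c(2)[OF tv k that])
    have pV: "p \<in> ?V" using xd p_def by blast
    have close_p: "norm (A (axis i 1) - partial_deriv i ?v p) < ?\<eta>" for i
    proof -
      have fd: "frechet_derivative (expression v (c k)) (at p) = frechet_derivative ?v (at p)"
        by (rule frechet_derivative_eventually_eq[OF eventually_nhds_eq_on_open[OF open_ball p0]]) (simp add: Veq)
      have "linear (frechet_derivative ?v (at p))" by (rule linear_frechet_derivative[OF v_diff[OF pV]])
      then have "bounded_linear (\<lambda>h. A h - frechet_derivative ?v (at p) h)"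
        using A linear_compose_sub linear_conv_bounded_linear by blast
      from onorm[OF this, of "axis i 1"]
      have "norm (A (axis i 1) - frechet_derivative ?v (at p) (axis i 1)) \<le> onorm (\<lambda>h. A h - frechet_derivative ?v (at p) h)"
        by simp
      also have "\<dots> < ?\<eta>" using close unfolding pc fd .
      finally show ?thesis unfolding frechet_derivative_axis .
    qed
    have N1: "\<exists>N. openin T N \<and> x \<in> N \<and> (\<forall>y\<in>N. \<forall>i\<in>UNIV. norm (A (axis i 1) - partial_deriv i ?v (snd (d k) y)) < ?\<eta>)"
    proof (rule finite_nbhd[OF finite xT])
      fix i :: 'n
      have "continuous_on ?V (\<lambda>q. A (axis i 1) - partial_deriv i ?v q)" by (intro continuous_intros v_cont)
      from nbhd_norm_less[OF dk chart_image_open[OF dk] this xd, of ?\<eta>] close_p[of i] pV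
      show "\<exists>N. openin T N \<and> x \<in> N \<and> (\<forall>y\<in>N. norm (A (axis i 1) - partial_deriv i ?v (snd (d k) y)) < ?\<eta>)"
        unfolding p_def by blast
    qed
    then obtain N1 where N1: "openin T N1" "x \<in> N1"
      "\<And>y i. y \<in> N1 \<Longrightarrow> norm (A (axis i 1) - partial_deriv i ?v (snd (d k) y)) < ?\<eta>" by blast
    let ?ctrl = "\<lambda>j L' y. y \<in> fst (c j) \<longrightarrow>
       (\<forall>i. norm (partial_deriv i (transition (d k) (d j)) (snd (d k) y)) \<le> L \<and>
          norm (partial_deriv i (transition (d j) (d k)) (snd (d j) y)) \<le> L \<and>
          (\<forall>a. norm (partial_deriv a (partial_deriv i (transition (d k) (d j))) (snd (d k) y)) \<le> L'))"
    have "\<forall>j\<in>{1..m}. \<exists>L'. \<exists>N. openin T N \<and> x \<in> N \<and> (\<forall>y\<in>N. ?ctrl j L' y)"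
      using transition_control[OF L _ k x] by blast
    then have "\<exists>L'. \<forall>j\<in>{1..m}. \<exists>N. openin T N \<and> x \<in> N \<and> (\<forall>y\<in>N. ?ctrl j (L' j) y)" by (rule bchoice)
    then obtain L' where L': "\<forall>j\<in>{1..m}. \<exists>N. openin T N \<and> x \<in> N \<and> (\<forall>y\<in>N. ?ctrl j (L' j) y)" by (elim exE)
    have "\<exists>N. openin T N \<and> x \<in> N \<and> (\<forall>y\<in>N. \<forall>j\<in>{1..m}. ?ctrl j (L' j) y)"
      by (rule finite_nbhd[OF _ xT]) (use L' in auto)
    then obtain N2 where N2: "openin T N2" "x \<in> N2" "\<And>y j. y \<in> N2 \<Longrightarrow> j \<in> {1..m} \<Longrightarrow> ?ctrl j (L' j) y" by blast
    \<comment> \<open>the region around \<open>p\<close> in which all estimates hold\<close>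
    define O' where "O' = snd (d k) ` (fst (d k) \<inter> (N \<inter> N1 \<inter> N2 \<inter> fst (c k)))"
    have "open O'" unfolding O'_def
      by (rule open_chart_image[OF dk]) (intro openin_Int N(1) N1(1) N2(1) chart_open[OF ck])
    moreover have "p \<in> O'" unfolding O'_def p_def using xd N N1 N2 x by blast
    ultimately obtain e where e: "e > 0" "ball p e \<subseteq> O'" using openE by blast
    define L2 where "L2 = 1 + (\<Sum>j\<in>{1..m}. \<bar>L' j\<bar>)"
    have L2: "L2 \<ge> 1" "\<And>j. j \<in> {1..m} \<Longrightarrow> L' j \<le> L2"
    proof -
      show "L2 \<ge> 1" by (simp add: L2_def sum_nonneg)
      fix j assume "j \<in> {1..m}"
      then have "\<bar>L' j\<bar> \<le> (\<Sum>j\<in>{1..m}. \<bar>L' j\<bar>)" by (intro member_le_sum) auto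
      then show "L' j \<le> L2" unfolding L2_def by linarith
    qed
    \<comment> \<open>\<open>e/3\<close> keeps the ball of radius \<open>2 r\<close> in the region; \<open>1/L2\<close> absorbs the second derivatives of the transition maps\<close>
    define r where "r = min (e/3) (1/L2)"
    have r: "r > 0" "2 * r < e" "r \<le> 1" "r * L2 \<le> 1"
    proof -
      show "r > 0" using e L2 by (simp add: r_def)
      have "r \<le> e/3" by (simp add: r_def)
      then show "2 * r < e" using e by linarith
      have r2: "r \<le> 1/L2" by (simp add: r_def)
      also have "\<dots> \<le> 1" using L2 by simp
      finally show "r \<le> 1" .
      show "r * L2 \<le> 1" using mult_right_mono[OF r2, of L2] L2 by simp
    qed
    have sub: "ball p (2 * r) \<subseteq> O'" using e r by auto
    have OV: "O' \<subseteq> ?V" unfolding O'_def by blast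
    have close_r: "norm (A (axis i 1) - partial_deriv i ?v q) \<le> ?\<eta>" if q: "q \<in> ball p r" for q i
    proof -
      have "q \<in> O'" using q sub r by auto
      then obtain y where "y \<in> N1" "q = snd (d k) y" unfolding O'_def by blast
      then show ?thesis using N1(3)[of y i] by simp
    qed
    have "nearly_linear ?v A p r ?\<eta>"
      unfolding nearly_linear_def
    proof (intro conjI ballI allI r(1) A trA' close_r)
      show "?v differentiable (at q)" if "q \<in> ball p (2 * r)" for q using v_diff that sub OV by blast
      show "continuous_on (ball p (2 * r)) (partial_deriv i ?v)" for i
        by (rule continuous_on_subset[OF v_cont]) (use sub OV in blast)
      show "coord_div ?v q = 0" if "q \<in> ball p (2 * r)" for q
        by (rule div_free_coordinates[OF s b v k]) (use that sub OV in blast)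
    qed
    then obtain w where w: "linearizes C w ?v A p r ?\<eta>" using linearize by blast
    have w_near: "w y = ?v p + A (y - p) - ?v y" if "y \<in> ball p (r/2)" for y
      using w that unfolding linearizes_def by blast
    have w_far: "w y = 0" if "y \<notin> ball p r" for y using w that unfolding linearizes_def by blast
    have w_diff: "w differentiable (at y)" and w_div: "coord_div w y = 0"
      and w_norm: "norm (w y) \<le> C * r * ?\<eta>" and w_dnorm: "norm (partial_deriv i w y) \<le> C * ?\<eta>" for y i
      using w unfolding linearizes_def by blast+
    have w_reg: "C_hoelder_on b n UNIV w" if "0 \<le> b" "b \<le> 1" "C_hoelder_on b n (ball p (2 * r)) ?v" for b n
      using w that unfolding linearizes_def by blast
    define B where "B = {y \<in> fst (d k). snd (d k) y \<in> cball p r}"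
    have Bk: "B \<subseteq> fst (d k)" by (auto simp: B_def)
    have cbO: "cball p r \<subseteq> O'" using sub r by auto
    have Bimg: "snd (d k) ` B = cball p r" unfolding B_def using cbO OV by blast
    have compB: "compactin T B" using compact_chart_image[OF dk Bk] Bimg by simp
    have BN: "B \<subseteq> N \<inter> N2"
    proof
      fix y assume y: "y \<in> B"
      then have "snd (d k) y \<in> O'" using cbO by (auto simp: B_def)
      then obtain y' where y': "y' \<in> fst (d k)" "y' \<in> N \<inter> N2" "snd (d k) y = snd (d k) y'" unfolding O'_def by blast
      then have "y = y'" using chart_inj[OF dk] y Bk by (auto dest: inj_onD)
      then show "y \<in> N \<inter> N2" using y' by simp
    qed
    define E where "E = chart_field (d k) w"
    have suppw: "w (snd (d k) y) = 0" if "y \<in> fst (d k)" "y \<notin> B" for y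
      by (rule w_far) (use that in \<open>auto simp: B_def\<close>)
    have Rw: "C_hoelder_on b' n UNIV w" if i: "regularity_index s \<beta> b' n" for b' n
    proof (rule w_reg)
      show "0 \<le> b'" "b' \<le> 1" using i b unfolding regularity_index_def by (auto split: if_splits)
      show "C_hoelder_on b' n (ball p (2 * r)) ?v" by (rule C_hoelder_on_subset[OF Rv[OF i]]) (use sub OV in blast)
    qed
    have E_div: "E \<in> div_free_fields T \<A> \<omega> m c s \<beta>" unfolding E_def
      by (rule chart_field_div_free[OF s b k compB suppw Bk Rw w_div])
    have tE: "tangent_field T \<A> E" unfolding E_def by (rule tangent_field_chart_field[OF dk])
    have E0: "E y = (\<lambda>_. 0)" if "y \<notin> B" for y
      unfolding E_def by (rule chart_field_eq_0[OF dk]) (rule suppw[OF _ that])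
    have near: "\<forall>\<^sub>F y in nhds (snd (c k) x). expression v (c k) y + expression E (c k) y = v x (c k) + A (y - snd (c k) x)"
    proof -
      have "open (ball p (r/2) \<inter> ball 0 r0)" "p \<in> ball p (r/2) \<inter> ball 0 r0" using r p0 by auto
      moreover have "expression v (c k) y + expression E (c k) y = v x (c k) + A (y - p)" if y: "y \<in> ball p (r/2) \<inter> ball 0 r0" for y
      proof -
        have y0: "y \<in> ball 0 r0" using y by blast
        have yV: "y \<in> ?V" using y0 cball_sub_d[OF k] by auto
        have "expression v (c k) y + expression E (c k) y = ?v y + w y"
          using d_eq_c(2)[OF tv k y0] d_eq_c(2)[OF tE k y0] expression_chart_field[OF dk yV, of w] by (simp add: E_def)
        also have "\<dots> = ?v p + A (y - p)" using w_near y by simp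
        also have "?v p = v x (c k)" unfolding p_def expression_at[OF dk xd] by (rule d_eq_c(1)[OF tv k x])
        finally show ?thesis .
      qed
      ultimately show ?thesis unfolding pc eventually_nhds by blast
    qed
    have bounds: "norm (expression E (c j) q) \<le> \<epsilon>/2 \<and> onorm (frechet_derivative (expression E (c j)) (at q)) \<le> \<epsilon>/2"
      if j: "j \<in> {1..m}" and q: "q \<in> ball 0 r0" for j q
    proof -
      have dj: "d j \<in> \<A>" by (rule d_atlas[OF j])
      obtain y where y: "y \<in> fst (c j)" "q = snd (c j) y" using q c_image[OF j] by blast
      have yd: "y \<in> fst (d j)" "q = snd (d j) y" using y c_sub_d[OF j] agree[OF j] by auto
      have eq: "expression E (c j) q = expression E (d j) q"
        "frechet_derivative (expression E (c j)) (at q) = frechet_derivative (expression E (d j)) (at q)"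
        using d_eq_c(2)[OF tE j q]
          frechet_derivative_eventually_eq[OF eventually_nhds_eq_on_open[OF open_ball q d_eq_c(2)[OF tE j]]] by simp_all
      show ?thesis
      proof (cases "y \<in> B")
        case False
        have cl: "openin T (topspace T - B)"
          by (rule openin_diff[OF openin_topspace compactin_imp_closedin[OF Hausdorff compB]])
        let ?S = "snd (d j) ` (fst (d j) \<inter> (topspace T - B))"
        have S: "open ?S" "q \<in> ?S" using open_chart_image[OF dj cl] False yd chart_subset[OF dj] by blast+
        have z: "expression E (d j) u = 0" if u: "u \<in> ?S" for u
        proof -
          obtain z where z: "z \<in> fst (d j)" "z \<notin> B" "u = snd (d j) z" using u by blast
          then show ?thesis using expression_at[OF dj z(1), of E] E0[OF z(2)] by simp
        qed
        have "frechet_derivative (expression E (d j)) (at q) = frechet_derivative (\<lambda>_. 0) (at q)"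
          by (rule frechet_derivative_eventually_eq[OF eventually_nhds_eq_on_open[OF S z]])
        also have "\<dots> = (\<lambda>_. 0)" by simp
        finally show ?thesis unfolding eq using z[OF S(2)] \<epsilon> by (simp add: onorm_zero)
      next
        case True
        then have yk: "y \<in> fst (d k)" and yN: "y \<in> N2" using Bk BN by blast+
        let ?\<tau> = "transition (d k) (d j)" and ?\<tau>' = "transition (d j) (d k)"
        let ?S = "overlap (d j) (d k)"
        have tq: "?\<tau>' q = snd (d k) y" using transition_eq[OF dj yd(1)] yd(2) by simp
        note ctrl = N2(3)[OF yN j, rule_format, OF y(1)]
        have S: "open ?S" "q \<in> ?S" using open_overlap[OF dj dk] yd yk by blast+
        have yo: "snd (d k) y \<in> overlap (d k) (d j)" using yd yk by blast
        have F: "expression E (d j) u = (\<Sum>i\<in>UNIV. w (?\<tau>' u) $ i *\<^sub>R partial_deriv i ?\<tau> (?\<tau>' u))" if u: "u \<in> ?S" for u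
        proof -
          obtain z where z: "z \<in> fst (d j)" "z \<in> fst (d k)" "u = snd (d j) z" using u by blast
          have "?\<tau>' u \<in> ?V" using transition_eq[OF dj z(1)] z by simp
          then have "expression E (d k) (?\<tau>' u) = w (?\<tau>' u)" unfolding E_def by (rule expression_chart_field[OF dk])
          then show ?thesis using expression_change[OF tE dk dj u] by simp
        qed
        have sm: "C_infinity_on (overlap (d k) (d j)) ?\<tau>" by (rule smooth_transition[OF dk dj])
        have d\<tau>: "partial_deriv i ?\<tau> differentiable (at (?\<tau>' q))" for i
          unfolding tq by (rule C_infinity_on_differentiable[OF C_infinity_on_partial[OF sm] yo])
        have d\<tau>': "?\<tau>' differentiable (at q)"
          by (rule C_infinity_on_differentiable[OF smooth_transition[OF dj dk] S(2)])
        note pb = pushforward_bounds[OF S F w_diff d\<tau> d\<tau>' w_norm w_dnorm, of L L2]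
        have c1: "norm (partial_deriv i ?\<tau> (?\<tau>' q)) \<le> L" for i using ctrl unfolding tq by blast
        have c2: "norm (partial_deriv a ?\<tau>' q) \<le> L" for a using ctrl unfolding yd(2)[symmetric] by blast
        have c3: "norm (partial_deriv b (partial_deriv i ?\<tau>) (?\<tau>' q)) \<le> L2" for b i
          using ctrl L2(2)[OF j] unfolding tq by (meson order_trans)
        have \<eta>0: "0 < C * ?\<eta>" using C \<delta> \<epsilon> by simp
        have n0: "0 < ?n" using n1 by simp
        \<comment> \<open>this identity is the reason for the choice of \<open>\<delta>\<close>\<close>
        have val: "?n ^ 3 * L ^ 2 * (C * ?\<eta>) = \<epsilon>/4"
          using n0 L1 C unfolding \<delta>_def by (simp add: field_simps)
        have "?n * L * (C * r * ?\<eta>) \<le> \<epsilon>/2"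
        proof -
          have "?n * L * (C * r * ?\<eta>) = (?n * L * (C * ?\<eta>)) * r" by simp
          also have "\<dots> \<le> (?n * L * (C * ?\<eta>)) * 1" using r n0 L1 \<eta>0 by (intro mult_left_mono) auto
          also have "\<dots> \<le> (?n ^ 3 * L ^ 2) * (C * ?\<eta>)"
          proof -
            have "?n * L \<le> ?n ^ 3 * L ^ 2"
              by (intro mult_mono self_le_power) (use n1 L1 in auto)
            from mult_right_mono[OF this, of "C * ?\<eta>"] show ?thesis using \<eta>0 by simp
          qed
          finally show ?thesis using val \<epsilon> by simp
        qed
        moreover have "?n * (?n * (?n * (C * ?\<eta> * L + C * r * ?\<eta> * L2)) * L) \<le> \<epsilon>/2"
        proof -
          have "C * r * ?\<eta> * L2 = (C * ?\<eta>) * (r * L2)" by simp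
          also have "\<dots> \<le> (C * ?\<eta>) * L" using r(4) L1 \<eta>0 by (intro mult_left_mono) auto
          finally have i: "C * ?\<eta> * L + C * r * ?\<eta> * L2 \<le> 2 * (C * ?\<eta> * L)" by linarith
          have "?n * (?n * (?n * (C * ?\<eta> * L + C * r * ?\<eta> * L2)) * L) \<le> ?n * (?n * (?n * (2 * (C * ?\<eta> * L))) * L)"
            using i n0 L1 by (intro mult_left_mono mult_right_mono) auto
          also have "\<dots> = 2 * (?n ^ 3 * L ^ 2 * (C * ?\<eta>))" by (simp add: power2_eq_square power3_eq_cube)
          finally show ?thesis using val by simp
        qed
        moreover have "norm (expression E (d j) q) \<le> ?n * L * (C * r * ?\<eta>)"
          by (rule pb(1)[OF _ c1 c2 c3])
        moreover have "onorm (frechet_derivative (expression E (d j)) (at q))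
            \<le> ?n * (?n * (?n * (C * ?\<eta> * L + C * r * ?\<eta> * L2)) * L)"
          by (rule pb(2)[OF _ c1 c2 c3])
        ultimately show ?thesis unfolding eq by linarith
      qed
    qed
    have "perturbs_at \<epsilon> s \<beta> v k x A B E"
      unfolding perturbs_at_def using compB E_div E0 near bounds by blast
    then show "\<exists>B\<subseteq>N. \<exists>E. perturbs_at \<epsilon> s \<beta> v k x A B E" using BN by blast
  qed
qed

section \<open>Several points\<close>

lemma disjoint_nbhds:
  assumes "finite S" "S \<subseteq> topspace T"
  obtains N where "\<And>x. x \<in> S \<Longrightarrow> openin T (N x)" "\<And>x. x \<in> S \<Longrightarrow> x \<in> N x"
    "\<And>x y. x \<in> S \<Longrightarrow> y \<in> S \<Longrightarrow> x \<noteq> y \<Longrightarrow> N x \<inter> N y = {}"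
proof -
  let ?sep = "\<lambda>x y P Q. openin T P \<and> openin T Q \<and> x \<in> P \<and> y \<in> Q \<and> P \<inter> Q = {}"
  have "\<exists>W. fst z \<noteq> snd z \<longrightarrow> ?sep (fst z) (snd z) (fst W) (snd W)" if z: "z \<in> S \<times> S" for z
  proof (cases "fst z = snd z")
    case False
    have "fst z \<in> topspace T \<and> snd z \<in> topspace T \<and> fst z \<noteq> snd z" using False z assms(2) by auto
    from Hausdorff[unfolded Hausdorff_space_def, rule_format, OF this]
    obtain P Q where "openin T P" "openin T Q" "fst z \<in> P" "snd z \<in> Q" "disjnt P Q" by (elim exE conjE)
    then show ?thesis by (intro exI[of _ "(P, Q)"]) (simp add: disjnt_def)
  qed simp
  then have "\<exists>W. \<forall>z\<in>S \<times> S. fst z \<noteq> snd z \<longrightarrow> ?sep (fst z) (snd z) (fst (W z)) (snd (W z))"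
    by (intro bchoice ballI)
  then obtain W where W: "\<forall>z\<in>S \<times> S. fst z \<noteq> snd z \<longrightarrow> ?sep (fst z) (snd z) (fst (W z)) (snd (W z))" by (elim exE)
  define P Q where "P x y = fst (W (x, y))" and "Q x y = snd (W (x, y))" for x y
  have PQ: "?sep x y (P x y) (Q x y)" if "x \<in> S" "y \<in> S" "x \<noteq> y" for x y
    using bspec[OF W, of "(x, y)"] that unfolding P_def Q_def by simp
  have "\<exists>N. openin T N \<and> x \<in> N \<and> (\<forall>z\<in>N. \<forall>y\<in>S. y \<noteq> x \<longrightarrow> z \<in> P x y \<inter> Q y x)" if x: "x \<in> S" for x
  proof (rule finite_nbhd[OF assms(1)])
    show "x \<in> topspace T" using x assms by blast
    fix y assume y: "y \<in> S"
    show "\<exists>N. openin T N \<and> x \<in> N \<and> (\<forall>z\<in>N. y \<noteq> x \<longrightarrow> z \<in> P x y \<inter> Q y x)"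
    proof (cases "y = x")
      case True
      then show ?thesis using x assms by (intro exI[of _ "topspace T"]) auto
    next
      case False
      then show ?thesis using PQ[OF x y] PQ[OF y x] by (intro exI[of _ "P x y \<inter> Q y x"]) auto
    qed
  qed
  then have "\<exists>N. \<forall>x\<in>S. openin T (N x) \<and> x \<in> N x \<and> (\<forall>z\<in>N x. \<forall>y\<in>S. y \<noteq> x \<longrightarrow> z \<in> P x y \<inter> Q y x)"
    by (intro bchoice ballI)
  then obtain N where N: "\<And>x. x \<in> S \<Longrightarrow> openin T (N x) \<and> x \<in> N x \<and> (\<forall>z\<in>N x. \<forall>y\<in>S. y \<noteq> x \<longrightarrow> z \<in> P x y \<inter> Q y x)"
    by blast
  show ?thesis
  proof (rule that[of N])
    fix x y assume xy: "x \<in> S" "y \<in> S" "x \<noteq> y"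
    have "z \<notin> N y" if "z \<in> N x" for z
    proof
      assume "z \<in> N y"
      then have "z \<in> Q x y" using N[OF xy(2)] xy by blast
      moreover have "z \<in> P x y" using N[OF xy(1)] xy(2) xy(3)[symmetric] that by blast
      ultimately show False using PQ[OF xy] by blast
    qed
    then show "N x \<inter> N y = {}" by blast
  qed (use N in blast)+
qed

text \<open>A supremum of values at most \<open>\<epsilon>/2\<close> over a nonempty set is at most \<open>\<epsilon>/2\<close>, which turns the pointwise bounds
  into a strict one. The balls are nonempty, and a nonempty manifold needs at least one chart.\<close>

lemma C1_norm_less:
  assumes "\<epsilon> > 0"
    and "\<And>j p. j \<in> {1..m} \<Longrightarrow> p \<in> ball 0 r0 \<Longrightarrow> norm (expression X (c j) p) \<le> \<epsilon>/2"
    and "\<And>j p. j \<in> {1..m} \<Longrightarrow> p \<in> ball 0 r0 \<Longrightarrow> onorm (frechet_derivative (expression X (c j)) (at p)) \<le> \<epsilon>/2"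
  shows "C1_norm m c X < \<epsilon>"
proof -
  have ne: "ball (0::real^'n) r0 \<noteq> {}" using r0 by simp
  have "{1..m} \<noteq> {}"
  proof
    assume "{1..m} = {}"
    then have "(\<Union>j\<in>{1..m}. fst (c j)) = {}" by (simp only: UN_empty)
    then show False using nonempty unfolding cover by contradiction
  qed
  moreover have "max (SUP p\<in>snd (c j) ` fst (c j). norm (expression X (c j) p))
       (SUP p\<in>snd (c j) ` fst (c j). onorm (frechet_derivative (expression X (c j)) (at p))) < \<epsilon>" if j: "j \<in> {1..m}" for j
  proof -
    have "(SUP p\<in>ball 0 r0. norm (expression X (c j) p)) \<le> \<epsilon>/2"
      by (rule cSUP_least[OF ne]) (rule assms(2)[OF j])
    moreover have "(SUP p\<in>ball 0 r0. onorm (frechet_derivative (expression X (c j)) (at p))) \<le> \<epsilon>/2"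
      by (rule cSUP_least[OF ne]) (rule assms(3)[OF j])
    ultimately show ?thesis using assms(1) unfolding c_image[OF j] by simp
  qed
  ultimately show ?thesis unfolding C1_norm_def by (subst Max_less_iff) auto
qed

text \<open>Every point has a neighbourhood on which at most one of the corrections is different from \<open>0\<close>,
  since their supports are closed and lie in disjoint open sets. So the pointwise bounds hold for the
  sum without a factor depending on the number of points.\<close>

lemma glue_perturbations:
  assumes \<epsilon>: "\<epsilon> > 0" and s: "1 \<le> s" and b: "0 \<le> \<beta>" "\<beta> \<le> 1" and v: "v \<in> div_free_fields T \<A> \<omega> m c s \<beta>"
    and S: "finite S" "S \<subseteq> topspace T" "S \<subseteq> T interior_of U"
    and k: "\<And>x. x \<in> S \<Longrightarrow> k x \<in> {1..m} \<and> x \<in> fst (c (k x))"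
    and local: "\<And>x N. x \<in> S \<Longrightarrow> openin T N \<Longrightarrow> x \<in> N \<Longrightarrow> \<exists>B\<subseteq>N. \<exists>E. perturbs_at \<epsilon> s \<beta> v (k x) x (A x) B E"
  shows "\<exists>Z\<in>div_free_fields T \<A> \<omega> m c s \<beta>.
            (\<forall>x\<in>S. \<forall>\<^sub>F y in nhds (snd (c (k x)) x).
               expression Z (c (k x)) y = v x (c (k x)) + A x (y - snd (c (k x)) x)) \<and>
            (\<forall>x\<in>topspace T - U. Z x = v x) \<and>
            C1_norm m c (field_diff Z v) < \<epsilon>"
proof -
  obtain N where N: "\<And>x. x \<in> S \<Longrightarrow> openin T (N x)" "\<And>x. x \<in> S \<Longrightarrow> x \<in> N x"
    "\<And>x y. x \<in> S \<Longrightarrow> y \<in> S \<Longrightarrow> x \<noteq> y \<Longrightarrow> N x \<inter> N y = {}"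
    using disjoint_nbhds[OF S(1,2)] by blast
  have "\<exists>F. snd F \<subseteq> N x \<inter> T interior_of U \<and> perturbs_at \<epsilon> s \<beta> v (k x) x (A x) (snd F) (fst F)" if x: "x \<in> S" for x
  proof -
    have "openin T (N x \<inter> T interior_of U)" "x \<in> N x \<inter> T interior_of U"
      using N(1,2)[OF x] S(3) x by (auto intro: openin_Int openin_interior_of)
    from local[OF x this] show ?thesis by simp blast
  qed
  then have "\<exists>F. \<forall>x\<in>S. snd (F x) \<subseteq> N x \<inter> T interior_of U \<and> perturbs_at \<epsilon> s \<beta> v (k x) x (A x) (snd (F x)) (fst (F x))"
    by (intro bchoice ballI)
  then obtain F where F: "\<forall>x\<in>S. snd (F x) \<subseteq> N x \<inter> T interior_of U \<and> perturbs_at \<epsilon> s \<beta> v (k x) x (A x) (snd (F x)) (fst (F x))"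
    by (elim exE)
  define E B where "E x = fst (F x)" and "B x = snd (F x)" for x
  have B: "B x \<subseteq> N x" "B x \<subseteq> T interior_of U" and pert: "perturbs_at \<epsilon> s \<beta> v (k x) x (A x) (B x) (E x)" if "x \<in> S" for x
    using bspec[OF F that] unfolding E_def B_def by blast+
  have compB: "compactin T (B x)" and E: "E x \<in> div_free_fields T \<A> \<omega> m c s \<beta>"
    and E0: "\<And>y. y \<notin> B x \<Longrightarrow> E x y = (\<lambda>_. 0)"
    and near: "\<forall>\<^sub>F y in nhds (snd (c (k x)) x). expression v (c (k x)) y + expression (E x) (c (k x)) y = v x (c (k x)) + A x (y - snd (c (k x)) x)"
    and bd: "\<And>j p. j \<in> {1..m} \<Longrightarrow> p \<in> ball 0 r0 \<Longrightarrow> norm (expression (E x) (c j) p) \<le> \<epsilon>/2 \<and>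
        onorm (frechet_derivative (expression (E x) (c j)) (at p)) \<le> \<epsilon>/2"
    if "x \<in> S" for x
    using pert[OF that] unfolding perturbs_at_def by blast+
  define Z where "Z = (\<lambda>y \<kappa>. v y \<kappa> + (\<Sum>x\<in>S. E x y \<kappa>))"
  have Z_div: "Z \<in> div_free_fields T \<A> \<omega> m c s \<beta>"
    unfolding Z_def by (rule div_free_field_sum[OF s b S(1) v E])
  have single: "(\<Sum>x'\<in>S. E x' y \<kappa>) = E x y \<kappa>" if x: "x \<in> S" and y: "y \<in> N x" for x y \<kappa>
  proof -
    have "E x' y \<kappa> = 0" if x': "x' \<in> S - {x}" for x'
    proof -
      have "y \<notin> B x'" using N(3)[of x x'] x x' y B(1)[of x'] by blast
      then show ?thesis using E0[of x' y] x' by simp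
    qed
    then show ?thesis using sum.remove[OF S(1) x, of "\<lambda>x'. E x' y \<kappa>"] by simp
  qed
  have none: "(\<Sum>x\<in>S. E x y \<kappa>) = 0" if "\<And>x. x \<in> S \<Longrightarrow> y \<notin> B x" for y \<kappa>
    using E0 that by (intro sum.neutral) auto
  have "\<forall>\<^sub>F y in nhds (snd (c (k x)) x). expression Z (c (k x)) y = v x (c (k x)) + A x (y - snd (c (k x)) x)" if x: "x \<in> S" for x
  proof -
    let ?\<kappa> = "c (k x)"
    have \<kappa>: "?\<kappa> \<in> \<A>" "x \<in> fst ?\<kappa>" using k x c_atlas by blast+
    let ?O = "snd ?\<kappa> ` (fst ?\<kappa> \<inter> N x)"
    have "expression Z ?\<kappa> q = expression v ?\<kappa> q + expression (E x) ?\<kappa> q" if q: "q \<in> ?O" for q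
    proof -
      obtain y where y: "y \<in> fst ?\<kappa>" "y \<in> N x" "q = snd ?\<kappa> y" using q by blast
      then show ?thesis using expression_at[OF \<kappa>(1) y(1)] single[OF x y(2)] by (simp add: Z_def)
    qed
    then have "\<forall>\<^sub>F q in nhds (snd ?\<kappa> x). expression Z ?\<kappa> q = expression v ?\<kappa> q + expression (E x) ?\<kappa> q"
      by (intro eventually_nhds_eq_on_open[OF open_chart_image[OF \<kappa>(1) N(1)[OF x]]]) (use \<kappa> N(2)[OF x] in blast)+
    with near[OF x] show ?thesis by eventually_elim simp
  qed
  moreover have "Z y = v y" if y: "y \<in> topspace T - U" for y
  proof -
    have "y \<notin> B x" if "x \<in> S" for x using B(2)[OF that] y interior_of_subset[of T U] by blast
    then show ?thesis using none[of y] by (simp add: Z_def fun_eq_iff)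
  qed
  moreover have "C1_norm m c (field_diff Z v) < \<epsilon>"
  proof -
    have D: "field_diff Z v y \<kappa> = (\<Sum>x\<in>S. E x y \<kappa>)" for y \<kappa> by (simp add: field_diff_def Z_def)
    have both: "norm (expression (field_diff Z v) (c j) p) \<le> \<epsilon>/2 \<and>
        onorm (frechet_derivative (expression (field_diff Z v) (c j)) (at p)) \<le> \<epsilon>/2"
      if j: "j \<in> {1..m}" and p: "p \<in> ball 0 r0" for j p
    proof -
      have cj: "c j \<in> \<A>" by (rule c_atlas[OF j])
      obtain y where y: "y \<in> fst (c j)" "p = snd (c j) y" using p c_image[OF j] by blast
      have yT: "y \<in> topspace T" using y chart_subset[OF cj] by blast
      have eqI: "expression (field_diff Z v) (c j) p = f p \<and>
           frechet_derivative (expression (field_diff Z v) (c j)) (at p) = frechet_derivative f (at p)"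
        if M: "openin T M" "y \<in> M" and f: "\<And>z. z \<in> fst (c j) \<Longrightarrow> z \<in> M \<Longrightarrow> (\<Sum>x\<in>S. E x z (c j)) = f (snd (c j) z)" for M f
      proof -
        let ?O = "snd (c j) ` (fst (c j) \<inter> M)"
        have O: "open ?O" "p \<in> ?O" using open_chart_image[OF cj M(1)] M y by blast+
        have e: "expression (field_diff Z v) (c j) q = f q" if q: "q \<in> ?O" for q
        proof -
          obtain z where z: "z \<in> fst (c j)" "z \<in> M" "q = snd (c j) z" using q by blast
          then show ?thesis using expression_at[OF cj z(1), of "field_diff Z v"] f[OF z(1,2)] by (simp add: D)
        qed
        show ?thesis
          by (intro conjI e[OF O(2)] frechet_derivative_eventually_eq[OF eventually_nhds_eq_on_open[OF O e]])
      qed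
      show ?thesis
      proof (cases "\<exists>x\<in>S. y \<in> B x")
        case True
        then obtain x where x: "x \<in> S" "y \<in> N x" using B(1) by blast
        have "(\<Sum>x\<in>S. E x z (c j)) = expression (E x) (c j) (snd (c j) z)" if "z \<in> fst (c j)" "z \<in> N x" for z
          using single[OF x(1) that(2)] expression_at[OF cj that(1)] by simp
        from eqI[OF N(1)[OF x(1)] x(2) this] show ?thesis using bd[OF x(1) j p] by simp
      next
        case False
        let ?M = "topspace T - (\<Union>x\<in>S. B x)"
        have "closedin T (\<Union>x\<in>S. B x)"
          by (rule closedin_Union) (use S compB compactin_imp_closedin[OF Hausdorff] in auto)
        then have M: "openin T ?M" by (intro openin_diff openin_topspace)
        have "(\<Sum>x\<in>S. E x z (c j)) = (\<lambda>_. 0) (snd (c j) z)" if "z \<in> fst (c j)" "z \<in> ?M" for z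
          using none[of z] that by simp
        from eqI[OF M _ this] False yT
        have "expression (field_diff Z v) (c j) p = 0 \<and>
           frechet_derivative (expression (field_diff Z v) (c j)) (at p) = (\<lambda>_. 0)" by simp
        then show ?thesis using \<epsilon> by (simp add: onorm_zero)
      qed
    qed
    show ?thesis by (rule C1_norm_less[OF \<epsilon>]) (use both in blast)+
  qed
  ultimately show ?thesis using Z_div by blast
qed

end

lemma regular_conservative_atlas_manifold:
  assumes man: "closed_manifold T \<A>" and form: "volume_form T \<A> \<omega>" and reg: "regular_conservative_atlas T \<A> \<omega> m c"
  obtains d r0 where "conservative_manifold T \<A> \<omega> m c d r0"
proof -
  obtain d where d: "conservative_atlas T \<A> \<omega> m d" "conservative_atlas T \<A> \<omega> m c"
    "\<forall>i\<in>{1..m}. T closure_of fst (c i) \<subseteq> fst (d i) \<and> (\<forall>x\<in>fst (c i). snd (d i) x = snd (c i) x)"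
    using reg unfolding regular_conservative_atlas_def by blast
  obtain r0 where r0: "r0 > 0" "\<forall>i\<in>{1..m}. snd (c i) ` fst (c i) = ball 0 r0"
    using d(2) unfolding conservative_atlas_def by blast
  have "conservative_manifold T \<A> \<omega> m c d r0"
  proof unfold_locales
    show "smooth_structure T \<A>" "Hausdorff_space T" "compact_space T" "topspace T \<noteq> {}"
      using man unfolding closed_manifold_def by blast+
    show "(\<Union>j\<in>{1..m}. fst (c j)) = topspace T" using d(2) unfolding conservative_atlas_def by blast
    show "volume_form T \<A> \<omega>" by (rule form)
    show "r0 > 0" by (rule r0(1))
    fix j assume j: "j \<in> {1..m}"
    show "c j \<in> \<A>" using d(2) j unfolding conservative_atlas_def by blast
    show "d j \<in> \<A>" "conservative_chart \<A> \<omega> (d j)" using d(1) j unfolding conservative_atlas_def by blast+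
    show "snd (c j) ` fst (c j) = ball 0 r0" using r0 j by blast
    show "T closure_of fst (c j) \<subseteq> fst (d j)" using d(3) j by blast
    show "snd (d j) x = snd (c j) x" if "x \<in> fst (c j)" for x using d(3) j that by blast
  qed
  then show ?thesis by (rule that)
qed

theorem theorem6:
  fixes T :: "'a topology"
    and \<A> :: "('a, 'n::finite) chart set"
    and \<omega> :: "('a, 'n) top_form"
    and m :: nat
    and c :: "nat \<Rightarrow> ('a, 'n) chart"
  assumes "CARD('n) \<ge> 2"
    and "closed_manifold T \<A>"
    and "orientable T \<A>"
    and "volume_form T \<A> \<omega>"
    and "regular_conservative_atlas T \<A> \<omega> m c"
  shows "\<exists>\<delta>>0. \<forall>(\<epsilon>::real) (s::enat) (\<beta>::real) (v::('a, 'n) field) (S::'a set) (U::'a set)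
           (k::'a \<Rightarrow> nat) (A::'a \<Rightarrow> real^'n \<Rightarrow> real^'n).
      \<epsilon> > 0 \<and> 1 \<le> s \<and> 0 \<le> \<beta> \<and> \<beta> \<le> 1 \<and> v \<in> div_free_fields T \<A> \<omega> m c s \<beta> \<and>
      finite S \<and> S \<subseteq> topspace T \<and> U \<subseteq> topspace T \<and> S \<subseteq> T interior_of U \<and>
      (\<forall>x\<in>S. k x \<in> {1..m} \<and> x \<in> fst (c (k x))) \<and>
      (\<forall>x\<in>S. linear (A x) \<and> trace (matrix (A x)) = 0 \<and>
         onorm (\<lambda>h. A x h - frechet_derivative (expression v (c (k x))) (at (snd (c (k x)) x)) h)
           < \<delta> * \<epsilon>)
      \<longrightarrow> (\<exists>Z\<in>div_free_fields T \<A> \<omega> m c s \<beta>.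
            (\<forall>x\<in>S. \<forall>\<^sub>F y in nhds (snd (c (k x)) x).
               expression Z (c (k x)) y = v x (c (k x)) + A x (y - snd (c (k x)) x)) \<and>
            (\<forall>x\<in>topspace T - U. Z x = v x) \<and>
            C1_norm m c (field_diff Z v) < \<epsilon>)"
proof -
  obtain d r0 where "conservative_manifold T \<A> \<omega> m c d r0"
    using regular_conservative_atlas_manifold[OF assms(2,4,5)] .
  then interpret conservative_manifold T \<A> \<omega> m c d r0 .
  obtain \<delta> where \<delta>: "\<delta> > 0" and local:
    "\<And>\<epsilon> s \<beta> v k x N A. \<epsilon> > 0 \<Longrightarrow> 1 \<le> s \<Longrightarrow> 0 \<le> \<beta> \<Longrightarrow> \<beta> \<le> 1 \<Longrightarrow> v \<in> div_free_fields T \<A> \<omega> m c s \<beta> \<Longrightarrow>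
      k \<in> {1..m} \<Longrightarrow> x \<in> fst (c k) \<Longrightarrow> openin T N \<Longrightarrow> x \<in> N \<Longrightarrow> linear A \<Longrightarrow> trace (matrix A) = 0 \<Longrightarrow>
      onorm (\<lambda>h. A h - frechet_derivative (expression v (c k)) (at (snd (c k) x)) h) < \<delta> * \<epsilon> \<Longrightarrow>
      \<exists>B\<subseteq>N. \<exists>E. perturbs_at \<epsilon> s \<beta> v k x A B E"
    using perturbation_at_point[OF assms(1)] by blast
  show ?thesis
  proof (intro exI[of _ \<delta>] conjI \<delta> allI impI, elim conjE)
    fix \<epsilon> \<beta> :: real and s v S U k and A :: "'a \<Rightarrow> real^'n \<Rightarrow> real^'n"
    assume h: "\<epsilon> > 0" "1 \<le> s" "0 \<le> \<beta>" "\<beta> \<le> 1" "v \<in> div_free_fields T \<A> \<omega> m c s \<beta>"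
      and S: "finite S" "S \<subseteq> topspace T" "S \<subseteq> T interior_of U"
      and k: "\<forall>x\<in>S. k x \<in> {1..m} \<and> x \<in> fst (c (k x))"
      and A: "\<forall>x\<in>S. linear (A x) \<and> trace (matrix (A x)) = 0 \<and>
         onorm (\<lambda>h. A x h - frechet_derivative (expression v (c (k x))) (at (snd (c (k x)) x)) h) < \<delta> * \<epsilon>"
    show "\<exists>Z\<in>div_free_fields T \<A> \<omega> m c s \<beta>.
            (\<forall>x\<in>S. \<forall>\<^sub>F y in nhds (snd (c (k x)) x).
               expression Z (c (k x)) y = v x (c (k x)) + A x (y - snd (c (k x)) x)) \<and>
            (\<forall>x\<in>topspace T - U. Z x = v x) \<and>
            C1_norm m c (field_diff Z v) < \<epsilon>"
    proof (rule glue_perturbations[OF h S])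
      show "k x \<in> {1..m} \<and> x \<in> fst (c (k x))" if "x \<in> S" for x using k that by blast
      show "\<exists>B\<subseteq>N. \<exists>E. perturbs_at \<epsilon> s \<beta> v (k x) x (A x) B E"
        if x: "x \<in> S" and N: "openin T N" "x \<in> N" for x N
        by (rule local[OF h _ _ N]) (use k A x in blast)+
    qed
  qed
qed

end
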